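(* Assume that for all $1\le j\le i$, $\mathbb{E}(X_{ij}\mid\mathcal{F}_{ij}^{1})=0$ a.s.; that $\sup_{n}\frac{1}{n^{2}}\sum_{1\le j\le i\le n}\sigma_{ij}^{2}<\infty$; that $$\lim_{a\to\infty}\limsup_{n\to\infty}\frac{1}{n^{2}}\sum_{1\le j\le i\le n}\big\Vert\mathbb{E}(X_{ij}^{2}-\sigma_{ij}^{2}\mid\mathcal{F}_{ij}^{a})\big\Vert_{1}=0;$$ and that for any $\varepsilon>0$, $\frac{1}{n^{2}}\sum_{1\le j\le i\le n}\mathbb{E}\big(X_{ij}^{2}I(|X_{ij}|>\varepsilon n^{1/2})\big)\to 0$ as $n\to\infty$. Assume besides that $$\frac{1}{n^{2}}\sum_{1\le j\le i\le n}|\sigma_{ij}^{2}-1|\to0\quad\text{as }n\to\infty.$$ Then $$\mathbf{F}^{\mathbb{X}_{n}}\Rightarrow G\quad\text{in probability},$$ where $G$ is the distribution function of the standard semicircle law.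
   Context: $(X_{ij})_{(i,j)\in\mathbb{Z}^{2}}$ are real-valued random variables on a probability space $(\Omega,\mathcal{F},\mathbb{P})$ with $\mathbb{E}(X_{ij})=0$ and $\mathbb{E}(X_{ij}^{2})=\sigma_{ij}^{2}<\infty$. $\mathbf{X}_{n}$ is the symmetric $n\times n$ matrix with $(\mathbf{X}_{n})_{ij}=X_{ij}$ for $i\ge j$ and $(\mathbf{X}_{n})_{ij}=X_{ji}$ for $i<j$; $\mathbb{X}_{n}=n^{-1/2}\mathbf{X}_{n}$. For a symmetric $n\times n$ matrix $A$ with eigenvalues $\lambda_1\le\dots\le\lambda_n$, $\mathbf{F}^{A}(t)=\frac1n\sum_{k=1}^{n}I(\lambda_{k}\le t)$. The Lévy distance is $d(F,G)=\inf\{\varepsilon>0: F(x-\varepsilon)-\varepsilon\le G(x)\le F(x+\varepsilon)+\varepsilon\ \text{for all }x\}$. "$\mathbf{F}_n\Rightarrow\mathbf{F}$ in probability" means $\lim_{n\to\infty}\mathbb{P}(d(\mathbf{F}_n,\mathbf{F})>\epsilon)=0$ for all $\epsilon>0$. Lexicographic order on $\mathbb{Z}^{2}$: $(u,v)\le_{\mathrm{lex}}(i,j)$ means $u<i$, or $u=i$ and $v\le j$. For a non-negative integer $a$, let $B_{ij}^{a}=\{(u,v)\in\mathbb{Z}^{2}:\max(|u-i|,|v-j|)\ge a,\ (u,v)\le_{\mathrm{lex}}(i,j)\}$, and for $i\ge j$ let $\mathcal{F}_{ij}^{a}=\sigma(X_{uv}:(u,v)\in B_{ij}^{a}\text{ and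 }v\le u)$ (the trivial $\sigma$-algebra if $B_{ij}^a=\emptyset$). $\Vert X\Vert_{p}=(\mathbb{E}|X|^{p})^{1/p}$, and $I(\cdot)$ is the indicator. The standard semicircle law has density $g(x)=\frac{1}{2\pi}\sqrt{4-x^{2}}\,I(|x|\le2)$ and distribution function $G(x)=\int_{-\infty}^{x}g(u)\,du$. *)

theory Defs
  imports "HOL-Probability.Probability" "Jordan_Normal_Form.Char_Poly"
begin

text \<open>Random fields on \<open>\<int>\<^sup>2\<close> have type \<open>int \<Rightarrow> int \<Rightarrow> 'a \<Rightarrow> real\<close>. Matrices are those of
  \<^theory>\<open>Jordan_Normal_Form.Matrix\<close>, indexed from 0, whence the shift by one below.\<close>

definition field_mat :: "(int \<Rightarrow> int \<Rightarrow> 'a \<Rightarrow> real) \<Rightarrow> nat \<Rightarrow> 'a \<Rightarrow> real mat" where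
  "field_mat X n \<omega> = Matrix.mat n n (\<lambda>(k, l).
     let i = int k + 1; j = int l + 1 in if i \<ge> j then X i j \<omega> else X j i \<omega>)"

definition normalized_field_mat :: "(int \<Rightarrow> int \<Rightarrow> 'a \<Rightarrow> real) \<Rightarrow> nat \<Rightarrow> 'a \<Rightarrow> real mat" where
  "normalized_field_mat X n \<omega> = (1 / sqrt (real n)) \<cdot>\<^sub>m field_mat X n \<omega>"

text \<open>Eigenvalues are counted with multiplicity, as roots of the characteristic polynomial. For a
  real symmetric matrix the polynomial splits over the reals, so there are exactly \<open>dim_row A\<close>
  of them.\<close>

definition eigenvalues :: "real mat \<Rightarrow> real multiset" where
  "eigenvalues A = proots (char_poly A)"

definition spectral_cdf :: "real mat \<Rightarrow> real \<Rightarrow> real" where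
  "spectral_cdf A t = (1 / real (dim_row A)) * (\<Sum>l\<in>#eigenvalues A. of_bool (l \<le> t))"

definition levy_dist :: "(real \<Rightarrow> real) \<Rightarrow> (real \<Rightarrow> real) \<Rightarrow> real" where
  "levy_dist F G = Inf {\<epsilon>. \<epsilon> > 0 \<and> (\<forall>x. F (x - \<epsilon>) - \<epsilon> \<le> G x \<and> G x \<le> F (x + \<epsilon>) + \<epsilon>)}"

text \<open>The event is measurable whenever each \<open>Fn n \<omega>\<close> is a distribution function with
  \<open>\<omega> \<mapsto> Fn n \<omega> x\<close> measurable: by one-sided continuity countably many \<open>x\<close> and \<open>\<epsilon>\<close> determine
  the distance. So \<^const>\<open>measure\<close> does not default to 0 there.\<close>

definition cdf_tendsto_in_prob ::
  "'a measure \<Rightarrow> (nat \<Rightarrow> 'a \<Rightarrow> real \<Rightarrow> real) \<Rightarrow> (real \<Rightarrow> real) \<Rightarrow> bool" where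
  "cdf_tendsto_in_prob M Fn F \<longleftrightarrow>
     (\<forall>\<epsilon>>0. (\<lambda>n. measure M {\<omega> \<in> space M. levy_dist (Fn n \<omega>) F > \<epsilon>}) \<longlonglongrightarrow> 0)"

definition lex_le :: "int \<times> int \<Rightarrow> int \<times> int \<Rightarrow> bool" where
  "lex_le = (\<lambda>(u, v) (i, j). u < i \<or> (u = i \<and> v \<le> j))"

definition past_set :: "nat \<Rightarrow> int \<Rightarrow> int \<Rightarrow> (int \<times> int) set" where
  "past_set a i j = {(u, v). max \<bar>u - i\<bar> \<bar>v - j\<bar> \<ge> int a \<and> lex_le (u, v) (i, j)}"

text \<open>A supremum of \<^const>\<open>vimage_algebra\<close>s would have empty underlying space when the index set
  is empty, whereas \<open>sigma (space M) {}\<close> is the trivial \<open>\<sigma>\<close>-algebra.\<close>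

definition past_sigma :: "'a measure \<Rightarrow> (int \<Rightarrow> int \<Rightarrow> 'a \<Rightarrow> real) \<Rightarrow> nat \<Rightarrow> int \<Rightarrow> int \<Rightarrow> 'a measure"
  where
  "past_sigma M X a i j = sigma (space M)
     {X u v -` A \<inter> space M | u v A. (u, v) \<in> past_set a i j \<and> v \<le> u \<and> A \<in> sets borel}"

definition Lp_norm :: "'a measure \<Rightarrow> real \<Rightarrow> ('a \<Rightarrow> real) \<Rightarrow> real" where
  "Lp_norm M p f = (\<integral>\<omega>. \<bar>f \<omega>\<bar> powr p \<partial>M) powr (1 / p)"

definition tri_avg :: "nat \<Rightarrow> (int \<Rightarrow> int \<Rightarrow> real) \<Rightarrow> real" where
  "tri_avg n f = (1 / (real n)\<^sup>2) * (\<Sum>i = 1..int n. \<Sum>j = 1..i. f i j)"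

definition semicircle_density :: "real \<Rightarrow> real" where
  "semicircle_density x = 1 / (2 * pi) * sqrt (4 - x\<^sup>2) * indicator {y. \<bar>y\<bar> \<le> 2} x"

definition semicircle_cdf :: "real \<Rightarrow> real" where
  "semicircle_cdf x = (\<integral>u\<in>{..x}. semicircle_density u \<partial>lborel)"

end

theory Submission
  imports Defs "HOL-Real_Asymp.Real_Asymp"
begin

text \<open>
  Fix \<open>z\<close> with positive imaginary part, let \<open>S\<close> be the Stieltjes transform at \<open>z\<close> of the empirical
  spectral distribution, that is \<open>1/n\<close> times the trace of the resolvent, and let
  \<open>P(s) = 1 + z s + s\<^sup>2\<close>. The Stieltjes transform of the semicircle law is the root of \<open>P\<close> with
  positive imaginary part, and the other root lies below the real axis, so \<open>S\<close> is close to the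
  right root as soon as \<open>P(S)\<close> is small (lemma \<open>defect_root\<close>). Everything therefore rests on
  \<open>E |P(S)|\<^sup>2 \<longrightarrow> 0\<close>. Working with the square of the modulus instead of \<open>P(S)\<close> itself yields
  convergence in probability directly, without a concentration inequality, which dependent
  entries would not provide.

  The expectation is computed by Lindeberg's method. The entries are replaced, from the
  lexicographically last to the first, by independent random signs. When the entry \<open>p\<close> is replaced,
  all later entries are signs already and all earlier ones are still original. As a function of
  the entry \<open>x\<close> at \<open>p\<close>, the quantity \<open>|P(S)|\<^sup>2\<close> is \<open>f + x A / \<surd>n + x\<^sup>2 B / n\<close> up to a remainder,
  where \<open>A\<close> and \<open>B\<close> are of order \<open>1/n\<close> and depend on the other entries only
  (\<open>sq_defect_taylor\<close>). The linear term has mean zero by the martingale difference property. In the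
  quadratic term the conditional variance is available only given the entries at distance at
  least \<open>a\<close>, so the entries nearer to \<open>p\<close> are set to zero inside \<open>B\<close>. That costs
  \<open>n\<^sup>-\<^sup>2 E (X\<^sub>p\<^sup>2 min 1 (|X\<^sub>q| / \<surd>n))\<close> for each such entry \<open>q\<close>, and the Lindeberg condition bounds this
  without any truncation of the entries, because
  \<open>X\<^sub>p\<^sup>2 I(|X\<^sub>q| > c) \<le> X\<^sub>p\<^sup>2 I(|X\<^sub>p| > c) + X\<^sub>q\<^sup>2 I(|X\<^sub>q| > c)\<close> (\<open>neighbour_bound\<close>, \<open>lindeberg_step\<close>).

  For a matrix of independent signs, \<open>1 + z S\<close> is a weighted sum of the entries times resolvent
  entries. Averaging over one sign is a discrete integration by parts, which turns this sum into
  \<open>-S\<^sup>2\<close> up to \<open>O(n\<^sup>-\<^sup>1\<^sup>/\<^sup>2)\<close>; hence \<open>E |P(S)|\<^sup>2\<close> is small there (\<open>sign_avg_sq_defect\<close>).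

  Finally, \<open>Im S(E + i \<eta>) / \<pi>\<close> is the density at \<open>E\<close> of the spectral distribution convolved with a
  Cauchy law of scale \<open>\<eta>\<close>. For small \<open>\<eta>\<close> it is close to the semicircle density at finitely many
  points, with high probability, hence on \<open>[-3, 3]\<close> by Lipschitz continuity. Integration gives
  closeness of the distribution functions there; outside \<open>[-3, 3]\<close> both laws have little mass, as the
  semicircle law has none (\<open>levy_dist_le\<close>).
\<close>

section \<open>Matrices with bounded operator norm\<close>

unbundle no vec_syntax
hide_const (open) Finite_Cartesian_Product.mat Finite_Cartesian_Product.row Finite_Cartesian_Product.vec Determinants.det

definition vec_len :: "complex Matrix.vec \<Rightarrow> real" where
  "vec_len v = L2_set (\<lambda>i. cmod (v $ i)) {..<dim_vec v}"

text \<open>The carrier and sign conditions are part of the notion, so that bounds of products compose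
  without side conditions.\<close>

definition op_bound :: "nat \<Rightarrow> real \<Rightarrow> complex mat \<Rightarrow> bool" where
  "op_bound n c A \<longleftrightarrow> A \<in> carrier_mat n n \<and> 0 \<le> c \<and>
     (\<forall>v\<in>carrier_vec n. vec_len (A *\<^sub>v v) \<le> c * vec_len v)"

lemma vec_len_nonneg [simp]: "0 \<le> vec_len v"
  by (simp add: vec_len_def)

lemma op_boundD:
  assumes "op_bound n c A"
  shows "A \<in> carrier_mat n n" "0 \<le> c" "v \<in> carrier_vec n \<Longrightarrow> vec_len (A *\<^sub>v v) \<le> c * vec_len v"
  using assms by (auto simp: op_bound_def)

lemma op_bound_mult:
  assumes "op_bound n c A" "op_bound n d B"
  shows "op_bound n (c * d) (A * B)"
  unfolding op_bound_def
proof (intro conjI ballI)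
  note A = op_boundD[OF assms(1)] and B = op_boundD[OF assms(2)]
  show "A * B \<in> carrier_mat n n" "0 \<le> c * d" using A B by auto
  fix v :: "complex Matrix.vec" assume v: "v \<in> carrier_vec n"
  have "vec_len (A * B *\<^sub>v v) = vec_len (A *\<^sub>v (B *\<^sub>v v))"
    using A(1) B(1) v by (simp add: assoc_mult_mat_vec)
  also have "\<dots> \<le> c * vec_len (B *\<^sub>v v)" using A(3) B(1) v by simp
  also have "\<dots> \<le> c * (d * vec_len v)" using A(2) B(3)[OF v] by (intro mult_left_mono)
  finally show "vec_len (A * B *\<^sub>v v) \<le> c * d * vec_len v" by (simp add: mult.assoc)
qed

lemma op_bound_mono: "op_bound n c A \<Longrightarrow> c \<le> d \<Longrightarrow> op_bound n d A"
  unfolding op_bound_def by (smt (verit, best) mult_right_mono vec_len_nonneg)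

lemma op_bound_one: "op_bound n 1 (1\<^sub>m n)"
  by (auto simp: op_bound_def)

lemma op_bound_column:
  assumes "op_bound n c A" "j < n"
  shows "(\<Sum>i<n. (cmod (A $$ (i,j)))^2) \<le> c^2"
proof -
  note A = op_boundD[OF assms(1)]
  have e: "(A *\<^sub>v unit_vec n j) $ i = A $$ (i,j)" if "i < n" for i
    using A(1) that assms(2) by simp
  have "vec_len (unit_vec n j) = 1"
  proof -
    have "vec_len (unit_vec n j) = sqrt (\<Sum>i<n. if i = j then 1 else 0)"
      unfolding vec_len_def L2_set_def using assms(2)
      by (intro arg_cong[where f=sqrt] sum.cong) (auto simp: unit_vec_def)
    then show ?thesis using assms(2) by simp
  qed
  then have "vec_len (A *\<^sub>v unit_vec n j) \<le> c" using A(3)[of "unit_vec n j"] by simp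
  moreover have "vec_len (A *\<^sub>v unit_vec n j) = sqrt (\<Sum>i<n. (cmod (A $$ (i,j)))^2)"
    using A(1) by (auto simp: vec_len_def L2_set_def e simp del: index_mult_mat_vec intro!: sum.cong)
  ultimately show ?thesis using A(2) by (metis abs_of_nonneg real_sqrt_abs real_sqrt_le_iff)
qed

lemma op_bound_entry:
  assumes "op_bound n c A" "i < n" "j < n"
  shows "cmod (A $$ (i,j)) \<le> c"
proof -
  have "(cmod (A $$ (i,j)))^2 \<le> (\<Sum>i<n. (cmod (A $$ (i,j)))^2)"
    using assms(2) by (intro member_le_sum) auto
  also have "\<dots> \<le> c^2" by (rule op_bound_column[OF assms(1,3)])
  finally show ?thesis using op_boundD(2)[OF assms(1)] by (simp add: abs_le_square_iff[symmetric])
qed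

definition tri :: "nat \<Rightarrow> (nat \<times> nat) set" where
  "tri n = {(k, l). l \<le> k \<and> k < n}"

text \<open>The direction in which a symmetric matrix moves when its entry \<open>p\<close> in the lower triangle, and with
  it the mirror entry, changes.\<close>

definition sym_unit :: "nat \<Rightarrow> nat \<times> nat \<Rightarrow> complex mat" where
  "sym_unit n p = mat n n (\<lambda>(k, l). if (max k l, min k l) = p then 1 else 0)"

definition mtr :: "complex mat \<Rightarrow> complex" where
  "mtr A = (\<Sum>i<dim_row A. A $$ (i,i))"

text \<open>The trace of the product of \<open>A\<close> with \<^term>\<open>sym_unit n p\<close>: all that the trace of a resolvent sees
  of a change of the entry \<open>p\<close> (lemma \<open>mtr_sym_unit\<close>).\<close>

definition etr :: "nat \<times> nat \<Rightarrow> complex mat \<Rightarrow> complex" where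
  "etr p A = (if fst p = snd p then A $$ p else A $$ p + A $$ prod.swap p)"

lemma sym_unit_carrier [simp]: "sym_unit n p \<in> carrier_mat n n" "dim_row (sym_unit n p) = n"
  "dim_col (sym_unit n p) = n"
  by (auto simp: sym_unit_def)

lemma sym_unit_index: "k < n \<Longrightarrow> l < n \<Longrightarrow> j \<le> i \<Longrightarrow>
    sym_unit n (i,j) $$ (k,l) = (if k = i \<and> l = j \<or> k = j \<and> l = i then 1 else 0)"
  by (auto simp: sym_unit_def)

lemma sum_sym_unit:
  assumes "(i,j) \<in> tri n" "k < n"
  shows "(\<Sum>l<n. sym_unit n (i,j) $$ (k,l) * f l) =
    (if k = i then f j else if k = j then f i else (0::complex))"
proof -
  have "(\<Sum>l<n. sym_unit n (i,j) $$ (k,l) * f l) =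
    (\<Sum>l<n. if l = (if k = i then j else i) then (if k = i \<or> k = j then f l else 0) else 0)"
    using assms by (intro sum.cong) (auto simp: sym_unit_index tri_def)
  also have "\<dots> = (if k = i then f j else if k = j then f i else 0)"
    using assms by (subst sum.delta) (auto simp: tri_def)
  finally show ?thesis .
qed

text \<open>The matrix restricts a vector to the two coordinates of \<open>p\<close> and swaps them, so each component of
  the image is bounded by the corresponding component of a permuted vector.\<close>

lemma op_bound_sym_unit:
  assumes "p \<in> tri n"
  shows "op_bound n 1 (sym_unit n p)"
proof -
  obtain i j where p: "p = (i,j)" by force
  have ij: "i < n" "j < n" using assms by (auto simp: p tri_def)
  have "vec_len (sym_unit n p *\<^sub>v v) \<le> vec_len v" if v: "v \<in> carrier_vec n" for v
  proof -
    have "(sym_unit n p *\<^sub>v v) $ k = (if k = i then v $ j else if k = j then v $ i else 0)"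
      if k: "k < n" for k
    proof -
      have "(sym_unit n p *\<^sub>v v) $ k = (\<Sum>l<n. sym_unit n p $$ (k,l) * v $ l)"
        using v k by (simp add: scalar_prod_def lessThan_atLeast0 carrier_vecD)
      then show ?thesis using sum_sym_unit[of i j n k "\<lambda>l. v $ l"] assms k by (simp add: p)
    qed
    then have "cmod ((sym_unit n p *\<^sub>v v) $ k) \<le> cmod (v $ Transposition.transpose i j k)" if "k < n" for k
      using that by (auto simp: Transposition.transpose_def)
    then have "(\<Sum>k<n. (cmod ((sym_unit n p *\<^sub>v v) $ k))^2) \<le> (\<Sum>k<n. (cmod (v $ Transposition.transpose i j k))^2)"
      by (intro sum_mono power_mono) auto
    also have "\<dots> = (\<Sum>k<n. (cmod (v $ k))^2)"
      by (rule sum.reindex_bij_witness[where i="Transposition.transpose i j" and j="Transposition.transpose i j"])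
        (use ij in \<open>auto simp: Transposition.transpose_def\<close>)
    finally show ?thesis using v by (simp add: vec_len_def L2_set_def carrier_vecD)
  qed
  then show ?thesis by (auto simp: op_bound_def)
qed

lemma etr_bound:
  assumes "op_bound n c A" "p \<in> tri n"
  shows "cmod (etr p A) \<le> 2 * c"
proof -
  obtain i j where p: "p = (i,j)" by force
  have ij: "i < n" "j < n" using assms by (auto simp: p tri_def)
  then show ?thesis
    using op_bound_entry[OF assms(1) ij] op_bound_entry[OF assms(1) ij(2,1)] op_boundD(2)[OF assms(1)]
    by (auto simp: etr_def p intro: order_trans[OF norm_triangle_ineq])
qed

lemma mtr_sym_unit:
  assumes p: "p \<in> tri n" and A: "A \<in> carrier_mat n n" and B: "B \<in> carrier_mat n n"
  shows "mtr (A * (sym_unit n p * B)) = etr p (B * A)"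
proof -
  obtain i j where [simp]: "p = (i,j)" by force
  have ij: "i < n" "j < n" using assms by (auto simp: tri_def)
  have EB: "(sym_unit n p * B) $$ (k,l) = (if k = i then B $$ (j,l) else if k = j then B $$ (i,l) else 0)"
    if "k < n" "l < n" for k l
    using sum_sym_unit[of i j n k "\<lambda>m. B $$ (m,l)"] that p B
    by (simp add: scalar_prod_def lessThan_atLeast0 times_mat_def)
  have BA: "(B * A) $$ (k,l) = (\<Sum>m<n. A $$ (m,l) * B $$ (k,m))" if "k < n" "l < n" for k l
    using that A B by (simp add: scalar_prod_def lessThan_atLeast0 mult.commute)
  have "mtr (A * (sym_unit n p * B)) = (\<Sum>m<n. \<Sum>k<n. A $$ (m,k) * (sym_unit n p * B) $$ (k,m))"
    unfolding mtr_def using A B by (auto simp: scalar_prod_def lessThan_atLeast0 intro!: sum.cong)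
  also have "\<dots> = (\<Sum>m<n. \<Sum>k<n. A $$ (m,k) * (if k = i then B $$ (j,m) else if k = j then B $$ (i,m) else 0))"
    by (intro sum.cong refl) (simp only: EB lessThan_iff)
  also have "\<dots> = (\<Sum>m<n. \<Sum>k<n. (if k = i then A $$ (m,i) * B $$ (j,m) else 0) +
      (if k = j then (if i = j then 0 else A $$ (m,j) * B $$ (i,m)) else 0))"
    by (intro sum.cong refl) auto
  also have "\<dots> = (\<Sum>m<n. A $$ (m,i) * B $$ (j,m)) + (if i = j then 0 else \<Sum>m<n. A $$ (m,j) * B $$ (i,m))"
    using ij by (simp add: sum.distrib sum.delta)
  also have "\<dots> = etr p (B * A)"
    using ij by (auto simp: etr_def BA)
  finally show ?thesis .
qed

section \<open>Resolvents of Hermitian matrices\<close>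

definition hermitian_mat :: "nat \<Rightarrow> complex mat \<Rightarrow> bool" where
  "hermitian_mat n A \<longleftrightarrow> A \<in> carrier_mat n n \<and> (\<forall>i<n. \<forall>j<n. A $$ (i,j) = cnj (A $$ (j,i)))"

lemma hermitian_matD:
  assumes "hermitian_mat n A"
  shows "A \<in> carrier_mat n n" "i < n \<Longrightarrow> j < n \<Longrightarrow> A $$ (i,j) = cnj (A $$ (j,i))"
  using assms unfolding hermitian_mat_def by blast+

text \<open>The formula by the adjugate is kept as the definition because it displays the entries as rational
  functions of the entries of \<open>A\<close>, which gives measurability, and the trace as a logarithmic
  derivative of the characteristic polynomial.\<close>

definition resolvent :: "complex \<Rightarrow> complex mat \<Rightarrow> complex mat" where
  "resolvent z A = (let B = A - z \<cdot>\<^sub>m 1\<^sub>m (dim_row A) in (1 / det B) \<cdot>\<^sub>m adj_mat B)"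

text \<open>Since \<open>v\<^sup>* A v\<close> is real, the imaginary part of \<open>v\<^sup>* (A - z) v\<close> is \<open>- Im z |v|\<^sup>2\<close>; the
  Cauchy-Schwarz inequality does the rest.\<close>

lemma shift_lower_bound:
  assumes A: "hermitian_mat n A" and v: "v \<in> carrier_vec n"
  shows "\<bar>Im z\<bar> * vec_len v \<le> vec_len ((A - z \<cdot>\<^sub>m 1\<^sub>m n) *\<^sub>v v)"
proof -
  define w where "w = (A - z \<cdot>\<^sub>m 1\<^sub>m n) *\<^sub>v v"
  note Ac = hermitian_matD(1)[OF A] and h = hermitian_matD(2)[OF A]
  have w: "w $ k = (\<Sum>l<n. A $$ (k,l) * v $ l) - z * v $ k" if k: "k < n" for k
  proof -
    have "w $ k = (\<Sum>l<n. (A $$ (k,l) - (if k = l then z else 0)) * v $ l)"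
      using k Ac v by (auto simp: w_def scalar_prod_def lessThan_atLeast0 carrier_vecD intro!: sum.cong)
    also have "\<dots> = (\<Sum>l<n. A $$ (k,l) * v $ l - (if k = l then z * v $ l else 0))"
      by (intro sum.cong) (auto simp: algebra_simps)
    finally show ?thesis using k by (simp add: sum_subtractf)
  qed
  define Q where "Q = (\<Sum>k<n. cnj (v $ k) * (\<Sum>l<n. A $$ (k,l) * v $ l))"
  have "cnj Q = (\<Sum>k<n. \<Sum>l<n. v $ k * cnj (A $$ (k,l)) * cnj (v $ l))"
    by (simp add: Q_def sum_distrib_left mult.assoc)
  also have "\<dots> = (\<Sum>l<n. \<Sum>k<n. v $ k * cnj (A $$ (k,l)) * cnj (v $ l))" by (rule sum.swap)
  also have "\<dots> = Q"
    unfolding Q_def sum_distrib_left by (intro sum.cong refl) (simp add: h[symmetric] mult_ac)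
  finally have "Im Q = 0" by (metis Reals_cnj_iff complex_is_Real_iff)
  have sq: "(vec_len v)^2 = (\<Sum>k<n. (cmod (v $ k))^2)"
    using v by (simp add: vec_len_def L2_set_def carrier_vecD sum_nonneg)
  have "(\<Sum>k<n. cnj (v $ k) * w $ k) =
      (\<Sum>k<n. cnj (v $ k) * (\<Sum>l<n. A $$ (k,l) * v $ l) - z * of_real ((cmod (v $ k))^2))"
  proof (rule sum.cong[OF refl])
    fix k assume "k \<in> {..<n}"
    then have "w $ k = (\<Sum>l<n. A $$ (k,l) * v $ l) - z * v $ k" by (intro w) simp
    then show "cnj (v $ k) * w $ k =
        cnj (v $ k) * (\<Sum>l<n. A $$ (k,l) * v $ l) - z * of_real ((cmod (v $ k))^2)"
      by (simp only: complex_norm_square right_diff_distrib mult_ac)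
  qed
  also have "\<dots> = Q - z * of_real ((vec_len v)^2)"
    by (simp only: Q_def sq sum_subtractf sum_distrib_left of_real_sum)
  finally have eq: "(\<Sum>k<n. cnj (v $ k) * w $ k) = Q - z * of_real ((vec_len v)^2)" .
  have "\<bar>Im z\<bar> * (vec_len v)^2 = \<bar>Im (\<Sum>k<n. cnj (v $ k) * w $ k)\<bar>"
    unfolding eq using \<open>Im Q = 0\<close> by (simp add: abs_mult del: of_real_power)
  also have "\<dots> \<le> cmod (\<Sum>k<n. cnj (v $ k) * w $ k)" by (rule abs_Im_le_cmod)
  also have "\<dots> \<le> (\<Sum>k<n. \<bar>cmod (v $ k)\<bar> * \<bar>cmod (w $ k)\<bar>)"
    by (rule order_trans[OF norm_sum]) (simp add: norm_mult)
  also have "\<dots> \<le> L2_set (\<lambda>k. cmod (v $ k)) {..<n} * L2_set (\<lambda>k. cmod (w $ k)) {..<n}"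
    by (rule L2_set_mult_ineq)
  also have "\<dots> = vec_len v * vec_len w"
    using v Ac by (simp add: vec_len_def carrier_vecD w_def)
  finally have "\<bar>Im z\<bar> * vec_len v * vec_len v \<le> vec_len w * vec_len v"
    by (simp add: power2_eq_square mult_ac)
  then show ?thesis
    using vec_len_nonneg[of v] by (cases "vec_len v = 0") (auto simp: w_def mult_le_cancel_right)
qed

lemma
  assumes A: "hermitian_mat n A" and z: "Im z \<noteq> 0"
  shows resolvent_right: "(A - z \<cdot>\<^sub>m 1\<^sub>m n) * resolvent z A = 1\<^sub>m n"
    and resolvent_left: "resolvent z A * (A - z \<cdot>\<^sub>m 1\<^sub>m n) = 1\<^sub>m n"
    and resolvent_carrier: "resolvent z A \<in> carrier_mat n n"
    and det_shift_nonzero: "det (A - z \<cdot>\<^sub>m 1\<^sub>m n) \<noteq> 0"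
proof -
  let ?B = "A - z \<cdot>\<^sub>m 1\<^sub>m n"
  have Ac: "A \<in> carrier_mat n n" and B: "?B \<in> carrier_mat n n"
    using hermitian_matD(1)[OF A] by auto
  show d: "det ?B \<noteq> 0"
  proof
    assume "det ?B = 0"
    then obtain v where v: "v \<in> carrier_vec n" "v \<noteq> 0\<^sub>v n" "?B *\<^sub>v v = 0\<^sub>v n"
      using det_0_iff_vec_prod_zero_field[OF B] by auto
    have "\<bar>Im z\<bar> * vec_len v \<le> vec_len (0\<^sub>v n)"
      using shift_lower_bound[OF A v(1), of z] v(3) by simp
    also have "vec_len (0\<^sub>v n) = 0" by (simp add: vec_len_def L2_set_def)
    finally have "vec_len v \<le> 0" using z by (simp add: mult_le_0_iff)
    then have "vec_len v = 0" using vec_len_nonneg[of v] by linarith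
    then have "\<forall>i<n. v $ i = 0"
      using v(1) by (simp add: vec_len_def L2_set_eq_0_iff carrier_vecD)
    then have "v = 0\<^sub>v n" using v(1) by (intro eq_vecI) auto
    then show False using v(2) by simp
  qed
  have r: "resolvent z A = (1 / det ?B) \<cdot>\<^sub>m adj_mat ?B"
    using Ac by (simp add: resolvent_def Let_def)
  show "resolvent z A \<in> carrier_mat n n" using adj_mat(1)[OF B] by (simp add: r)
  have one: "(1 / det ?B) \<cdot>\<^sub>m (det ?B \<cdot>\<^sub>m 1\<^sub>m n) = 1\<^sub>m n"
    using d by (intro eq_matI) auto
  show "?B * resolvent z A = 1\<^sub>m n"
    by (simp only: r mult_smult_distrib[OF B adj_mat(1)[OF B]] adj_mat(2)[OF B] one)
  show "resolvent z A * ?B = 1\<^sub>m n"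
    by (simp only: r mult_smult_assoc_mat[OF adj_mat(1)[OF B] B] adj_mat(3)[OF B] one)
qed

lemma op_bound_resolvent:
  assumes A: "hermitian_mat n A" and z: "Im z \<noteq> 0"
  shows "op_bound n (1 / \<bar>Im z\<bar>) (resolvent z A)"
  unfolding op_bound_def
proof (intro conjI ballI)
  fix v :: "complex Matrix.vec" assume v: "v \<in> carrier_vec n"
  note R = resolvent_carrier[OF A z]
  note Ac = hermitian_matD(1)[OF A]
  have B: "A - z \<cdot>\<^sub>m 1\<^sub>m n \<in> carrier_mat n n" using Ac by auto
  have "(A - z \<cdot>\<^sub>m 1\<^sub>m n) *\<^sub>v (resolvent z A *\<^sub>v v) = ((A - z \<cdot>\<^sub>m 1\<^sub>m n) * resolvent z A) *\<^sub>v v"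
    by (rule assoc_mult_mat_vec[OF B R v, symmetric])
  also have "\<dots> = v" by (simp only: resolvent_right[OF A z] one_mult_mat_vec[OF v])
  finally have "\<bar>Im z\<bar> * vec_len (resolvent z A *\<^sub>v v) \<le> vec_len v"
    using shift_lower_bound[OF A mult_mat_vec_carrier[OF R v], of z] by simp
  then show "vec_len (resolvent z A *\<^sub>v v) \<le> 1 / \<bar>Im z\<bar> * vec_len v"
    using z by (simp add: field_simps)
qed (use resolvent_carrier[OF A z] in auto)

lemma resolvent_identity:
  assumes A: "hermitian_mat n A" and B: "hermitian_mat n B" and z: "Im z \<noteq> 0"
    and D: "D \<in> carrier_mat n n" and BA: "B = A + D"
  shows "resolvent z B = resolvent z A - resolvent z A * (D * resolvent z B)"
proof -
  let ?I = "z \<cdot>\<^sub>m 1\<^sub>m n :: complex mat"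
  define R T A' B' where "R = resolvent z A" "T = resolvent z B" "A' = A - ?I" "B' = B - ?I"
  note defs = this
  note Ac = hermitian_matD(1)[OF A]
  have c: "A' \<in> carrier_mat n n" "B' \<in> carrier_mat n n" "R \<in> carrier_mat n n" "T \<in> carrier_mat n n"
    using hermitian_matD(1)[OF A] hermitian_matD(1)[OF B] resolvent_carrier[OF A z] resolvent_carrier[OF B z]
    by (auto simp: defs)
  have "D = B' - A'"
    unfolding defs BA using Ac D by (intro eq_matI) auto
  then have "D * T = B' * T - A' * T"
    by (simp only: minus_mult_distrib_mat[OF c(2,1,4)])
  also have "B' * T = 1\<^sub>m n" using resolvent_right[OF B z] by (simp only: defs)
  finally have "R * (D * T) = R * 1\<^sub>m n - R * (A' * T)"
    by (simp only: mult_minus_distrib_mat[OF c(3) one_carrier_mat mult_carrier_mat[OF c(1,4)]])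
  also have "R * (A' * T) = (R * A') * T"
    by (rule assoc_mult_mat[OF c(3,1,4), symmetric])
  also have "R * A' = 1\<^sub>m n" using resolvent_left[OF A z] by (simp only: defs)
  also have "1\<^sub>m n * T = T" using c(4) by simp
  also have "R * 1\<^sub>m n = R" using c(3) by simp
  finally have e: "R * (D * T) = R - T" .
  have "R - (R - T) = T" using c(3,4) by (intro eq_matI) auto
  then show ?thesis by (simp add: e defs(1,2)[symmetric])
qed

section \<open>Perturbation of a single matrix entry\<close>

lemma square_mult_carrier [simp]:
  "A \<in> carrier_mat n n \<Longrightarrow> B \<in> carrier_mat n n \<Longrightarrow> A * B \<in> carrier_mat n n"
  by auto

lemma square_mult_diff_smult:
  fixes A B C :: "complex mat"
  assumes [simp]: "A \<in> carrier_mat n n" "B \<in> carrier_mat n n" "C \<in> carrier_mat n n"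
  shows "A * (B - c \<cdot>\<^sub>m C) = A * B - c \<cdot>\<^sub>m (A * C)" "(B - c \<cdot>\<^sub>m C) * A = B * A - c \<cdot>\<^sub>m (C * A)"
  by (simp_all add: mult_minus_distrib_mat[of _ n n _ n] mult_smult_distrib[of _ n n _ n]
      minus_mult_distrib_mat[of _ n n _ _ n] mult_smult_assoc_mat[of _ n n _ n])

lemma diff_smult_eq_add:
  fixes A B :: "complex mat"
  assumes "A \<in> carrier_mat n n" "B \<in> carrier_mat n n"
  shows "A - c \<cdot>\<^sub>m B = A + (- c) \<cdot>\<^sub>m B"
  using assms by (intro eq_matI) auto

lemma etr_lin:
  assumes "p \<in> tri n" "A \<in> carrier_mat n n" "B \<in> carrier_mat n n"
  shows "etr p (A - c \<cdot>\<^sub>m B) = etr p A - c * etr p B" "etr p (A + B) = etr p A + etr p B"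
  using assms by (cases p; auto simp: etr_def tri_def algebra_simps)+

lemma mtr_diff_smult:
  assumes "A \<in> carrier_mat n n" "B \<in> carrier_mat n n"
  shows "mtr (A - c \<cdot>\<^sub>m B) = mtr A - c * mtr B"
  using assms by (simp add: mtr_def sum_subtractf sum_distrib_left)

definition wigner :: "nat \<Rightarrow> (nat \<times> nat \<Rightarrow> real) \<Rightarrow> complex mat" where
  "wigner n x = mat n n (\<lambda>(k, l). complex_of_real (x (max k l, min k l) / sqrt (real n)))"

lemma wigner_carrier [simp]: "wigner n x \<in> carrier_mat n n" "dim_row (wigner n x) = n"
  "dim_col (wigner n x) = n"
  by (auto simp: wigner_def)

lemma wigner_hermitian: "hermitian_mat n (wigner n x)"
  unfolding hermitian_mat_def by (auto simp: wigner_def max.commute min.commute)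

lemma wigner_update:
  "wigner n (x(p := c)) = wigner n x + complex_of_real ((c - x p) / sqrt (real n)) \<cdot>\<^sub>m sym_unit n p"
  by (intro eq_matI) (auto simp: wigner_def sym_unit_def diff_divide_distrib)

text \<open>\<open>R\<close> and \<open>T\<close> are the resolvents before and after the entry \<open>p\<close> moves by \<open>t\<close>. All
  expansions below are exact identities obtained by iterating \<open>T = R - t R E T\<close>; the remainders still
  contain \<open>T\<close>, so they can be bounded for large \<open>t\<close> as well.\<close>

locale entry_perturbation =
  fixes n :: nat and p :: "nat \<times> nat" and z t :: complex and A B R T E :: "complex mat" and K :: real
  assumes p: "p \<in> tri n" and A: "hermitian_mat n A" and B: "hermitian_mat n B" and z: "Im z \<noteq> 0"
    and K: "1 \<le> K" "1 / \<bar>Im z\<bar> \<le> K"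
    and BA: "B = A + t \<cdot>\<^sub>m sym_unit n p"
    and R: "R = resolvent z A" and T: "T = resolvent z B" and E: "E = sym_unit n p"
begin

lemma carriers: "R \<in> carrier_mat n n" "T \<in> carrier_mat n n" "E \<in> carrier_mat n n"
  using resolvent_carrier[OF A z] resolvent_carrier[OF B z] by (auto simp: R T E)

lemma bounds: "op_bound n K R" "op_bound n K T" "op_bound n 1 E"
  using op_bound_mono[OF op_bound_resolvent[OF A z] K(2)] op_bound_mono[OF op_bound_resolvent[OF B z] K(2)]
    op_bound_sym_unit[OF p] by (auto simp: R T E)

lemma T_eq: "T = R - t \<cdot>\<^sub>m (R * (E * T))"
proof -
  have "R * ((t \<cdot>\<^sub>m E) * T) = t \<cdot>\<^sub>m (R * (E * T))"
    by (simp only: mult_smult_assoc_mat[OF carriers(3,2)]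
        mult_smult_distrib[OF carriers(1) mult_carrier_mat[OF carriers(3,2)]])
  moreover have "T = R - R * ((t \<cdot>\<^sub>m E) * T)"
    unfolding R T E by (rule resolvent_identity[OF A B z _ BA]) simp
  ultimately show ?thesis by simp
qed

lemma TZ_eq:
  assumes Z: "Z \<in> carrier_mat n n"
  shows "T * Z = R * Z - t \<cdot>\<^sub>m (R * (E * (T * Z)))"
proof -
  note [simp] = carriers Z
  have "T * Z = (R - t \<cdot>\<^sub>m (R * (E * T))) * Z" using T_eq by simp
  also have "\<dots> = R * Z - t \<cdot>\<^sub>m (R * (E * T) * Z)"
    by (rule square_mult_diff_smult[where n = n]) auto
  also have "R * (E * T) * Z = R * (E * T * Z)" by (rule assoc_mult_mat[of _ n n _ n _ n]) auto
  also have "E * T * Z = E * (T * Z)" by (rule assoc_mult_mat[of _ n n _ n _ n]) auto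
  finally show ?thesis .
qed

lemma etr_expand1:
  assumes Z: "Z \<in> carrier_mat n n"
  shows "etr p (T * Z) = etr p (R * Z) - t * etr p (R * (E * (T * Z)))"
  by (subst TZ_eq[OF Z], rule etr_lin[OF p]) (use carriers Z in auto)

lemma etr_expand2:
  assumes Z: "Z \<in> carrier_mat n n"
  shows "etr p (R * (E * (T * Z))) =
    etr p (R * (E * (R * Z))) - t * etr p (R * (E * (R * (E * (T * Z)))))"
proof -
  note [simp] = carriers Z
  have "R * (E * (T * Z)) = R * (E * (R * Z - t \<cdot>\<^sub>m (R * (E * (T * Z)))))"
    using TZ_eq[OF Z] by simp
  also have "E * (R * Z - t \<cdot>\<^sub>m (R * (E * (T * Z)))) = E * (R * Z) - t \<cdot>\<^sub>m (E * (R * (E * (T * Z))))"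
    by (rule square_mult_diff_smult[where n = n]) auto
  also have "R * \<dots> = R * (E * (R * Z)) - t \<cdot>\<^sub>m (R * (E * (R * (E * (T * Z)))))"
    by (rule square_mult_diff_smult[where n = n]) auto
  finally have "etr p (R * (E * (T * Z))) =
      etr p (R * (E * (R * Z)) - t \<cdot>\<^sub>m (R * (E * (R * (E * (T * Z))))))" by (rule arg_cong)
  also have "\<dots> = etr p (R * (E * (R * Z))) - t * etr p (R * (E * (R * (E * (T * Z)))))"
    by (rule etr_lin(1)[OF p]) auto
  finally show ?thesis .
qed

lemma etr_bound1: "op_bound n c Z \<Longrightarrow> cmod (etr p (R * (E * (T * Z)))) \<le> 2 * (K^2 * c)"
  "op_bound n c Z \<Longrightarrow> cmod (etr p (R * (E * (R * Z)))) \<le> 2 * (K^2 * c)"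
  "op_bound n c Z \<Longrightarrow> cmod (etr p (R * (E * (R * (E * (T * Z)))))) \<le> 2 * (K^3 * c)"
proof -
  assume Z: "op_bound n c Z"
  have "op_bound n (K * (1 * (K * c))) (R * (E * (T * Z)))" "op_bound n (K * (1 * (K * c))) (R * (E * (R * Z)))"
    "op_bound n (K * (1 * (K * (1 * (K * c))))) (R * (E * (R * (E * (T * Z)))))"
    by (intro op_bound_mult bounds Z)+
  then show "cmod (etr p (R * (E * (T * Z)))) \<le> 2 * (K^2 * c)"
    "cmod (etr p (R * (E * (R * Z)))) \<le> 2 * (K^2 * c)"
    "cmod (etr p (R * (E * (R * (E * (T * Z)))))) \<le> 2 * (K^3 * c)"
    using etr_bound[OF _ p] by (force simp: power2_eq_square power3_eq_cube mult.assoc)+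
qed

lemma etr_first_order:
  assumes Z: "op_bound n c Z"
  shows "cmod (etr p (T * Z) - etr p (R * Z)) \<le> cmod t * (2 * (K^2 * c))"
    and "cmod (etr p (T * Z) - etr p (R * Z) + t * etr p (R * (E * (R * Z)))) \<le> (cmod t)^2 * (2 * (K^3 * c))"
proof -
  note Zc = op_boundD(1)[OF Z]
  have "etr p (T * Z) - etr p (R * Z) = - t * etr p (R * (E * (T * Z)))"
    using etr_expand1[OF Zc] by simp
  then show "cmod (etr p (T * Z) - etr p (R * Z)) \<le> cmod t * (2 * (K^2 * c))"
    using etr_bound1(1)[OF Z] by (simp add: norm_mult mult_left_mono)
  have "etr p (T * Z) - etr p (R * Z) + t * etr p (R * (E * (R * Z))) =
      t^2 * etr p (R * (E * (R * (E * (T * Z)))))"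
    using etr_expand1[OF Zc] etr_expand2[OF Zc] by (simp add: algebra_simps power2_eq_square)
  then show "cmod (etr p (T * Z) - etr p (R * Z) + t * etr p (R * (E * (R * Z)))) \<le> (cmod t)^2 * (2 * (K^3 * c))"
    using etr_bound1(3)[OF Z] by (simp add: norm_mult norm_power mult_left_mono)
qed

lemma mtr_diff: "mtr T - mtr R = - t * etr p (T * R)"
proof -
  note [simp] = carriers
  have "mtr T = mtr (R - t \<cdot>\<^sub>m (R * (E * T)))" using T_eq by simp
  also have "\<dots> = mtr R - t * mtr (R * (E * T))" by (rule mtr_diff_smult[of _ n]) auto
  also have "mtr (R * (E * T)) = etr p (T * R)"
    unfolding E by (rule mtr_sym_unit[OF p]) auto
  finally show ?thesis by simp
qed

lemma mtr_diff_bound: "cmod (mtr T - mtr R) \<le> cmod t * (2 * K^2)"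
proof -
  have "cmod (etr p (T * R)) \<le> 2 * (K * K)"
    by (intro etr_bound[OF _ p] op_bound_mult bounds)
  then show ?thesis by (simp add: mtr_diff norm_mult mult_left_mono power2_eq_square)
qed

text \<open>The remainder can be bounded by the square and by the cube of \<open>t\<close>, depending on where the expansion
  is stopped. Both are needed: entries have only two moments, so large ones must be paid for by
  the square, while the cube makes small ones negligible.\<close>

lemma mtr_second_order:
  "cmod (mtr T - mtr R + t * etr p (R * R) - t^2 * etr p (R * (E * (R * R))))
    \<le> 4 * K^4 * min ((cmod t)^2) ((cmod t)^3)"
proof -
  note c = carriers
  let ?d = "mtr T - mtr R + t * etr p (R * R) - t^2 * etr p (R * (E * (R * R)))"
  have eq1: "?d = - t * (etr p (T * R) - etr p (R * R) + t * etr p (R * (E * (R * R))))"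
    unfolding mtr_diff by (simp add: algebra_simps power2_eq_square)
  have "cmod ?d \<le> cmod t * ((cmod t)^2 * (2 * (K^3 * K)))"
    unfolding eq1 norm_mult norm_minus_cancel using etr_first_order(2)[OF bounds(1)] by (intro mult_left_mono) auto
  also have "\<dots> = 2 * K^4 * (cmod t)^3" by (simp add: eval_nat_numeral mult_ac)
  also have "\<dots> \<le> 4 * K^4 * (cmod t)^3" using K by (intro mult_right_mono) auto
  finally have b1: "cmod ?d \<le> 4 * K^4 * (cmod t)^3" .
  have eq2: "?d = t^2 * (etr p (R * (E * (T * R))) - etr p (R * (E * (R * R))))"
    unfolding mtr_diff etr_expand1[OF c(1)] by (simp add: algebra_simps power2_eq_square)
  have "cmod (etr p (R * (E * (T * R))) - etr p (R * (E * (R * R)))) \<le> 2 * (K^2 * K) + 2 * (K^2 * K)"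
    by (intro order_trans[OF norm_triangle_ineq4] add_mono etr_bound1 bounds)
  also have "\<dots> = 4 * K^3" by (simp add: eval_nat_numeral)
  also have "\<dots> \<le> 4 * K^4" using K by (intro mult_left_mono power_increasing) auto
  finally have "cmod ?d \<le> (cmod t)^2 * (4 * K^4)"
    unfolding eq2 norm_mult norm_power by (intro mult_left_mono) auto
  then have b2: "cmod ?d \<le> 4 * K^4 * (cmod t)^2" by (simp add: mult.commute)
  show ?thesis using b1 b2 by (simp add: min_def)
qed

text \<open>Telescoping: the three resolvents are exchanged one after the other, and each exchange costs a
  factor \<open>|t|\<close> by the resolvent identity.\<close>

lemma etr_quadratic_change:
  assumes q: "q \<in> tri n"
  shows "cmod (etr q (T * (sym_unit n q * (T * T))) - etr q (R * (sym_unit n q * (R * R))))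
    \<le> 6 * K^4 * cmod t"
proof -
  define F where "F = sym_unit n q"
  define D where "D = (- t) \<cdot>\<^sub>m (R * (E * T))"
  have F: "F \<in> carrier_mat n n" "op_bound n 1 F" using op_bound_sym_unit[OF q] by (auto simp: F_def)
  have D: "D \<in> carrier_mat n n" using carriers by (auto simp: D_def)
  note [simp] = carriers F(1) D
  have TD: "T = R + D"
    unfolding D_def by (subst T_eq, rule diff_smult_eq_add[where n = n]) auto
  have bnd: "cmod (etr q (U * (D * V))) \<le> 2 * K^2 * cmod t * (c * d)" if "op_bound n c U" "op_bound n d V" for U V c d
  proof -
    note uv = op_boundD(1)[OF that(1)] op_boundD(1)[OF that(2)]
    have "U * (D * V) = (- t) \<cdot>\<^sub>m (U * (R * (E * T) * V))"
      unfolding D_def using uv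
      by (subst mult_smult_assoc_mat[of _ n n _ n], simp_all, subst mult_smult_distrib[of _ n n _ n], simp_all)
    then have "etr q (U * (D * V)) = (- t) * etr q (U * (R * (E * T) * V))"
      using uv q by (cases q) (auto simp: etr_def tri_def algebra_simps simp del: index_mult_mat(1))
    moreover
    have "cmod (etr q (U * (R * (E * T) * V))) \<le> 2 * (c * (K * (1 * K) * d))"
      by (intro etr_bound[OF _ q] op_bound_mult bounds that)
    from mult_left_mono[OF this, of "cmod t"] calculation show ?thesis
      by (simp add: norm_mult power2_eq_square mult_ac)
  qed
  have 1: "etr q (T * (F * (T * T))) = etr q (R * (F * (T * T))) + etr q (D * (F * (T * T)))"
    by (subst (1) TD, subst add_mult_distrib_mat[of _ n n _ _ n], simp_all add: etr_lin(2)[OF q])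
  have 2: "etr q (R * (F * (T * T))) = etr q (R * (F * (R * T))) + etr q (R * (F * (D * T)))"
    by (subst (1) TD, subst add_mult_distrib_mat[of _ n n _ _ n], simp_all,
      subst mult_add_distrib_mat[of _ n n _ n], simp_all, subst mult_add_distrib_mat[of _ n n _ n], simp_all add: etr_lin(2)[OF q])
  have 3: "etr q (R * (F * (R * T))) = etr q (R * (F * (R * R))) + etr q (R * (F * (R * D)))"
    by (subst (1) TD, subst mult_add_distrib_mat[of _ n n _ n], simp_all, subst mult_add_distrib_mat[of _ n n _ n], simp_all,
      subst mult_add_distrib_mat[of _ n n _ n], simp_all add: etr_lin(2)[OF q])
  have 4: "1\<^sub>m n * (D * (F * (T * T))) = D * (F * (T * T))"
    by (rule left_mult_one_mat[of _ n n]) simp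
  have 5: "(R * F) * (D * T) = R * (F * (D * T))" by (rule assoc_mult_mat[of _ n n _ n _ n]) auto
  have "(R * (F * R)) * D = R * ((F * R) * D)" by (rule assoc_mult_mat[of _ n n _ n _ n]) auto
  also have "(F * R) * D = F * (R * D)" by (rule assoc_mult_mat[of _ n n _ n _ n]) auto
  finally have 6: "(R * (F * R)) * (D * 1\<^sub>m n) = R * (F * (R * D))"
    by (simp add: right_mult_one_mat[of _ n n])
  have "etr q (T * (F * (T * T))) - etr q (R * (F * (R * R))) =
     etr q (D * (F * (T * T))) + etr q (R * (F * (D * T))) + etr q (R * (F * (R * D)))"
    using 1 2 3 by simp
  also have "cmod \<dots> \<le> 2 * K^2 * cmod t * (1 * (1 * (K * K))) + 2 * K^2 * cmod t * ((K * 1) * K)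
      + 2 * K^2 * cmod t * ((K * (1 * K)) * 1)"
    by (intro order_trans[OF norm_triangle_ineq] add_mono;
        (subst 4[symmetric] | subst 5[symmetric] | subst 6[symmetric]);
        intro bnd op_bound_mult op_bound_one bounds F(2))
  also have "\<dots> = 6 * K^4 * cmod t" by (simp add: eval_nat_numeral)
  finally show ?thesis by (simp add: F_def)
qed

end

section \<open>The defect of the semicircle equation and its dependence on one entry\<close>

lemma Re_of_real_mult: "Re (of_real c * w) = c * Re w" by simp

definition stieltjes :: "complex \<Rightarrow> nat \<Rightarrow> (nat \<times> nat \<Rightarrow> real) \<Rightarrow> complex" where
  "stieltjes z n x = mtr (resolvent z (wigner n x)) / of_nat n"

text \<open>The Stieltjes transform of the semicircle law is the zero of this polynomial in the upper half
  plane.\<close>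

definition defect :: "complex \<Rightarrow> complex \<Rightarrow> complex" where
  "defect z s = 1 + z * s + s^2"

definition sq_defect :: "complex \<Rightarrow> nat \<Rightarrow> (nat \<times> nat \<Rightarrow> real) \<Rightarrow> real" where
  "sq_defect z n x = (cmod (defect z (stieltjes z n x)))^2"

text \<open>The gradient of \<open>s \<mapsto> |P s|\<^sup>2\<close> with \<open>P = defect z\<close>: a small change \<open>\<delta>\<close> of \<open>s\<close> changes that function
  by the real part of \<open>\<delta>\<close> times this number.\<close>

definition sq_defect_grad :: "complex \<Rightarrow> complex \<Rightarrow> complex" where
  "sq_defect_grad z s = 2 * cnj (defect z s) * (z + 2 * s)"

text \<open>The coefficients of \<open>t\<close> and \<open>t\<^sup>2\<close> when the rescaled entry \<open>p\<close> of the matrix is moved by \<open>t\<close>. The second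
  one omits the contribution of the second derivative of \<open>|P|\<^sup>2\<close>: \<open>S\<close> moves by \<open>O(t / n)\<close> only, so that
  this contribution has order \<open>t\<^sup>2 / n\<^sup>2\<close> and goes into the remainder.\<close>

definition coeff1 :: "complex \<Rightarrow> nat \<Rightarrow> nat \<times> nat \<Rightarrow> (nat \<times> nat \<Rightarrow> real) \<Rightarrow> real" where
  "coeff1 z n p x = - Re (sq_defect_grad z (stieltjes z n x) *
     etr p (resolvent z (wigner n x) * resolvent z (wigner n x))) / real n"

definition coeff2 :: "complex \<Rightarrow> nat \<Rightarrow> nat \<times> nat \<Rightarrow> (nat \<times> nat \<Rightarrow> real) \<Rightarrow> real" where
  "coeff2 z n p x = Re (sq_defect_grad z (stieltjes z n x) *
     (let R = resolvent z (wigner n x) in etr p (R * (sym_unit n p * (R * R))))) / real n"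

text \<open>A single constant \<open>K\<close> dominates the operator norm of all resolvents at \<open>z\<close>, the modulus of \<open>z\<close> and
  the number 1, so that every estimate becomes a multiple of a power of \<open>K\<close>.\<close>

locale spectral_parameter =
  fixes z :: complex and K :: real
  assumes z: "Im z \<noteq> 0" and K1: "1 \<le> K" and Kz: "1 / \<bar>Im z\<bar> \<le> K" and zK: "cmod z \<le> K"
begin

lemma K0: "0 \<le> K" "0 < K" using K1 by auto

lemma op_bound_R: "op_bound n K (resolvent z (wigner n x))"
  by (rule op_bound_mono[OF op_bound_resolvent[OF wigner_hermitian z] Kz])

lemma stieltjes_bound: "cmod (stieltjes z n x) \<le> K"
proof (cases "n = 0")
  case False
  have "dim_row (resolvent z (wigner n x)) = n" using op_boundD(1)[OF op_bound_R, of n x] by auto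
  then have "cmod (mtr (resolvent z (wigner n x))) \<le> (\<Sum>i<n. cmod (resolvent z (wigner n x) $$ (i,i)))"
    by (simp add: mtr_def norm_sum)
  also have "\<dots> \<le> (\<Sum>i<n. K)" by (intro sum_mono op_bound_entry[OF op_bound_R]) auto
  finally have "cmod (mtr (resolvent z (wigner n x))) \<le> (\<Sum>i<n. K)" .
  then show ?thesis using False by (simp add: stieltjes_def norm_divide field_simps)
qed (use K0 in \<open>simp add: stieltjes_def\<close>)

lemma defect_bound: assumes "cmod s \<le> K" shows "cmod (defect z s) \<le> 3 * K^2"
proof -
  have "cmod (defect z s) \<le> 1 + cmod z * cmod s + (cmod s)^2"
    unfolding defect_def
    by (metis (no_types) norm_mult norm_one norm_power norm_triangle_ineq add_right_mono order_trans)
  also have "\<dots> \<le> K^2 + K * K + K^2"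
    using assms K1 zK by (intro add_mono mult_mono power_mono) (auto simp: one_le_power)
  finally show ?thesis by (simp add: power2_eq_square)
qed

lemma slope_bound: assumes "cmod s \<le> K" shows "cmod (z + 2 * s) \<le> 3 * K"
  using norm_triangle_ineq[of z "2 * s"] assms zK by (simp add: norm_mult)

lemma grad_bound: assumes "cmod s \<le> K" shows "cmod (sq_defect_grad z s) \<le> 18 * K^3"
proof -
  have "cmod (sq_defect_grad z s) = 2 * (cmod (defect z s) * cmod (z + 2 * s))"
    by (simp add: sq_defect_grad_def norm_mult)
  also have "\<dots> \<le> 2 * ((3 * K^2) * (3 * K))"
    using assms K0 by (intro mult_left_mono mult_mono defect_bound slope_bound) auto
  finally show ?thesis by (simp add: eval_nat_numeral)
qed

lemma defect_diff: "defect z s - defect z s' = (s - s') * (z + s + s')"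
  by (simp add: defect_def algebra_simps power2_eq_square)

lemma defect_lipschitz:
  assumes "cmod s \<le> K" "cmod s' \<le> K"
  shows "cmod (defect z s - defect z s') \<le> 3 * K * cmod (s - s')"
proof -
  have "cmod (z + s + s') \<le> cmod z + cmod s + cmod s'"
    by (meson norm_triangle_ineq add_right_mono order_trans)
  also have "\<dots> \<le> 3 * K" using assms zK by simp
  finally show ?thesis unfolding defect_diff norm_mult
    by (simp add: mult.commute mult_left_mono)
qed

lemma grad_lipschitz:
  assumes "cmod s \<le> K" "cmod s' \<le> K"
  shows "cmod (sq_defect_grad z s - sq_defect_grad z s') \<le> 30 * K^2 * cmod (s - s')"
proof -
  have "sq_defect_grad z s - sq_defect_grad z s' =
      2 * (cnj (defect z s - defect z s') * (z + 2 * s) + cnj (defect z s') * (2 * (s - s')))"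
    by (simp add: sq_defect_grad_def algebra_simps)
  also have "cmod \<dots> \<le> 2 * (cmod (defect z s - defect z s') * cmod (z + 2 * s) +
      cmod (defect z s') * (2 * cmod (s - s')))"
    using norm_triangle_ineq[of "cnj (defect z s - defect z s') * (z + 2 * s)" "cnj (defect z s') * (2 * (s - s'))"]
    by (simp only: norm_mult complex_mod_cnj norm_numeral mult_le_cancel_left_pos zero_less_numeral)
  also have "\<dots> \<le> 2 * (3 * K * cmod (s - s') * (3 * K) + 3 * K^2 * (2 * cmod (s - s')))"
    using assms K0 by (intro mult_left_mono add_mono mult_mono defect_lipschitz slope_bound defect_bound) auto
  finally show ?thesis by (simp add: power2_eq_square algebra_simps)
qed

lemma sq_defect_expand:
  assumes "cmod s \<le> K" "cmod s' \<le> K"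
  shows "\<bar>(cmod (defect z s'))^2 - (cmod (defect z s))^2 - Re (sq_defect_grad z s * (s' - s))\<bar>
    \<le> 15 * K^2 * (cmod (s' - s))^2"
proof -
  let ?P = "defect z s" and ?d = "s' - s" and ?k = "defect z s' - defect z s"
  have k: "?k = (z + 2 * s) * ?d + ?d^2" by (simp add: defect_def algebra_simps power2_eq_square)
  have "(cmod (?P + ?k))^2 = (cmod ?P)^2 + 2 * Re (cnj ?P * ?k) + (cmod ?k)^2"
    unfolding cmod_power2 by (simp add: algebra_simps power2_eq_square)
  moreover have "2 * Re (cnj ?P * ?k) = Re (sq_defect_grad z s * ?d) + 2 * Re (cnj ?P * ?d^2)"
    unfolding k sq_defect_grad_def by (simp add: algebra_simps)
  ultimately have "(cmod (defect z s'))^2 - (cmod ?P)^2 - Re (sq_defect_grad z s * ?d) =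
      2 * Re (cnj ?P * ?d^2) + (cmod ?k)^2" by simp
  moreover have "\<bar>Re (cnj ?P * ?d^2)\<bar> \<le> 3 * K^2 * (cmod ?d)^2"
    by (rule order_trans[OF abs_Re_le_cmod])
      (use defect_bound[OF assms(1)] in \<open>simp add: norm_mult norm_power mult_right_mono\<close>)
  moreover have "(cmod ?k)^2 \<le> (3 * K * cmod ?d)^2"
    using defect_lipschitz[OF assms(2,1)] by (intro power_mono) auto
  then have "(cmod ?k)^2 \<le> 9 * K^2 * (cmod ?d)^2" by (simp add: power_mult_distrib)
  moreover have "0 \<le> (cmod ?k)^2" by simp
  ultimately show ?thesis by linarith
qed

lemma perturbation:
  assumes "p \<in> tri n" "t = (c - x p) / sqrt (real n)"
  shows "entry_perturbation n p z (of_real t) (wigner n x) (wigner n (x(p := c)))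
    (resolvent z (wigner n x)) (resolvent z (wigner n (x(p := c)))) (sym_unit n p) K"
  by (unfold_locales, unfold assms(2)) (fact assms z K1 Kz wigner_hermitian wigner_update refl)+

lemma stieltjes_diff_bound:
  assumes "p \<in> tri n"
  shows "cmod (stieltjes z n (x(p := c)) - stieltjes z n x) \<le> 2 * K^2 * \<bar>(c - x p) / sqrt (real n)\<bar> / real n"
proof -
  define t where "t = (c - x p) / sqrt (real n)"
  interpret entry_perturbation n p z "of_real t" "wigner n x" "wigner n (x(p := c))"
    "resolvent z (wigner n x)" "resolvent z (wigner n (x(p := c)))" "sym_unit n p" K
    by (rule perturbation[where x = x and c = c, OF assms t_def])
  show ?thesis unfolding t_def[symmetric] using mtr_diff_bound
    by (simp add: stieltjes_def diff_divide_distrib[symmetric] norm_divide divide_right_mono mult.commute)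
qed

text \<open>Large enough for all the estimates at a fixed \<open>z\<close>: the largest of them, in \<open>coeff2_update\<close>, needs
  \<open>228 K\<^sup>7\<close>.\<close>

definition C :: real where "C = 300 * K^7"

lemma C_ge: "k \<le> 7 \<Longrightarrow> a \<le> 300 \<Longrightarrow> 0 \<le> a \<Longrightarrow> a * K^k \<le> C" "0 \<le> C"
  unfolding C_def using K1 by (auto intro!: mult_mono power_increasing)

lemma coeff1_bound:
  assumes "p \<in> tri n" shows "\<bar>coeff1 z n p x\<bar> \<le> C / real n"
proof -
  let ?R = "resolvent z (wigner n x)"
  have "\<bar>Re (sq_defect_grad z (stieltjes z n x) * etr p (?R * ?R))\<bar> \<le> (18 * K^3) * (2 * (K * K))"
    by (rule order_trans[OF abs_Re_le_cmod], unfold norm_mult, intro mult_mono grad_bound stieltjes_bound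
        etr_bound[OF _ assms] op_bound_mult op_bound_R) (use K0 in auto)
  also have "\<dots> = 36 * K^5" by (simp add: eval_nat_numeral)
  also have "\<dots> \<le> C" by (rule C_ge) auto
  finally show ?thesis by (simp add: coeff1_def divide_right_mono)
qed

lemma coeff2_bound:
  assumes "p \<in> tri n" shows "\<bar>coeff2 z n p x\<bar> \<le> 36 * K^6 / real n" "\<bar>coeff2 z n p x\<bar> \<le> C / real n"
proof -
  let ?R = "resolvent z (wigner n x)"
  have "\<bar>Re (sq_defect_grad z (stieltjes z n x) * etr p (?R * (sym_unit n p * (?R * ?R))))\<bar> \<le>
      (18 * K^3) * (2 * (K * (1 * (K * K))))"
    by (rule order_trans[OF abs_Re_le_cmod], unfold norm_mult, intro mult_mono grad_bound stieltjes_bound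
        etr_bound[OF _ assms] op_bound_mult op_bound_R op_bound_sym_unit assms) (use K0 in auto)
  also have "\<dots> = 36 * K^6" by (simp add: eval_nat_numeral)
  finally show b: "\<bar>coeff2 z n p x\<bar> \<le> 36 * K^6 / real n"
    by (simp add: coeff2_def divide_right_mono Let_def)
  show "\<bar>coeff2 z n p x\<bar> \<le> C / real n"
    by (rule order_trans[OF b divide_right_mono[OF C_ge(1)]]) auto
qed

text \<open>The factor \<open>min 1\<close> matters: the entry \<open>q\<close> is later multiplied by the square of another entry, and
  its product with an unbounded \<open>|x q|\<close> need not be integrable.\<close>

lemma coeff2_update:
  assumes p: "p \<in> tri n" and q: "q \<in> tri n"
  shows "\<bar>coeff2 z n p (x(q := c)) - coeff2 z n p x\<bar> \<le> C / real n * min 1 \<bar>(c - x q) / sqrt (real n)\<bar>"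
proof -
  define t where "t = (c - x q) / sqrt (real n)"
  interpret entry_perturbation n q z "of_real t" "wigner n x" "wigner n (x(q := c))"
    "resolvent z (wigner n x)" "resolvent z (wigner n (x(q := c)))" "sym_unit n q" K
    by (rule perturbation[where x = x and c = c, OF q t_def])
  have n: "1 \<le> real n" using p by (auto simp: tri_def)
  define R T where "R = resolvent z (wigner n x)" "T = resolvent z (wigner n (x(q := c)))"
  define S S' where "S = stieltjes z n x" "S' = stieltjes z n (x(q := c))"
  define b b' where "b = etr p (R * (sym_unit n p * (R * R)))" "b' = etr p (T * (sym_unit n p * (T * T)))"
  have "cmod (S' - S) \<le> 2 * K^2 * \<bar>t\<bar> / real n"
    using stieltjes_diff_bound[OF q] by (simp add: S_S'_def t_def)
  also have "\<dots> \<le> 2 * K^2 * \<bar>t\<bar> / 1" using n by (intro divide_left_mono) auto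
  finally have dS: "cmod (S' - S) \<le> 2 * K^2 * \<bar>t\<bar>" by simp
  have SK: "cmod S \<le> K" "cmod S' \<le> K" by (simp_all add: S_S'_def stieltjes_bound)
  have db: "cmod (b' - b) \<le> 6 * K^4 * \<bar>t\<bar>"
    using etr_quadratic_change[OF assms(1)] by (simp add: b_b'_def R_T_def)
  have "cmod b \<le> 2 * (K * (1 * (K * K)))" unfolding b_b'_def R_T_def
    by (intro etr_bound[OF _ assms(1)] op_bound_mult op_bound_R op_bound_sym_unit assms(1))
  then have bK: "cmod b \<le> 2 * K^3" by (simp add: eval_nat_numeral)
  have "sq_defect_grad z S' * b' - sq_defect_grad z S * b =
      (sq_defect_grad z S' - sq_defect_grad z S) * b + sq_defect_grad z S' * (b' - b)"
    by (simp add: algebra_simps)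
  also have "cmod \<dots> \<le> (30 * K^2 * (2 * K^2 * \<bar>t\<bar>)) * (2 * K^3) + (18 * K^3) * (6 * K^4 * \<bar>t\<bar>)"
    using K0 dS by (intro order_trans[OF norm_triangle_ineq] add_mono, unfold norm_mult)
      (intro mult_mono bK db order_trans[OF grad_lipschitz[OF SK(2,1)]] grad_bound SK; simp add: mult_left_mono)+
  also have "\<dots> = 228 * K^7 * \<bar>t\<bar>" by (simp add: eval_nat_numeral)
  also have "\<dots> \<le> C * \<bar>t\<bar>" by (intro mult_right_mono C_ge) auto
  finally have "\<bar>Re (sq_defect_grad z S' * b') - Re (sq_defect_grad z S * b)\<bar> \<le> C * \<bar>t\<bar>"
    using abs_Re_le_cmod order_trans by (metis minus_complex.simps(1))
  then have b1: "\<bar>coeff2 z n p (x(q := c)) - coeff2 z n p x\<bar> \<le> C * \<bar>t\<bar> / real n"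
    by (simp add: coeff2_def Let_def b_b'_def R_T_def S_S'_def diff_divide_distrib[symmetric] divide_right_mono)
  have "\<bar>coeff2 z n p (x(q := c)) - coeff2 z n p x\<bar> \<le> 36 * K^6 / real n + 36 * K^6 / real n"
    by (intro order_trans[OF abs_triangle_ineq4] add_mono coeff2_bound assms(1))
  also have "\<dots> = 72 * K^6 / real n" by simp
  also have "\<dots> \<le> C / real n" by (intro divide_right_mono C_ge) auto
  finally have b2: "\<bar>coeff2 z n p (x(q := c)) - coeff2 z n p x\<bar> \<le> C / real n" .
  show ?thesis using b1 b2 by (simp add: t_def min_def)
qed

text \<open>The expansion is around the matrix with the entry \<open>p\<close> set to zero, so its coefficients do not
  depend on that entry. The last summand comes from the squared change of \<open>S\<close>; summed over the
  \<open>O(n\<^sup>2)\<close> entries, with \<open>t\<^sup>2\<close> of order \<open>1 / n\<close>, it contributes only \<open>O(1 / n)\<close>.\<close>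

lemma sq_defect_taylor:
  fixes x :: "nat \<times> nat \<Rightarrow> real"
  assumes p: "p \<in> tri n"
  defines "t \<equiv> x p / sqrt (real n)" and "y \<equiv> x(p := 0)"
  shows "\<bar>sq_defect z n x - sq_defect z n y - t * coeff1 z n p y - t^2 * coeff2 z n p y\<bar>
    \<le> C / real n * min (t^2) (\<bar>t\<bar>^3) + C * t^2 / (real n)^2"
proof -
  have xy: "y(p := x p) = x" by (simp add: y_def)
  have t': "(x p - y p) / sqrt (real n) = t" by (simp add: y_def t_def)
  interpret entry_perturbation n p z "of_real t" "wigner n y" "wigner n x"
    "resolvent z (wigner n y)" "resolvent z (wigner n x)" "sym_unit n p" K
    using perturbation[where x = y and c = "x p", OF p t'[symmetric]] by (simp only: xy)
  have n: "1 \<le> real n" using p by (auto simp: tri_def)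
  define R T where "R = resolvent z (wigner n y)" "T = resolvent z (wigner n x)"
  define S S' g where "S = stieltjes z n y" "S' = stieltjes z n x" "g = sq_defect_grad z S"
  have SK: "cmod S \<le> K" "cmod S' \<le> K" by (simp_all add: S_S'_g_def stieltjes_bound)
  define a b where "a = etr p (R * R)" "b = etr p (R * (sym_unit n p * (R * R)))"
  define r where "r = mtr T - mtr R + t * a - t^2 * b"
  have r: "cmod r \<le> 4 * K^4 * min (t^2) (\<bar>t\<bar>^3)"
    using mtr_second_order by (simp add: r_def R_T_def a_b_def)
  have dS: "S' - S = (- t * a + t^2 * b + r) / of_nat n"
    by (simp add: S_S'_g_def stieltjes_def r_def R_T_def diff_divide_distrib[symmetric])
  have "cmod (S' - S) \<le> 2 * K^2 * \<bar>t\<bar> / real n"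
    using stieltjes_diff_bound[OF p, of y "x p"] xy t' by (simp only: S_S'_g_def)
  then have "(cmod (S' - S))^2 \<le> (2 * K^2 * \<bar>t\<bar> / real n)^2" by (intro power_mono) auto
  also have "\<dots> = 4 * K^4 * (t^2 / (real n)^2)"
    by (simp add: power_mult_distrib power_divide)
  finally have "15 * K^2 * (cmod (S' - S))^2 \<le> 15 * K^2 * (4 * K^4 * (t^2 / (real n)^2))"
    by (intro mult_left_mono) auto
  also have "\<dots> = 60 * K^6 * (t^2 / (real n)^2)" by (simp add: eval_nat_numeral)
  also have "\<dots> \<le> C * (t^2 / (real n)^2)" by (intro mult_right_mono C_ge) auto
  finally have e1: "\<bar>sq_defect z n x - sq_defect z n y - Re (g * (S' - S))\<bar> \<le> C * t^2 / (real n)^2"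
    using sq_defect_expand[OF SK] by (simp add: sq_defect_def S_S'_g_def)
  have "g * (S' - S) = (of_real (- t) * (g * a) + of_real (t^2) * (g * b) + g * r) / of_real (real n)"
    by (simp add: dS algebra_simps)
  then have "Re (g * (S' - S)) = (- t * Re (g * a) + t^2 * Re (g * b) + Re (g * r)) / real n"
    by (simp only: Re_divide_of_real plus_complex.simps Re_of_real_mult)
  also have "\<dots> = t * coeff1 z n p y + t^2 * coeff2 z n p y + Re (g * r) / real n"
    by (simp add: coeff1_def coeff2_def Let_def a_b_def R_T_def S_S'_g_def add_divide_distrib diff_divide_distrib
        algebra_simps)
  finally have e2: "Re (g * (S' - S)) = t * coeff1 z n p y + t^2 * coeff2 z n p y + Re (g * r) / real n" .
  have "\<bar>Re (g * r)\<bar> \<le> (18 * K^3) * (4 * K^4 * min (t^2) (\<bar>t\<bar>^3))"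
    by (rule order_trans[OF abs_Re_le_cmod], unfold norm_mult, intro mult_mono r)
      (use grad_bound[OF SK(1)] K0 in \<open>auto simp: S_S'_g_def\<close>)
  also have "\<dots> = 72 * K^7 * min (t^2) (\<bar>t\<bar>^3)" by (simp add: eval_nat_numeral)
  also have "\<dots> \<le> C * min (t^2) (\<bar>t\<bar>^3)" by (intro mult_right_mono C_ge) auto
  finally have "\<bar>Re (g * r) / real n\<bar> \<le> C / real n * min (t^2) (\<bar>t\<bar>^3)"
    by (simp add: divide_right_mono)
  then show ?thesis using e1 e2 by linarith
qed

end

section \<open>Averages over independent signs\<close>

text \<open>The expectation over independent uniform signs at the positions \<open>ps\<close>, the other coordinates being
  those of \<open>x\<close>. The recursion does the work of a product measure and peels off one position at a time.\<close>

fun sign_avg :: "'i list \<Rightarrow> (('i \<Rightarrow> real) \<Rightarrow> real) \<Rightarrow> ('i \<Rightarrow> real) \<Rightarrow> real" where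
  "sign_avg [] g x = g x"
| "sign_avg (p # ps) g x = (sign_avg ps g (x(p := 1)) + sign_avg ps g (x(p := -1))) / 2"

lemma sign_avg_commute: "sign_avg ps (sign_avg [p] g) x = sign_avg [p] (sign_avg ps g) x"
proof (induction ps arbitrary: x)
  case (Cons q ps)
  have "sign_avg (q # ps) (sign_avg [p] g) x =
      (sign_avg [p] (sign_avg ps g) (x(q := 1)) + sign_avg [p] (sign_avg ps g) (x(q := -1))) / 2"
    by (subst sign_avg.simps(2), subst (1 2) Cons.IH, rule refl)
  also have "\<dots> = sign_avg [p] (sign_avg (q # ps) g) x"
    by (cases "p = q") (simp_all add: fun_upd_twist[of p q] add_divide_distrib)
  finally show ?case .
qed simp

lemma sign_avg_absorb:
  assumes "p \<in> set ps"
  shows "sign_avg ps (sign_avg [p] g) x = sign_avg ps g x"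
  using assms
proof (induction ps arbitrary: x)
  case (Cons q ps)
  show ?case
  proof (cases "p = q")
    case True
    have "sign_avg (q # ps) (sign_avg [p] g) x =
        (sign_avg [p] (sign_avg ps g) (x(q := 1)) + sign_avg [p] (sign_avg ps g) (x(q := -1))) / 2"
      by (subst sign_avg.simps(2), simp only: sign_avg_commute)
    also have "\<dots> = sign_avg (q # ps) g x" by (simp add: True)
    finally show ?thesis .
  qed (use Cons in simp)
qed simp

text \<open>The arguments at which \<^const>\<open>sign_avg\<close> evaluates the averaged function.\<close>

definition sign_completion :: "'i list \<Rightarrow> ('i \<Rightarrow> real) \<Rightarrow> ('i \<Rightarrow> real) \<Rightarrow> bool" where
  "sign_completion ps x y \<longleftrightarrow> (\<forall>q. q \<notin> set ps \<longrightarrow> y q = x q) \<and> (\<forall>q\<in>set ps. y q = 1 \<or> y q = -1)"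

lemma sign_avg_mono:
  assumes "\<And>y. sign_completion ps x y \<Longrightarrow> g y \<le> h y"
  shows "sign_avg ps g x \<le> sign_avg ps h x"
  using assms
proof (induction ps arbitrary: x)
  case (Cons p ps)
  have "sign_avg ps g (x(p := c)) \<le> sign_avg ps h (x(p := c))" if "c = 1 \<or> c = -1" for c
    by (rule Cons.IH, rule Cons.prems) (use that in \<open>auto simp: sign_completion_def split: if_splits\<close>)
  then show ?case by (simp add: add_mono)
qed (simp add: sign_completion_def)

lemma sign_avg_add: "sign_avg ps (\<lambda>y. g y + h y) x = sign_avg ps g x + sign_avg ps h x"
  by (induction ps arbitrary: x) (simp_all add: add_divide_distrib)

lemma sign_avg_cmult: "sign_avg ps (\<lambda>y. c * g y) x = c * sign_avg ps g x"
  by (induction ps arbitrary: x) (simp_all add: add_divide_distrib distrib_left)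

lemma sign_avg_const: "sign_avg ps (\<lambda>y. c) x = c"
  by (induction ps arbitrary: x) simp_all

lemma sign_avg_diff: "sign_avg ps (\<lambda>y. g y - h y) x = sign_avg ps g x - sign_avg ps h x"
  using sign_avg_add[of ps g "\<lambda>y. - 1 * h y" x] by (simp only: sign_avg_cmult) simp

lemmas sign_avg_lin = sign_avg_add sign_avg_diff sign_avg_cmult sign_avg_const

lemma sign_avg_sum: "sign_avg ps (\<lambda>y. \<Sum>i\<in>I. g i y) x = (\<Sum>i\<in>I. sign_avg ps (g i) x)"
  by (induction I rule: infinite_finite_induct) (simp_all add: sign_avg_lin)

lemma sign_avg_abs_le:
  assumes "\<And>y. sign_completion ps x y \<Longrightarrow> \<bar>g y\<bar> \<le> c"
  shows "\<bar>sign_avg ps g x\<bar> \<le> c"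
proof -
  have "sign_avg ps g x \<le> sign_avg ps (\<lambda>_. c) x" "sign_avg ps (\<lambda>_. - c) x \<le> sign_avg ps g x"
    using assms by (intro sign_avg_mono; force simp: abs_le_iff)+
  then show ?thesis by (simp add: sign_avg_lin)
qed

lemma finite_tri [simp]: "finite (tri n)"
  by (rule finite_subset[of _ "{..<n} \<times> {..<n}"]) (auto simp: tri_def)

lemma card_tri: "card (tri n) \<le> n * n"
proof -
  have "tri n \<subseteq> {..<n} \<times> {..<n}" by (auto simp: tri_def)
  then show ?thesis using card_mono[of "{..<n} \<times> {..<n}" "tri n"] by simp
qed

lemma sum_square_tri:
  "(\<Sum>i<n. \<Sum>j<n. g (i,j)) = (\<Sum>p\<in>tri n. if fst p = snd p then g p else g p + g (prod.swap p) :: complex)"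
proof -
  let ?L = "{p \<in> tri n. fst p \<noteq> snd p}"
  have "(\<Sum>i<n. \<Sum>j<n. g (i,j)) = sum g ({..<n} \<times> {..<n})"
    by (simp add: sum.cartesian_product)
  also have "{..<n} \<times> {..<n} = tri n \<union> prod.swap ` ?L"
    by (auto simp: tri_def image_iff) 
  also have "sum g (tri n \<union> prod.swap ` ?L) = sum g (tri n) + sum g (prod.swap ` ?L)"
    by (rule sum.union_disjoint, simp_all) (auto simp: tri_def)
  also have "sum g (prod.swap ` ?L) = (\<Sum>p\<in>?L. g (prod.swap p))"
    by (subst sum.reindex) auto
  also have "\<dots> = (\<Sum>p\<in>tri n. if fst p = snd p then 0 else g (prod.swap p))"
    by (subst sum.inter_filter) (auto intro!: sum.cong)
  also have "sum g (tri n) + \<dots> = (\<Sum>p\<in>tri n. if fst p = snd p then g p else g p + g (prod.swap p))"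
    by (subst sum.distrib[symmetric]) (auto intro!: sum.cong)
  finally show ?thesis .
qed

lemma mtr_wigner_mult:
  assumes A: "A \<in> carrier_mat n n"
  shows "mtr (wigner n x * A) = (\<Sum>p\<in>tri n. of_real (x p / sqrt (real n)) * etr p A)"
proof -
  have "mtr (wigner n x * A) = (\<Sum>i<n. \<Sum>j<n. wigner n x $$ (i,j) * A $$ (j,i))"
    unfolding mtr_def using A by (auto simp: scalar_prod_def lessThan_atLeast0 intro!: sum.cong)
  also have "\<dots> = (\<Sum>i<n. \<Sum>j<n. (\<lambda>(i,j). wigner n x $$ (i,j) * A $$ (j,i)) (i,j))" by simp
  also have "\<dots> = (\<Sum>p\<in>tri n. of_real (x p / sqrt (real n)) * etr p A)"
    unfolding sum_square_tri by (intro sum.cong) (auto simp: tri_def etr_def wigner_def max_def min_def algebra_simps add_divide_distrib)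
  finally show ?thesis .
qed

text \<open>The sum over all entries of the second-order effect recovers the square of the trace. This is where
  the quadratic term of the semicircle equation comes from; the other summand is a squared
  Hilbert-Schmidt norm and has lower order.\<close>

lemma etr_sandwich_sum:
  assumes R: "R \<in> carrier_mat n n"
  shows "(\<Sum>p\<in>tri n. etr p (R * (sym_unit n p * R))) =
    (mtr R)^2 + (\<Sum>i<n. \<Sum>j<n. if i = j then 0 else (R $$ (i,j))^2)"
proof -
  define g where "g = (\<lambda>(i,j). R $$ (i,i) * R $$ (j,j) + (if i = j then 0 else (R $$ (i,j))^2))"
  have entry: "(R * (sym_unit n (i,j) * R)) $$ (a,b) =
      R $$ (a,i) * R $$ (j,b) + (if i = j then 0 else R $$ (a,j) * R $$ (i,b))"
    if ij: "(i,j) \<in> tri n" and ab: "a < n" "b < n" for i j a b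
  proof -
    have ER: "(sym_unit n (i,j) * R) $$ (k,b) = (if k = i then R $$ (j,b) else if k = j then R $$ (i,b) else 0)"
      if "k < n" for k
      using sum_sym_unit[OF ij that, of "\<lambda>m. R $$ (m,b)"] R that ab
      by (simp add: scalar_prod_def lessThan_atLeast0 times_mat_def)
    have "(R * (sym_unit n (i,j) * R)) $$ (a,b) = (\<Sum>k<n. R $$ (a,k) * (sym_unit n (i,j) * R) $$ (k,b))"
      using R ab by (simp add: scalar_prod_def lessThan_atLeast0)
    also have "\<dots> = (\<Sum>k<n. (if k = i then R $$ (a,i) * R $$ (j,b) else 0) +
        (if k = j then (if i = j then 0 else R $$ (a,j) * R $$ (i,b)) else 0))"
      by (intro sum.cong refl) (auto simp: ER simp del: index_mult_mat(1))
    also have "\<dots> = R $$ (a,i) * R $$ (j,b) + (if i = j then 0 else R $$ (a,j) * R $$ (i,b))"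
      using ij by (simp add: sum.distrib tri_def)
    finally show ?thesis .
  qed
  have "(\<Sum>p\<in>tri n. etr p (R * (sym_unit n p * R))) =
      (\<Sum>p\<in>tri n. if fst p = snd p then g p else g p + g (prod.swap p))"
  proof (intro sum.cong refl)
    fix p assume p: "p \<in> tri n"
    obtain i j where [simp]: "p = (i,j)" by force
    have "i < n" "j < n" using p by (auto simp: tri_def)
    then show "etr p (R * (sym_unit n p * R)) = (if fst p = snd p then g p else g p + g (prod.swap p))"
      using entry[of i j] p by (auto simp: etr_def g_def power2_eq_square simp del: index_mult_mat(1))
  qed
  also have "\<dots> = (\<Sum>i<n. \<Sum>j<n. g (i,j))" by (rule sum_square_tri[symmetric])
  also have "\<dots> = (mtr R)^2 + (\<Sum>i<n. \<Sum>j<n. if i = j then 0 else (R $$ (i,j))^2)"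
    using R by (simp add: g_def sum.distrib mtr_def power2_eq_square sum_product)
  finally show ?thesis .
qed

section \<open>Random sign matrices almost solve the semicircle equation\<close>

context spectral_parameter
begin

text \<open>The normalised trace of \<open>(H - z) R = 1\<close>.\<close>

lemma one_plus_z_stieltjes:
  assumes "0 < n"
  shows "1 + z * stieltjes z n x =
    (\<Sum>p\<in>tri n. of_real (x p / sqrt (real n)) * etr p (resolvent z (wigner n x))) / of_nat n"
proof -
  let ?H = "wigner n x" and ?R = "resolvent z (wigner n x)"
  have R: "?R \<in> carrier_mat n n" by (rule op_boundD(1)[OF op_bound_R])
  have "(?H - z \<cdot>\<^sub>m 1\<^sub>m n) * ?R = ?H * ?R - z \<cdot>\<^sub>m (1\<^sub>m n * ?R)"
    using R by (intro square_mult_diff_smult(2)[where n = n]) auto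
  then have "?H * ?R - z \<cdot>\<^sub>m ?R = 1\<^sub>m n"
    using resolvent_right[OF wigner_hermitian z] R by simp
  then have "mtr (?H * ?R - z \<cdot>\<^sub>m ?R) = of_nat n" by (simp add: mtr_def)
  then have "mtr (?H * ?R) - z * mtr ?R = of_nat n"
    using mtr_diff_smult[of "?H * ?R" n ?R z] R by simp
  then have "mtr (?H * ?R) = of_nat n + z * mtr ?R" by (simp only: diff_eq_eq)
  then show ?thesis
    unfolding mtr_wigner_mult[OF R, symmetric] using assms by (simp add: stieltjes_def add_divide_distrib)
qed

text \<open>By \<open>one_plus_z_stieltjes\<close>, \<open>|P(S)|\<^sup>2\<close> is the sum of the terms \<open>y p * flip_obs n p y\<close>, up to normalisation
  and the contribution of \<open>S\<^sup>2\<close>. \<open>flip_deriv\<close> is, up to sign, the derivative of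
  \<open>flip_obs n p\<close> in the rescaled entry \<open>p\<close>, with the factor \<open>P\<close> held fixed.\<close>

definition flip_obs :: "nat \<Rightarrow> nat \<times> nat \<Rightarrow> (nat \<times> nat \<Rightarrow> real) \<Rightarrow> real" where
  "flip_obs n p y = Re (cnj (defect z (stieltjes z n y)) * etr p (resolvent z (wigner n y)))"

definition flip_deriv :: "nat \<Rightarrow> nat \<times> nat \<Rightarrow> (nat \<times> nat \<Rightarrow> real) \<Rightarrow> real" where
  "flip_deriv n p y = Re (cnj (defect z (stieltjes z n y)) *
     (let R = resolvent z (wigner n y) in etr p (R * (sym_unit n p * R))))"

text \<open>The expansion is around the sign matrix \<open>y\<close> itself and not around the one with entry 0 at \<open>p\<close>, so
  that the derivatives for the different \<open>p\<close> refer to the same matrix and can be summed up. The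
  factor \<open>P\<close> may be held fixed because it moves by \<open>O(n\<^sup>-\<^sup>3\<^sup>/\<^sup>2)\<close> only.\<close>

lemma flip_obs_change:
  assumes p: "p \<in> tri n" and y: "y p = 1 \<or> y p = -1"
  shows "\<bar>flip_obs n p (y(p := - y p)) - flip_obs n p y - 2 * y p / sqrt (real n) * flip_deriv n p y\<bar> \<le> C / real n"
proof -
  define y' where "y' = y(p := - y p)"
  define t where "t = - (2 * y p / sqrt (real n))"
  have t': "t = (- y p - y p) / sqrt (real n)" by (simp add: t_def)
  interpret entry_perturbation n p z "of_real t" "wigner n y" "wigner n y'"
    "resolvent z (wigner n y)" "resolvent z (wigner n y')" "sym_unit n p" K
    unfolding y'_def by (rule perturbation[where x = y and c = "- y p", OF assms(1) t'])
  have n: "1 \<le> real n" using assms(1) by (auto simp: tri_def)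
  have t1: "\<bar>t\<bar> \<le> 2" and t2: "t^2 = 4 / real n"
    using y n real_sqrt_ge_one[OF n]
    by (auto simp: t_def power_divide power_mult_distrib abs_mult divide_le_eq)
  define R T where "R = resolvent z (wigner n y)" "T = resolvent z (wigner n y')"
  let ?e = "etr p (R * (sym_unit n p * R))"
  define P Q where "P = defect z (stieltjes z n y)" "Q = defect z (stieltjes z n y')"
  have c: "R \<in> carrier_mat n n" "T \<in> carrier_mat n n" using carriers by (auto simp: R_T_def)
  have e: "cmod (etr p T - etr p R + t * ?e) \<le> t^2 * (2 * K^3)"
    using etr_first_order(2)[OF op_bound_one] c by (simp add: R_T_def right_mult_one_mat[of _ n n])
  have "cmod (Q - P) \<le> 3 * K * cmod (stieltjes z n y' - stieltjes z n y)"
    unfolding P_Q_def by (intro defect_lipschitz stieltjes_bound)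
  also have "\<dots> \<le> 3 * K * (2 * K^2 * \<bar>t\<bar> / real n)"
    using stieltjes_diff_bound[OF assms(1), where x = y and c = "- y p"] K0 unfolding t' y'_def
    by (intro mult_left_mono) auto
  also have "\<dots> \<le> 3 * K * (2 * K^2 * 2 / real n)"
    using t1 K0 by (intro mult_left_mono divide_right_mono) auto
  finally have PQ: "cmod (Q - P) \<le> 12 * K^3 / real n" by (simp add: eval_nat_numeral)
  have eT: "cmod (etr p T) \<le> 2 * K" unfolding R_T_def by (intro etr_bound[OF _ assms(1)] op_bound_R)
  have PK: "cmod P \<le> 3 * K^2" unfolding P_Q_def by (intro defect_bound stieltjes_bound)
  have "cnj Q * etr p T - cnj P * etr p R + t * (cnj P * ?e) =
      cnj (Q - P) * etr p T + cnj P * (etr p T - etr p R + t * ?e)"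
    by (simp add: algebra_simps)
  also have "cmod \<dots> \<le> (12 * K^3 / real n) * (2 * K) + 3 * K^2 * (t^2 * (2 * K^3))"
    using K0 by (intro order_trans[OF norm_triangle_ineq] add_mono, unfold norm_mult complex_mod_cnj)
      (intro mult_mono PQ eT PK e; simp)+
  also have "\<dots> = 24 * K^4 / real n + 24 * K^5 / real n"
    unfolding t2 by (simp add: eval_nat_numeral)
  also have "\<dots> \<le> 24 * K^5 / real n + 24 * K^5 / real n"
    using K1 by (intro add_mono divide_right_mono mult_left_mono power_increasing) auto
  also have "\<dots> = 48 * K^5 / real n" by simp
  also have "\<dots> \<le> C / real n" by (intro divide_right_mono C_ge) auto
  finally have "cmod (cnj Q * etr p T - cnj P * etr p R + t * (cnj P * ?e)) \<le> C / real n" .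
  then have "\<bar>Re (cnj Q * etr p T - cnj P * etr p R + t * (cnj P * ?e))\<bar> \<le> C / real n"
    using abs_Re_le_cmod order_trans by blast
  moreover have "Re (cnj Q * etr p T - cnj P * etr p R + t * (cnj P * ?e)) =
     flip_obs n p y' - flip_obs n p y + t * flip_deriv n p y"
    by (simp add: flip_obs_def flip_deriv_def R_T_def P_Q_def Let_def)
  ultimately show ?thesis by (simp add: t_def y'_def)
qed

text \<open>Integration by parts for a random sign: the average of \<open>y p * h\<close> is half the difference of the
  values of \<open>h\<close> at the two signs.\<close>

lemma sign_avg_flip_obs:
  assumes p: "p \<in> tri n" "p \<in> set ps"
  shows "sign_avg ps (\<lambda>y. y p * flip_obs n p y) x \<le>
    sign_avg ps (\<lambda>y. - (1 / sqrt (real n)) * flip_deriv n p y) x + C / real n"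
proof -
  have "sign_avg ps (\<lambda>y. y p * flip_obs n p y) x = sign_avg ps (sign_avg [p] (\<lambda>y. y p * flip_obs n p y)) x"
    by (rule sign_avg_absorb[OF p(2), symmetric])
  also have "\<dots> \<le> sign_avg ps (\<lambda>y. - (1 / sqrt (real n)) * flip_deriv n p y + C / real n) x"
  proof (rule sign_avg_mono)
    fix y assume "sign_completion ps x y"
    then have y: "y p = 1 \<or> y p = -1" using p(2) by (auto simp: sign_completion_def)
    have n: "0 \<le> C / real n" using C_ge(2) by simp
    from flip_obs_change[where y = y, OF p(1) y] y n
    show "sign_avg [p] (\<lambda>y. y p * flip_obs n p y) y \<le> - (1 / sqrt (real n)) * flip_deriv n p y + C / real n"
      by (elim disjE) (simp_all add: fun_upd_idem abs_le_iff)
  qed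
  also have "\<dots> = sign_avg ps (\<lambda>y. - (1 / sqrt (real n)) * flip_deriv n p y) x + C / real n"
    by (simp only: sign_avg_add sign_avg_const)
  finally show ?thesis .
qed

text \<open>Integration by parts in every entry replaces \<open>1 + z S\<close> by minus the normalised sum of the
  \<open>flip_deriv\<close>, which is \<open>-S\<^sup>2\<close> up to \<open>O(1 / n)\<close> by \<open>etr_sandwich_sum\<close> and thus cancels the
  quadratic term of \<open>P\<close>. The \<open>O(n\<^sup>2)\<close> errors of size \<open>1 / n\<close>, weighted by \<open>n\<^sup>-\<^sup>3\<^sup>/\<^sup>2\<close>, sum up to the stated
  bound.\<close>

theorem sign_avg_sq_defect:
  assumes ps: "set ps = tri n" and n: "0 < n"
  shows "sign_avg ps (sq_defect z n) x \<le> 2 * C / sqrt (real n)"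
proof -
  let ?D = "\<lambda>y. \<Sum>p\<in>tri n. flip_deriv n p y" and ?c = "C / sqrt (real n)"
  let ?r = "real n * sqrt (real n)"
  have r: "0 < ?r" using n by simp
  define W where "W = (\<lambda>y. Re (cnj (defect z (stieltjes z n y)) * (stieltjes z n y)^2))"
  have dec: "sq_defect z n y = (\<Sum>p\<in>tri n. (1 / ?r) * (y p * flip_obs n p y)) + W y" for y
  proof -
    let ?P = "defect z (stieltjes z n y)"
    have "of_real (sq_defect z n y) = cnj ?P * ((1 + z * stieltjes z n y) + (stieltjes z n y)^2)"
      unfolding sq_defect_def complex_norm_square by (simp add: defect_def mult.commute)
    also have "\<dots> = (\<Sum>p\<in>tri n. of_real (y p / ?r) * (cnj ?P * etr p (resolvent z (wigner n y)))) +
        cnj ?P * (stieltjes z n y)^2"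
      unfolding one_plus_z_stieltjes[OF n] distrib_left
      by (simp add: sum_distrib_left sum_divide_distrib mult_ac)
    finally have "sq_defect z n y = Re \<dots>" by (metis Re_complex_of_real)
    also have "\<dots> = (\<Sum>p\<in>tri n. y p / ?r * flip_obs n p y) + W y"
      by (simp only: plus_complex.simps Re_sum Re_of_real_mult W_def flip_obs_def)
    finally show ?thesis by simp
  qed
  have "sign_avg ps (sq_defect z n) x = (\<Sum>p\<in>tri n. (1 / ?r) * sign_avg ps (\<lambda>y. y p * flip_obs n p y) x) + sign_avg ps W x"
    unfolding dec[abs_def] by (simp only: sign_avg_lin sign_avg_sum)
  also have "\<dots> \<le> (\<Sum>p\<in>tri n. (1 / ?r) * (sign_avg ps (\<lambda>y. - (1 / sqrt (real n)) * flip_deriv n p y) x + C / real n)) + sign_avg ps W x"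
    using r ps by (intro add_right_mono sum_mono mult_left_mono sign_avg_flip_obs) auto
  also have "\<dots> = (\<Sum>p\<in>tri n. - (1 / (real n)^2) * sign_avg ps (flip_deriv n p) x + C / (real n * ?r)) + sign_avg ps W x"
  proof -
    have "(1 / ?r) * (sign_avg ps (\<lambda>y. - (1 / sqrt (real n)) * flip_deriv n p y) x + C / real n) =
        - (1 / (real n)^2) * sign_avg ps (flip_deriv n p) x + C / (real n * ?r)" for p
    proof -
      have "(1 / ?r) * (1 / sqrt (real n)) = 1 / (real n)^2"
        using n by (simp add: power2_eq_square)
      then show ?thesis unfolding sign_avg_cmult by (simp add: algebra_simps)
    qed
    then show ?thesis by simp
  qed
  also have "\<dots> = sign_avg ps (\<lambda>y. W y + - (1 / (real n)^2) * ?D y) x +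
      real (card (tri n)) * (C / (real n * ?r))"
    by (simp only: sign_avg_add sign_avg_cmult sign_avg_sum sum.distrib sum_distrib_left sum_constant)
  also have "\<dots> = sign_avg ps (\<lambda>y. W y - ?D y / (real n)^2) x +
      real (card (tri n)) * (C / (real n * ?r))" by simp
  also have "\<dots> \<le> ?c + ?c"
  proof (rule add_mono)
    have "sign_avg ps (\<lambda>y. W y - ?D y / (real n)^2) x \<le> sign_avg ps (\<lambda>_. ?c) x"
    proof (rule sign_avg_mono)
      fix y
      let ?R = "resolvent z (wigner n y)" and ?P = "defect z (stieltjes z n y)"
      define off where "off = (\<Sum>i<n. \<Sum>j<n. if i = j then 0 else (?R $$ (i,j))^2)"
      have R: "?R \<in> carrier_mat n n" by (rule op_boundD(1)[OF op_bound_R])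
      have "?D y = Re (cnj ?P * (\<Sum>p\<in>tri n. etr p (?R * (sym_unit n p * ?R))))"
        by (simp add: flip_deriv_def Let_def sum_distrib_left del: times_complex.simps)
      also have "\<dots> = Re (cnj ?P * ((of_real ((real n)^2) * (stieltjes z n y)^2) + off))"
        using n by (simp add: etr_sandwich_sum[OF R] off_def stieltjes_def power_divide)
      also have "\<dots> = (real n)^2 * W y + Re (cnj ?P * off)"
        by (simp add: W_def algebra_simps)
      finally have "W y - ?D y / (real n)^2 = - Re (cnj ?P * off) / (real n)^2"
        using n by (simp add: field_simps)
      also have "\<dots> \<le> (3 * K^2 * (real n * K^2)) / (real n)^2"
      proof (rule divide_right_mono)
        have "cmod off \<le> (\<Sum>i<n. \<Sum>j<n. cmod (if i = j then 0 else (?R $$ (i,j))^2))"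
          unfolding off_def by (intro order_trans[OF norm_sum] sum_mono norm_sum)
        also have "\<dots> \<le> (\<Sum>i<n. \<Sum>j<n. (cmod (?R $$ (i,j)))^2)"
          by (intro sum_mono) (auto simp: norm_power)
        also have "\<dots> = (\<Sum>j<n. \<Sum>i<n. (cmod (?R $$ (i,j)))^2)" by (rule sum.swap)
        also have "\<dots> \<le> (\<Sum>j<n. K^2)" by (intro sum_mono op_bound_column[OF op_bound_R]) auto
        finally have "cmod off \<le> real n * K^2" by simp
        then have "cmod (cnj ?P * off) \<le> 3 * K^2 * (real n * K^2)"
          unfolding norm_mult complex_mod_cnj using K0 by (intro mult_mono defect_bound stieltjes_bound) auto
        then show "- Re (cnj ?P * off) \<le> 3 * K^2 * (real n * K^2)"
          using abs_Re_le_cmod[of "cnj ?P * off"] by linarith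
      qed simp
      also have "\<dots> = 3 * K^4 / real n" using n by (simp add: eval_nat_numeral field_simps)
      also have "\<dots> \<le> C / real n" by (intro divide_right_mono C_ge) auto
      also have "\<dots> \<le> ?c"
        using n C_ge(2) real_sqrt_le_mono[of "real n" "(real n)^2"]
        by (intro divide_left_mono) (auto simp: power2_eq_square)
      finally show "W y - ?D y / (real n)^2 \<le> ?c" .
    qed
    then show "sign_avg ps (\<lambda>y. W y - ?D y / (real n)^2) x \<le> ?c"
      by (simp add: sign_avg_lin)
    have "real (card (tri n)) * (C / (real n * ?r)) \<le> (real n * real n) * (C / (real n * ?r))"
      using card_tri[of n] C_ge(2) by (intro mult_right_mono) (simp_all flip: of_nat_mult)
    also have "\<dots> = ?c" using n by simp
    finally show "real (card (tri n)) * (C / (real n * ?r)) \<le> ?c" .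
  qed
  finally show ?thesis by simp
qed

end

section \<open>Measurability in the matrix entries\<close>

lemma det_measurable:
  fixes A :: "'a \<Rightarrow> complex mat"
  assumes "\<And>\<omega>. A \<omega> \<in> carrier_mat n n"
    and "\<And>i j. i < n \<Longrightarrow> j < n \<Longrightarrow> (\<lambda>\<omega>. A \<omega> $$ (i,j)) \<in> borel_measurable N"
  shows "(\<lambda>\<omega>. det (A \<omega>)) \<in> borel_measurable N"
proof -
  have "(\<lambda>\<omega>. det (A \<omega>)) =
      (\<lambda>\<omega>. \<Sum>p\<in>{p. p permutes {0..<n}}. signof p * (\<Prod>i = 0..<n. A \<omega> $$ (i, p i)))"
    by (intro ext det_def'[OF assms(1)])
  also have "\<dots> \<in> borel_measurable N"
    by (intro borel_measurable_sum borel_measurable_times borel_measurable_prod borel_measurable_const assms(2))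
      (auto simp: permutes_in_image)
  finally show ?thesis .
qed

definition entries_measurable :: "'a measure \<Rightarrow> nat \<Rightarrow> ('a \<Rightarrow> complex mat) \<Rightarrow> bool" where
  "entries_measurable N n A \<longleftrightarrow> (\<forall>\<omega>. A \<omega> \<in> carrier_mat n n) \<and>
     (\<forall>i<n. \<forall>j<n. (\<lambda>\<omega>. A \<omega> $$ (i,j)) \<in> borel_measurable N)"

lemma entries_measurable_mult:
  assumes A: "entries_measurable N n A" and B: "entries_measurable N n B"
  shows "entries_measurable N n (\<lambda>\<omega>. A \<omega> * B \<omega>)"
proof -
  have c: "A \<omega> \<in> carrier_mat n n" "B \<omega> \<in> carrier_mat n n" for \<omega>
    using A B by (simp_all add: entries_measurable_def)
  have "(\<lambda>\<omega>. (A \<omega> * B \<omega>) $$ (i,j)) \<in> borel_measurable N" if ij: "i < n" "j < n" for i j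
  proof -
    have "(\<lambda>\<omega>. (A \<omega> * B \<omega>) $$ (i,j)) = (\<lambda>\<omega>. \<Sum>k<n. A \<omega> $$ (i,k) * B \<omega> $$ (k,j))"
      using c carrier_matD[OF c(1)] carrier_matD[OF c(2)] ij
      by (intro ext) (simp add: scalar_prod_def lessThan_atLeast0)
    also have "\<dots> \<in> borel_measurable N"
      using A B ij by (intro borel_measurable_sum borel_measurable_times) (simp_all add: entries_measurable_def)
    finally show ?thesis .
  qed
  then show ?thesis using c by (simp add: entries_measurable_def del: index_mult_mat(1))
qed

lemma entries_measurable_const: "A \<in> carrier_mat n n \<Longrightarrow> entries_measurable N n (\<lambda>_. A)"
  by (simp add: entries_measurable_def)

lemma etr_measurable:
  assumes "entries_measurable N n A" "p \<in> tri n"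
  shows "(\<lambda>\<omega>. etr p (A \<omega>)) \<in> borel_measurable N"
proof -
  obtain i j where p: "p = (i,j)" by force
  have "(\<lambda>\<omega>. A \<omega> $$ (i,j)) \<in> borel_measurable N" "(\<lambda>\<omega>. A \<omega> $$ (j,i)) \<in> borel_measurable N"
    using assms by (auto simp: p entries_measurable_def tri_def)
  then show ?thesis by (cases "i = j") (simp_all add: p etr_def)
qed

lemma mtr_measurable:
  assumes "entries_measurable N n A"
  shows "(\<lambda>\<omega>. mtr (A \<omega>)) \<in> borel_measurable N"
proof -
  have "(\<lambda>\<omega>. mtr (A \<omega>)) = (\<lambda>\<omega>. \<Sum>i<n. A \<omega> $$ (i,i))"
    using assms by (intro ext) (auto simp: mtr_def entries_measurable_def)
  also have "\<dots> \<in> borel_measurable N"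
    using assms by (intro borel_measurable_sum) (auto simp: entries_measurable_def)
  finally show ?thesis .
qed

lemma resolvent_measurable:
  assumes A: "entries_measurable N n A"
  shows "entries_measurable N n (\<lambda>\<omega>. resolvent z (A \<omega>))"
proof -
  define B where "B = (\<lambda>\<omega>. A \<omega> - z \<cdot>\<^sub>m 1\<^sub>m n)"
  have A': "A \<omega> \<in> carrier_mat n n" for \<omega> using A by (simp add: entries_measurable_def)
  have c: "B \<omega> \<in> carrier_mat n n" for \<omega> using A'[of \<omega>] by (auto simp: B_def)
  have B: "(\<lambda>\<omega>. B \<omega> $$ (i,j)) \<in> borel_measurable N" if "i < n" "j < n" for i j
  proof -
    have "(\<lambda>\<omega>. B \<omega> $$ (i,j)) = (\<lambda>\<omega>. A \<omega> $$ (i,j) - z * (if i = j then 1 else 0))"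
      using A' that by (intro ext) (simp add: B_def)
    moreover have "(\<lambda>\<omega>. A \<omega> $$ (i,j)) \<in> borel_measurable N"
      using A that by (simp add: entries_measurable_def)
    ultimately show ?thesis by (simp only:) (intro borel_measurable_diff borel_measurable_const)
  qed
  have minor: "(\<lambda>\<omega>. det (mat_delete (B \<omega>) i j)) \<in> borel_measurable N" if "i < n" "j < n" for i j
  proof (rule det_measurable)
    fix \<omega> show "mat_delete (B \<omega>) i j \<in> carrier_mat (n - 1) (n - 1)"
      using c[of \<omega>] by (rule mat_delete_carrier)
  next
    fix k l assume kl: "k < n - 1" "l < n - 1"
    have "(\<lambda>\<omega>. mat_delete (B \<omega>) i j $$ (k,l)) =
        (\<lambda>\<omega>. B \<omega> $$ (if k < i then k else Suc k, if l < j then l else Suc l))"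
      using kl by (intro ext) (simp add: mat_delete_def carrier_matD[OF c])
    then show "(\<lambda>\<omega>. mat_delete (B \<omega>) i j $$ (k,l)) \<in> borel_measurable N"
      using B kl by simp
  qed
  have "(\<lambda>\<omega>. resolvent z (A \<omega>) $$ (i,j)) \<in> borel_measurable N" if "i < n" "j < n" for i j
  proof -
    have "resolvent z (A \<omega>) $$ (i,j) = 1 / det (B \<omega>) * ((-1) ^ (j + i) * det (mat_delete (B \<omega>) j i))" for \<omega>
      using A'[of \<omega>] c[of \<omega>] that by (simp add: resolvent_def Let_def B_def adj_mat_def cofactor_def)
    then show ?thesis using det_measurable[OF c B] minor[OF that(2,1)] by simp
  qed
  moreover have "resolvent z (A \<omega>) \<in> carrier_mat n n" for \<omega>
    using A'[of \<omega>] c[of \<omega>] by (simp add: resolvent_def Let_def B_def[symmetric] adj_mat_def)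
  ultimately show ?thesis by (simp add: entries_measurable_def)
qed

text \<open>The value of \<open>g\<close> is measurable as soon as the coordinates outside \<open>D\<close> are. The set \<open>D\<close> grows by the
  positions that are averaged over or set to zero, and what remains has to be measurable with
  respect to the \<open>\<sigma>\<close>-algebra in the conditional expectation.\<close>

definition measurable_outside :: "'a measure \<Rightarrow> 'i set \<Rightarrow> (('i \<Rightarrow> real) \<Rightarrow> 'b::topological_space) \<Rightarrow> bool" where
  "measurable_outside N D g \<longleftrightarrow> (\<forall>x. (\<forall>q. q \<notin> D \<longrightarrow> (\<lambda>\<omega>. x \<omega> q) \<in> borel_measurable N) \<longrightarrow>
     (\<lambda>\<omega>. g (x \<omega>)) \<in> borel_measurable N)"

lemma measurable_outside_sign_avg:
  assumes "measurable_outside N D g"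
  shows "measurable_outside N (D \<union> set ps) (sign_avg ps g)"
proof (induction ps)
  case (Cons p ps)
  show ?case unfolding measurable_outside_def
  proof (intro allI impI)
    fix x :: "_ \<Rightarrow> _ \<Rightarrow> real" assume x: "\<forall>q. q \<notin> D \<union> set (p # ps) \<longrightarrow> (\<lambda>\<omega>. x \<omega> q) \<in> borel_measurable N"
    have "(\<lambda>\<omega>. sign_avg ps g ((x \<omega>)(p := c))) \<in> borel_measurable N" for c
    proof -
      have "(\<lambda>\<omega>. ((x \<omega>)(p := c)) q) \<in> borel_measurable N" if "q \<notin> D \<union> set ps" for q
        using x that by (cases "q = p") auto
      then show ?thesis using Cons.IH unfolding measurable_outside_def by (elim allE[of _ "\<lambda>\<omega>. (x \<omega>)(p := c)"]) auto
    qed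
    then show "(\<lambda>\<omega>. sign_avg (p # ps) g (x \<omega>)) \<in> borel_measurable N" by simp
  qed
qed (use assms in \<open>simp add: measurable_outside_def\<close>)

definition zero_on :: "'i set \<Rightarrow> ('i \<Rightarrow> real) \<Rightarrow> 'i \<Rightarrow> real" where
  "zero_on Q x = (\<lambda>q. if q \<in> Q then 0 else x q)"

lemma measurable_outside_zero_on:
  assumes "measurable_outside N D g"
  shows "measurable_outside N (D \<union> Q) (\<lambda>x. g (zero_on Q x))"
  unfolding measurable_outside_def
proof (intro allI impI)
  fix x :: "_ \<Rightarrow> _ \<Rightarrow> real" assume x: "\<forall>q. q \<notin> D \<union> Q \<longrightarrow> (\<lambda>\<omega>. x \<omega> q) \<in> borel_measurable N"
  have "(\<lambda>\<omega>. zero_on Q (x \<omega>) q) \<in> borel_measurable N" if "q \<notin> D" for q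
    using x that by (cases "q \<in> Q") (auto simp: zero_on_def)
  then show "(\<lambda>\<omega>. g (zero_on Q (x \<omega>))) \<in> borel_measurable N"
    using assms unfolding measurable_outside_def by (elim allE[of _ "\<lambda>\<omega>. zero_on Q (x \<omega>)"]) auto
qed

lemma measurable_outsideD:
  "measurable_outside N D g \<Longrightarrow> (\<And>q. q \<notin> D \<Longrightarrow> (\<lambda>\<omega>. x \<omega> q) \<in> borel_measurable N) \<Longrightarrow>
    (\<lambda>\<omega>. g (x \<omega>)) \<in> borel_measurable N"
  by (simp add: measurable_outside_def)

lemma resolvent_wigner_measurable:
  assumes "\<And>q. q \<in> tri n \<Longrightarrow> (\<lambda>\<omega>. x \<omega> q) \<in> borel_measurable N"
  shows "entries_measurable N n (\<lambda>\<omega>. resolvent z (wigner n (x \<omega>)))"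
proof (rule resolvent_measurable)
  have "(\<lambda>\<omega>. wigner n (x \<omega>) $$ (i,j)) \<in> borel_measurable N" if "i < n" "j < n" for i j
  proof -
    have "(max i j, min i j) \<in> tri n" using that by (auto simp: tri_def)
    from assms[OF this] show ?thesis using that by (simp add: wigner_def)
  qed
  then show "entries_measurable N n (\<lambda>\<omega>. wigner n (x \<omega>))" by (simp add: entries_measurable_def)
qed

lemma stieltjes_measurable: "measurable_outside N (- tri n) (stieltjes z n)"
  unfolding measurable_outside_def stieltjes_def
  by (auto intro!: borel_measurable_divide mtr_measurable resolvent_wigner_measurable)

lemma of_stieltjes_measurable:
  assumes "continuous_on UNIV h"
  shows "measurable_outside N (- tri n) (\<lambda>x. h (stieltjes z n x))"
  unfolding measurable_outside_def
  by (intro allI impI measurable_compose[OF measurable_outsideD[OF stieltjes_measurable]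
      borel_measurable_continuous_onI[OF assms]]) auto

lemma sq_defect_measurable: "measurable_outside N (- tri n) (sq_defect z n)"
  unfolding sq_defect_def defect_def by (rule of_stieltjes_measurable) (intro continuous_intros)

lemma coeff_measurable:
  assumes p: "p \<in> tri n"
  shows "measurable_outside N (- tri n) (coeff1 z n p)" "measurable_outside N (- tri n) (coeff2 z n p)"
proof -
  let ?R = "\<lambda>y. resolvent z (wigner n y)"
  have "continuous_on UNIV (sq_defect_grad z)"
    unfolding sq_defect_grad_def defect_def by (intro continuous_intros)
  note S = of_stieltjes_measurable[OF this, of N n z]
  have "(\<lambda>\<omega>. coeff1 z n p (x \<omega>)) \<in> borel_measurable N" "(\<lambda>\<omega>. coeff2 z n p (x \<omega>)) \<in> borel_measurable N"
    if x: "\<And>q. q \<notin> - tri n \<Longrightarrow> (\<lambda>\<omega>. x \<omega> q) \<in> borel_measurable N" for x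
  proof -
    have R: "entries_measurable N n (\<lambda>\<omega>. ?R (x \<omega>))"
      by (rule resolvent_wigner_measurable) (use x in auto)
    have g: "(\<lambda>\<omega>. sq_defect_grad z (stieltjes z n (x \<omega>))) \<in> borel_measurable N"
      by (rule measurable_outsideD[OF S]) (use x in auto)
    have a: "(\<lambda>\<omega>. etr p (?R (x \<omega>) * ?R (x \<omega>))) \<in> borel_measurable N"
      by (intro etr_measurable[OF _ p] entries_measurable_mult R)
    have b: "(\<lambda>\<omega>. etr p (?R (x \<omega>) * (sym_unit n p *
        (?R (x \<omega>) * ?R (x \<omega>))))) \<in> borel_measurable N"
      by (intro etr_measurable[OF _ p] entries_measurable_mult R entries_measurable_const) simp
    show "(\<lambda>\<omega>. coeff1 z n p (x \<omega>)) \<in> borel_measurable N"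
      unfolding coeff1_def
      by (intro borel_measurable_divide borel_measurable_uminus borel_measurable_const
          measurable_compose[OF borel_measurable_times[OF g a] borel_measurable_Re])
    show "(\<lambda>\<omega>. coeff2 z n p (x \<omega>)) \<in> borel_measurable N"
      unfolding coeff2_def Let_def
      by (intro borel_measurable_divide borel_measurable_const
          measurable_compose[OF borel_measurable_times[OF g b] borel_measurable_Re])
  qed
  then show "measurable_outside N (- tri n) (coeff1 z n p)" "measurable_outside N (- tri n) (coeff2 z n p)"
    unfolding measurable_outside_def by blast+
qed

section \<open>Lexicographic order and neighbourhoods in the lower triangle\<close>

definition lex_less :: "nat \<times> nat \<Rightarrow> nat \<times> nat \<Rightarrow> bool" where
  "lex_less q p \<longleftrightarrow> fst q < fst p \<or> fst q = fst p \<and> snd q < snd p"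

definition sup_dist :: "nat \<times> nat \<Rightarrow> nat \<times> nat \<Rightarrow> int" where
  "sup_dist p q = max \<bar>int (fst p) - int (fst q)\<bar> \<bar>int (snd p) - int (snd q)\<bar>"

definition ball_tri :: "nat \<Rightarrow> nat \<Rightarrow> nat \<times> nat \<Rightarrow> (nat \<times> nat) set" where
  "ball_tri n a p = {q \<in> tri n. sup_dist p q < int a}"

text \<open>Only earlier positions: at the later ones there are random signs already when \<open>p\<close> is treated.\<close>

definition near :: "nat \<Rightarrow> nat \<Rightarrow> nat \<times> nat \<Rightarrow> (nat \<times> nat) set" where
  "near n a p = {q \<in> ball_tri n a p. lex_less q p}"

lemma sup_dist_commute: "sup_dist p q = sup_dist q p"
  by (simp add: sup_dist_def abs_minus_commute)

lemma finite_ball_tri [simp]: "finite (ball_tri n a p)" "finite (near n a p)"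
  by (rule finite_subset[OF _ finite_tri[of n]]; force simp: ball_tri_def near_def)+

lemma card_ball_tri: "card (ball_tri n a p) \<le> (2 * a + 1)^2"
proof -
  let ?I = "\<lambda>k. {k - a..k + a}"
  have "ball_tri n a p \<subseteq> ?I (fst p) \<times> ?I (snd p)"
    by (auto simp: ball_tri_def sup_dist_def)
  then have "card (ball_tri n a p) \<le> card (?I (fst p) \<times> ?I (snd p))" by (intro card_mono) auto
  also have "\<dots> \<le> (2 * a + 1) * (2 * a + 1)"
    unfolding card_cartesian_product by (intro mult_mono) auto
  finally show ?thesis by (simp add: power2_eq_square)
qed

text \<open>Every position lies in the neighbourhood of at most \<open>(2 a + 1)\<^sup>2\<close> others.\<close>

lemma sum_near_le:
  assumes "\<And>p q. 0 \<le> h p" "\<And>p. 0 \<le> k p"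
  shows "(\<Sum>p\<in>tri n. \<Sum>q\<in>near n a p. h p + k q) \<le>
    real ((2 * a + 1)^2) * ((\<Sum>p\<in>tri n. h p) + (\<Sum>p\<in>tri n. k p :: real))"
proof -
  have "(\<Sum>p\<in>tri n. \<Sum>q\<in>near n a p. h p + k q) \<le> (\<Sum>p\<in>tri n. \<Sum>q\<in>ball_tri n a p. h p + k q)"
    using assms by (intro sum_mono sum_mono2) (auto simp: near_def add_nonneg_nonneg)
  also have "\<dots> = (\<Sum>p\<in>tri n. real (card (ball_tri n a p)) * h p) + (\<Sum>p\<in>tri n. \<Sum>q\<in>ball_tri n a p. k q)"
    by (simp add: sum.distrib)
  also have "(\<Sum>p\<in>tri n. \<Sum>q\<in>ball_tri n a p. k q) = (\<Sum>q\<in>tri n. \<Sum>p | p \<in> tri n \<and> q \<in> ball_tri n a p. k q)"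
    by (subst sum.swap_restrict[symmetric]) (auto intro!: sum.cong simp: ball_tri_def)
  also have "\<dots> = (\<Sum>q\<in>tri n. \<Sum>p\<in>ball_tri n a q. k q)"
    by (intro sum.cong) (auto simp: ball_tri_def sup_dist_commute)
  also have "\<dots> = (\<Sum>q\<in>tri n. real (card (ball_tri n a q)) * k q)" by simp
  also have "(\<Sum>p\<in>tri n. real (card (ball_tri n a p)) * h p) + (\<Sum>q\<in>tri n. real (card (ball_tri n a q)) * k q) \<le>
      (\<Sum>p\<in>tri n. real ((2 * a + 1)^2) * h p) + (\<Sum>q\<in>tri n. real ((2 * a + 1)^2) * k q)"
    using assms by (intro add_mono sum_mono mult_right_mono of_nat_mono card_ball_tri) auto
  finally show ?thesis by (simp add: sum_distrib_left distrib_left)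
qed

definition tri_list :: "nat \<Rightarrow> (nat \<times> nat) list" where
  "tri_list n = concat (map (\<lambda>k. map (Pair k) [0..<Suc k]) [0..<n])"

lemma set_tri_list: "set (tri_list n) = tri n"
  by (auto simp: tri_list_def tri_def image_iff)

lemma sorted_tri_list: "sorted_wrt lex_less (tri_list n)"
proof (induction n)
  case (Suc n)
  have "tri_list (Suc n) = tri_list n @ map (Pair n) [0..<Suc n]" by (simp add: tri_list_def)
  moreover have "sorted_wrt lex_less (map (Pair n) [0..<Suc n])"
    unfolding sorted_wrt_map
    by (rule sorted_wrt_mono_rel[OF _ sorted_wrt_upt]) (auto simp: lex_less_def)
  moreover have "lex_less q p" if "q \<in> set (tri_list n)" "p \<in> set (map (Pair n) [0..<Suc n])" for p q
    using that(1)[unfolded set_tri_list] that(2) by (auto simp: lex_less_def tri_def)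
  ultimately show ?case using Suc by (simp only: sorted_wrt_append) blast
qed (simp add: tri_list_def)

lemma distinct_tri_list: "distinct (tri_list n)"
proof -
  have "distinct xs" if "sorted_wrt lex_less xs" for xs
    using that by (induction xs) (auto simp: lex_less_def)
  then show ?thesis using sorted_tri_list by blast
qed

context spectral_parameter
begin

lemma coeff2_zero_on:
  assumes p: "p \<in> tri n" and Q: "finite Q" "Q \<subseteq> tri n"
  shows "\<bar>coeff2 z n p y - coeff2 z n p (zero_on Q y)\<bar> \<le> (\<Sum>q\<in>Q. C / real n * min 1 (\<bar>y q\<bar> / sqrt (real n)))"
  using Q
proof (induction Q rule: finite_induct)
  case empty
  then show ?case by (simp add: zero_on_def)
next
  case (insert q Q)
  have "zero_on (insert q Q) y = (zero_on Q y)(q := 0)" by (auto simp: zero_on_def)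
  then have "\<bar>coeff2 z n p (zero_on (insert q Q) y) - coeff2 z n p (zero_on Q y)\<bar> \<le>
      C / real n * min 1 (\<bar>y q\<bar> / sqrt (real n))"
    using coeff2_update[OF p, of q "zero_on Q y" 0] insert by (simp add: zero_on_def)
  then show ?case using insert by simp
qed

text \<open>The original entry and both signs are expanded around the same matrix, with entry 0 at \<open>p\<close>. The
  linear terms of the two signs cancel and their quadratic terms are equal, which leaves
  \<open>x\<^sup>2 - 1\<close> in front of the second coefficient. In the remainder, the cube is used for
  \<open>|x| \<le> \<epsilon> \<surd>n\<close> and the square otherwise.\<close>

lemma lindeberg_pointwise:
  fixes y :: "nat \<times> nat \<Rightarrow> real"
  assumes p: "p \<in> tri n" and e: "0 < \<epsilon>"
  defines "y0 \<equiv> y(p := 0)"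
  shows "sq_defect z n y - sign_avg [p] (sq_defect z n) y \<le>
    y p * (coeff1 z n p y0 / sqrt (real n)) + ((y p)^2 - 1) * (coeff2 z n p y0 / real n) +
    C / (real n)^2 * (\<epsilon> * (y p)^2 + (y p)^2 * of_bool (\<bar>y p\<bar> > \<epsilon> * sqrt (real n)) + (y p)^2 / real n + 2 / sqrt (real n))"
proof -
  let ?i = "of_bool (\<bar>y p\<bar> > \<epsilon> * sqrt (real n))" and ?t = "y p / sqrt (real n)" and ?u = "1 / sqrt (real n)"
  have n: "1 \<le> real n" using p by (auto simp: tri_def)
  have sn: "1 \<le> sqrt (real n)" "sqrt (real n) * sqrt (real n) = real n" using n by auto
  define r where "r = (\<lambda>t. C / real n * min (t^2) (\<bar>t\<bar>^3) + C * t^2 / (real n)^2)"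
  define f0 A B where "f0 = sq_defect z n y0" "A = coeff1 z n p y0" "B = coeff2 z n p y0"
  have tay: "\<bar>sq_defect z n (y(p := c)) - f0 - c / sqrt (real n) * A - (c / sqrt (real n))^2 * B\<bar> \<le> r (c / sqrt (real n))" for c
    using sq_defect_taylor[OF p, of "y(p := c)"] by (simp add: y0_def f0_A_B_def r_def)
  have t1: "sq_defect z n y \<le> f0 + y p / sqrt (real n) * A + ?t^2 * B + r ?t"
    using tay[of "y p"] by simp
  have t2: "f0 + 1 / sqrt (real n) * A + ?u^2 * B - r ?u \<le> sq_defect z n (y(p := 1))"
    using tay[of 1] by simp
  have t3: "f0 - 1 / sqrt (real n) * A + ?u^2 * B - r ?u \<le> sq_defect z n (y(p := -1))"
    using tay[of "-1"] by (simp add: r_def)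
  have r1: "r ?u \<le> C / (real n)^2 * (2 / sqrt (real n))"
  proof -
    have "min (?u^2) (\<bar>?u\<bar>^3) \<le> (1 / real n) * ?u"
      using n by (intro min.coboundedI2) (simp add: power3_eq_cube)
    then have "C / real n * min (?u^2) (\<bar>?u\<bar>^3) \<le> C / real n * ((1 / real n) * ?u)"
      using C_ge(2) n by (intro mult_left_mono) auto
    moreover have "C * ?u^2 / (real n)^2 \<le> C / (real n)^2 * ?u"
    proof -
      have "1 / real n \<le> 1 / sqrt (real n)"
        using n real_sqrt_le_mono[of "real n" "(real n)^2"] by (intro divide_left_mono) (auto simp: power2_eq_square)
      then have "C / (real n)^2 * (1 / real n) \<le> C / (real n)^2 * ?u"
        using C_ge(2) by (intro mult_left_mono) auto
      then show ?thesis using n by (simp add: power_divide mult.commute)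
    qed
    ultimately have "r ?u \<le>
        C / real n * ((1 / real n) * ?u) + C / (real n)^2 * ?u"
      unfolding r_def by (rule add_mono)
    also have "\<dots> = C / (real n)^2 * (2 / sqrt (real n))" by (simp add: power2_eq_square mult_ac)
    finally show ?thesis .
  qed
  have ry: "r ?t \<le>
      C / (real n)^2 * (\<epsilon> * (y p)^2 + (y p)^2 * ?i + (y p)^2 / real n)"
  proof -
    have "min (?t^2) (\<bar>?t\<bar>^3) \<le>
        (\<epsilon> + ?i) * ((y p)^2 / real n)"
    proof (cases "\<bar>y p\<bar> > \<epsilon> * sqrt (real n)")
      case True
      have "1 * ((y p)^2 / real n) \<le> (\<epsilon> + 1) * ((y p)^2 / real n)"
        using e by (intro mult_right_mono) auto
      then show ?thesis using True n by (intro min.coboundedI1) (simp add: power_divide)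
    next
      case False
      then have "\<bar>?t\<bar> \<le> \<epsilon>" using sn by (simp add: divide_le_eq)
      then have "\<bar>?t\<bar> * \<bar>?t\<bar>^2 \<le> \<epsilon> * \<bar>?t\<bar>^2"
        by (intro mult_right_mono) auto
      then show ?thesis using False n
        by (intro min.coboundedI2) (simp add: power_divide power3_eq_cube power2_eq_square mult_ac)
    qed
    then have "C / real n * min (?t^2) (\<bar>?t\<bar>^3) \<le>
        C / real n * ((\<epsilon> + ?i) * ((y p)^2 / real n))"
      using C_ge(2) by (intro mult_left_mono) auto
    also have "\<dots> = C / (real n)^2 * (\<epsilon> * (y p)^2 + (y p)^2 * ?i)"
      by (simp add: power2_eq_square algebra_simps add_divide_distrib)
    finally have 1: "C / real n * min (?t^2) (\<bar>?t\<bar>^3) \<le>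
        C / (real n)^2 * (\<epsilon> * (y p)^2 + (y p)^2 * ?i)" .
    have 2: "C * ?t^2 / (real n)^2 = C / (real n)^2 * ((y p)^2 / real n)"
      by (simp add: power_divide mult_ac)
    show ?thesis unfolding r_def 2 using 1 by (simp only: distrib_left)
  qed
  have lin: "a - (b + c) / 2 \<le> u + (v - x) + q + q'"
    if "a \<le> f + u + v + q" "f + w + x - q' \<le> b" "f - w + x - q' \<le> c" for a b c f u v w x q q' :: real
    using that by (simp add: field_simps)
  have "sq_defect z n y - sign_avg [p] (sq_defect z n) y \<le>
      y p / sqrt (real n) * A + (?t^2 - ?u^2) * B + r ?t + r ?u"
    unfolding left_diff_distrib sign_avg.simps by (rule lin[OF t1 t2 t3])
  also have "\<dots> = y p * (A / sqrt (real n)) + ((y p)^2 - 1) * (B / real n) + (r ?t + r ?u)"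
    using n by (simp add: power_divide field_simps)
  also have "\<dots> \<le> y p * (A / sqrt (real n)) + ((y p)^2 - 1) * (B / real n) +
     C / (real n)^2 * (\<epsilon> * (y p)^2 + (y p)^2 * ?i + (y p)^2 / real n + 2 / sqrt (real n))"
    using r1 ry by (simp add: distrib_left)
  finally show ?thesis by (simp add: f0_A_B_def)
qed

end

section \<open>Martingale difference fields on the lower triangle\<close>

text \<open>\<open>G a p\<close> plays the role of the past of \<open>p\<close> at distance at least \<open>a\<close>. It contains the entries of the
  lower triangle in that past, and possibly more, such as entries with indices below the range.\<close>

locale martingale_difference_field = prob_space M for M :: "'a measure" +
  fixes Y :: "'a \<Rightarrow> nat \<times> nat \<Rightarrow> real" and G :: "nat \<Rightarrow> nat \<times> nat \<Rightarrow> 'a measure" and s :: "nat \<times> nat \<Rightarrow> real"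
  assumes Y_measurable [measurable]: "\<And>p. (\<lambda>\<omega>. Y \<omega> p) \<in> borel_measurable M"
    and sub: "\<And>a p. subalgebra M (G a p)"
    and adapted: "\<And>a p q. snd q \<le> fst q \<Longrightarrow> snd p \<le> fst p \<Longrightarrow> lex_less q p \<Longrightarrow> int a \<le> sup_dist p q \<Longrightarrow>
      (\<lambda>\<omega>. Y \<omega> q) \<in> borel_measurable (G a p)"
    and Y_square_integrable: "\<And>p. integrable M (\<lambda>\<omega>. (Y \<omega> p)^2)"
    and Y_variance: "\<And>p. (\<integral>\<omega>. (Y \<omega> p)^2 \<partial>M) = s p"
    and Y_martingale: "\<And>p. snd p \<le> fst p \<Longrightarrow> AE \<omega> in M. real_cond_exp M (G 1 p) (\<lambda>\<omega>. Y \<omega> p) \<omega> = 0"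
begin

definition tail :: "real \<Rightarrow> nat \<Rightarrow> nat \<times> nat \<Rightarrow> real" where
  "tail \<epsilon> n p = (\<integral>\<omega>. (Y \<omega> p)^2 * of_bool (\<bar>Y \<omega> p\<bar> > \<epsilon> * sqrt (real n)) \<partial>M)"

definition memory :: "nat \<Rightarrow> nat \<times> nat \<Rightarrow> real" where
  "memory a p = (\<integral>\<omega>. \<bar>real_cond_exp M (G a p) (\<lambda>\<omega>. (Y \<omega> p)^2 - s p) \<omega>\<bar> \<partial>M)"

lemma s_nonneg: "0 \<le> s p"
  using Y_variance[of p] by (metis Bochner_Integration.integral_nonneg zero_le_power2)

lemma tail_nonneg: "0 \<le> tail \<epsilon> n p"
  unfolding tail_def by (intro Bochner_Integration.integral_nonneg) auto

lemma tail_integrable: "integrable M (\<lambda>\<omega>. (Y \<omega> p)^2 * of_bool (\<bar>Y \<omega> p\<bar> > c))"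
  by (rule Bochner_Integration.integrable_bound[OF Y_square_integrable[of p]]) auto

lemma Y_integrable: "integrable M (\<lambda>\<omega>. Y \<omega> p)"
  by (rule square_integrable_imp_integrable) (auto intro: Y_square_integrable)

lemma sigma_finite_G: "sigma_finite_subalgebra M (G a p)"
  by (intro finite_measure_subalgebra_is_sigma_finite finite_measure_subalgebra.intro
      finite_measure_subalgebra_axioms.intro sub finite_measure_axioms)

lemma integrable_mult_bounded:
  assumes "integrable M h" "b \<in> borel_measurable M" "\<And>\<omega>. \<bar>b \<omega>\<bar> \<le> (c::real)"
  shows "integrable M (\<lambda>\<omega>. h \<omega> * b \<omega> :: real)"
proof (rule Bochner_Integration.integrable_bound)
  show "integrable M (\<lambda>\<omega>. c * h \<omega>)" using assms(1) by simp
  show "AE \<omega> in M. norm (h \<omega> * b \<omega>) \<le> norm (c * h \<omega>)"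
    using assms(3) order_trans[OF abs_ge_zero assms(3)]
    by (auto simp: abs_mult intro!: AE_I2) (metis abs_ge_self abs_ge_zero mult.commute mult_left_mono order_trans)
qed (use assms in auto)

lemma martingale_orthogonal:
  assumes "snd p \<le> fst p" "b \<in> borel_measurable (G 1 p)" "\<And>\<omega>. \<bar>b \<omega>\<bar> \<le> (c::real)"
  shows "(\<integral>\<omega>. Y \<omega> p * b \<omega> \<partial>M) = 0"
proof -
  interpret sigma_finite_subalgebra M "G 1 p" by (rule sigma_finite_G)
  have b: "b \<in> borel_measurable M" by (rule measurable_from_subalg[OF sub assms(2)])
  have int: "integrable M (\<lambda>\<omega>. b \<omega> * Y \<omega> p)"
    using integrable_mult_bounded[OF Y_integrable b assms(3)] by (simp add: mult.commute)
  have "(\<integral>\<omega>. b \<omega> * Y \<omega> p \<partial>M) = (\<integral>\<omega>. b \<omega> * real_cond_exp M (G 1 p) (\<lambda>\<omega>. Y \<omega> p) \<omega> \<partial>M)"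
    by (rule real_cond_exp_intg(2)[OF int assms(2), symmetric]) simp
  also have "\<dots> = (\<integral>\<omega>. 0 \<partial>M)"
    using Y_martingale[OF assms(1)] b by (intro integral_cong_AE) auto
  finally show ?thesis by (simp add: mult.commute)
qed

lemma memory_bound:
  assumes "b \<in> borel_measurable (G a p)" "\<And>\<omega>. \<bar>b \<omega>\<bar> \<le> (c::real)"
  shows "(\<integral>\<omega>. ((Y \<omega> p)^2 - s p) * b \<omega> \<partial>M) \<le> c * memory a p"
proof -
  interpret sigma_finite_subalgebra M "G a p" by (rule sigma_finite_G)
  let ?E = "real_cond_exp M (G a p) (\<lambda>\<omega>. (Y \<omega> p)^2 - s p)"
  have b: "b \<in> borel_measurable M" by (rule measurable_from_subalg[OF sub assms(1)])
  have i: "integrable M (\<lambda>\<omega>. (Y \<omega> p)^2 - s p)" using Y_square_integrable by simp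
  have int: "integrable M (\<lambda>\<omega>. b \<omega> * ((Y \<omega> p)^2 - s p))"
    using integrable_mult_bounded[OF i b assms(2)] by (simp add: mult.commute)
  have iE: "integrable M ?E" by (rule real_cond_exp_int(1)[OF i])
  have c: "0 \<le> c" using order_trans[OF abs_ge_zero assms(2)] .
  have "(\<integral>\<omega>. b \<omega> * ((Y \<omega> p)^2 - s p) \<partial>M) = (\<integral>\<omega>. b \<omega> * ?E \<omega> \<partial>M)"
    by (rule real_cond_exp_intg(2)[OF int assms(1), symmetric]) simp
  also have "\<dots> \<le> (\<integral>\<omega>. c * \<bar>?E \<omega>\<bar> \<partial>M)"
  proof (rule integral_mono)
    show "integrable M (\<lambda>\<omega>. b \<omega> * ?E \<omega>)" by (rule real_cond_exp_intg(1)[OF int assms(1)]) simp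
    show "integrable M (\<lambda>\<omega>. c * \<bar>?E \<omega>\<bar>)" using iE by simp
    fix \<omega>
    have "b \<omega> * ?E \<omega> \<le> \<bar>b \<omega>\<bar> * \<bar>?E \<omega>\<bar>" by (metis abs_ge_self abs_mult)
    also have "\<dots> \<le> c * \<bar>?E \<omega>\<bar>" using assms(2) by (intro mult_right_mono) auto
    finally show "b \<omega> * ?E \<omega> \<le> c * \<bar>?E \<omega>\<bar>" .
  qed
  finally show ?thesis by (simp add: memory_def mult.commute)
qed

text \<open>An entry \<open>q\<close> that exceeds \<open>\<epsilon> \<surd>n\<close> either exceeds the entry \<open>p\<close> as well, whose square is then
  replaced by that of \<open>q\<close>, or is exceeded by it, and then \<open>p\<close> is large itself. In both cases the
  Lindeberg condition applies. The constant \<open>s p\<close> is treated in the same way, after splitting it at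
  the level \<open>\<epsilon>\<^sup>2 n\<close>.\<close>

lemma neighbour_bound:
  assumes e: "0 < \<epsilon>" and n: "0 < n"
  shows "(\<integral>\<omega>. ((Y \<omega> p)^2 + s p) * min 1 (\<bar>Y \<omega> q\<bar> / sqrt (real n)) \<partial>M) \<le>
    2 * \<epsilon> * s p + 2 * (tail \<epsilon> n p + tail \<epsilon> n q)"
proof -
  let ?L = "\<epsilon> * sqrt (real n)"
  let ?u = "\<lambda>p \<omega>. (Y \<omega> p)^2 * of_bool (\<bar>Y \<omega> p\<bar> > ?L)"
  let ?m = "\<lambda>\<omega>. min 1 (\<bar>Y \<omega> q\<bar> / sqrt (real n))"
  have L: "0 < ?L" using e n by simp
  have m: "?m \<omega> \<le> \<epsilon> + of_bool (\<bar>Y \<omega> q\<bar> > ?L)" "0 \<le> ?m \<omega>" for \<omega>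
  proof -
    show "?m \<omega> \<le> \<epsilon> + of_bool (\<bar>Y \<omega> q\<bar> > ?L)"
    proof (cases "\<bar>Y \<omega> q\<bar> > ?L")
      case True
      then show ?thesis using e by (intro min.coboundedI1) simp
    next
      case False
      then show ?thesis using n by (intro min.coboundedI2) (simp add: divide_le_eq)
    qed
  qed simp
  have "s p = (\<integral>\<omega>. (Y \<omega> p)^2 \<partial>M)" by (simp add: Y_variance)
  also have "\<dots> \<le> (\<integral>\<omega>. ?L^2 + ?u p \<omega> \<partial>M)"
  proof (rule integral_mono)
    fix \<omega> show "(Y \<omega> p)^2 \<le> ?L^2 + ?u p \<omega>"
      using L abs_le_square_iff[of "Y \<omega> p" ?L] by (auto simp: not_less)
  qed (use Y_square_integrable tail_integrable in auto)
  also have "\<dots> = ?L^2 + tail \<epsilon> n p"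
    using tail_integrable by (simp add: tail_def prob_space)
  finally have sp: "s p \<le> ?L^2 + tail \<epsilon> n p" .
  have pt: "((Y \<omega> p)^2 + s p) * ?m \<omega> \<le> \<epsilon> * (Y \<omega> p)^2 + \<epsilon> * s p + 2 * ?u q \<omega> + ?u p \<omega> + tail \<epsilon> n p" for \<omega>
  proof -
    have "((Y \<omega> p)^2 + s p) * ?m \<omega> \<le> ((Y \<omega> p)^2 + s p) * (\<epsilon> + of_bool (\<bar>Y \<omega> q\<bar> > ?L))"
      using m s_nonneg[of p] by (intro mult_left_mono) auto
    moreover have "(Y \<omega> p)^2 * of_bool (\<bar>Y \<omega> q\<bar> > ?L) \<le> ?u p \<omega> + ?u q \<omega>"
      using abs_le_square_iff[of "Y \<omega> p" "Y \<omega> q"] by (auto simp: not_less)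
    moreover have "s p * of_bool (\<bar>Y \<omega> q\<bar> > ?L) \<le> ?u q \<omega> + tail \<epsilon> n p"
    proof (cases "\<bar>Y \<omega> q\<bar> > ?L")
      case True
      then have "?L^2 \<le> (Y \<omega> q)^2" using L abs_le_square_iff[of ?L "Y \<omega> q"] by auto
      then show ?thesis using True sp by simp
    qed (use tail_nonneg in auto)
    ultimately show ?thesis by (simp add: algebra_simps)
  qed
  have "(\<integral>\<omega>. ((Y \<omega> p)^2 + s p) * ?m \<omega> \<partial>M) \<le>
      (\<integral>\<omega>. \<epsilon> * (Y \<omega> p)^2 + \<epsilon> * s p + 2 * ?u q \<omega> + ?u p \<omega> + tail \<epsilon> n p \<partial>M)"
  proof (rule integral_mono[OF _ _ pt])
    show "integrable M (\<lambda>\<omega>. ((Y \<omega> p)^2 + s p) * ?m \<omega>)"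
      by (rule integrable_mult_bounded[where c = 1]) (use m(2) Y_square_integrable in auto)
  qed (use Y_square_integrable tail_integrable in auto)
  also have "\<dots> = \<epsilon> * s p + \<epsilon> * s p + 2 * tail \<epsilon> n q + tail \<epsilon> n p + tail \<epsilon> n p"
    using Y_square_integrable tail_integrable by (simp add: tail_def prob_space Y_variance)
  finally show ?thesis by simp
qed

end

section \<open>Replacement of the entries by random signs\<close>

lemma zero_on_singleton: "zero_on {p} y = y(p := 0)"
  by (auto simp: zero_on_def)

locale lindeberg_replacement = martingale_difference_field M Y G s + spectral_parameter z K
  for M :: "'a measure" and Y G s z K
begin

text \<open>In this order: the memory at lag \<open>a\<close>, the cost of setting the near entries to zero, the deviation of
  the variance from that of a sign, and the remainders of the expansion.\<close>

definition step_error :: "real \<Rightarrow> nat \<Rightarrow> nat \<Rightarrow> nat \<times> nat \<Rightarrow> real" where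
  "step_error \<epsilon> n a p = C / (real n)^2 *
     (memory a p + (\<Sum>q\<in>near n a p. 2 * \<epsilon> * s p + 2 * (tail \<epsilon> n p + tail \<epsilon> n q)) +
      \<bar>s p - 1\<bar> + \<epsilon> * s p + tail \<epsilon> n p + s p / real n + 2 / sqrt (real n))"

lemma sign_avg_sq_defect_integrable: "integrable M (\<lambda>\<omega>. sign_avg ps (sq_defect z n) (Y \<omega>))"
proof (rule integrable_const_bound[where B = "(3 * K^2)^2"])
  have "\<bar>sq_defect z n y\<bar> \<le> (3 * K^2)^2" for y
    unfolding sq_defect_def abs_of_nonneg[OF zero_le_power2]
    by (intro power_mono defect_bound stieltjes_bound) auto
  then show "AE \<omega> in M. norm (sign_avg ps (sq_defect z n) (Y \<omega>)) \<le> (3 * K^2)^2"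
    by (auto intro!: sign_avg_abs_le)
  show "(\<lambda>\<omega>. sign_avg ps (sq_defect z n) (Y \<omega>)) \<in> borel_measurable M"
    by (rule measurable_outsideD[OF measurable_outside_sign_avg[OF sq_defect_measurable]]) simp
qed

text \<open>\<open>A\<close> and \<open>B\<close> are the coefficients averaged over the later signs, so they are functions of the earlier
  entries. This makes \<open>A\<close> measurable with respect to the past of \<open>p\<close>, and the linear term vanishes.
  The same holds for \<open>B'\<close>, in which the near entries are set to zero as well, and the past at
  distance \<open>a\<close>.\<close>

lemma lindeberg_step:
  assumes p: "p \<in> tri n" "p \<notin> set ps" and e: "0 < \<epsilon>"
    and past: "\<And>q. q \<in> tri n \<Longrightarrow> q \<notin> set ps \<Longrightarrow> q \<noteq> p \<Longrightarrow> lex_less q p"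
    and future: "\<And>q. q \<in> set ps \<Longrightarrow> \<not> lex_less q p"
  shows "(\<integral>\<omega>. sign_avg ps (sq_defect z n) (Y \<omega>) \<partial>M) \<le>
    (\<integral>\<omega>. sign_avg (p # ps) (sq_defect z n) (Y \<omega>) \<partial>M) + step_error \<epsilon> n a p"
proof -
  have n: "0 < n" "0 < real n" using p by (auto simp: tri_def)
  let ?f = "sq_defect z n" and ?L = "\<epsilon> * sqrt (real n)" and ?Q = "insert p (near n a p)"
  let ?d = "\<lambda>\<omega>. (Y \<omega> p)^2 - s p"
  let ?m = "\<lambda>q \<omega>. min 1 (\<bar>Y \<omega> q\<bar> / sqrt (real n))"
  let ?b = "\<lambda>q. 2 * \<epsilon> * s p + 2 * (tail \<epsilon> n p + tail \<epsilon> n q)"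
  define rest where "rest = (\<lambda>u. C / (real n)^2 * (\<epsilon> * u^2 + u^2 * of_bool (\<bar>u\<bar> > ?L) + u^2 / real n + 2 / sqrt (real n)))"
  define A where "A = (\<lambda>\<omega>. sign_avg ps (\<lambda>y. coeff1 z n p (zero_on {p} y)) (Y \<omega>))"
  define B where "B = (\<lambda>\<omega>. sign_avg ps (\<lambda>y. coeff2 z n p (zero_on {p} y)) (Y \<omega>))"
  define B' where "B' = (\<lambda>\<omega>. sign_avg ps (\<lambda>y. coeff2 z n p (zero_on ?Q y)) (Y \<omega>))"
  have bounds: "\<bar>A \<omega>\<bar> \<le> C / real n" "\<bar>B \<omega>\<bar> \<le> C / real n" "\<bar>B' \<omega>\<bar> \<le> C / real n" for \<omega>
    unfolding A_def B_def B'_def by (intro sign_avg_abs_le coeff1_bound coeff2_bound p)+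
  have Q: "p \<notin> near n a p" "near n a p \<subseteq> tri n" by (auto simp: near_def ball_tri_def lex_less_def)
  have pp: "snd p \<le> fst p" using p by (auto simp: tri_def)
  have A_meas: "A \<in> borel_measurable (G 1 p)"
    unfolding A_def
  proof (rule measurable_outsideD[OF measurable_outside_sign_avg[OF measurable_outside_zero_on[OF coeff_measurable(1)[OF p(1)]]]])
    fix q assume "q \<notin> - tri n \<union> {p} \<union> set ps"
    then have q: "q \<in> tri n" "q \<noteq> p" "q \<notin> set ps" by auto
    then show "(\<lambda>\<omega>. Y \<omega> q) \<in> borel_measurable (G 1 p)"
      by (intro adapted pp past) (auto simp: tri_def sup_dist_def prod_eq_iff)
  qed
  have B'_meas: "B' \<in> borel_measurable (G a p)"
    unfolding B'_def
  proof (rule measurable_outsideD[OF measurable_outside_sign_avg[OF measurable_outside_zero_on[OF coeff_measurable(2)[OF p(1)]]]])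
    fix q assume "q \<notin> - tri n \<union> ?Q \<union> set ps"
    then have q: "q \<in> tri n" "q \<noteq> p" "q \<notin> set ps" "q \<notin> near n a p" by auto
    then show "(\<lambda>\<omega>. Y \<omega> q) \<in> borel_measurable (G a p)"
      by (intro adapted pp past) (use q past in \<open>auto simp: tri_def near_def ball_tri_def\<close>)
  qed
  have B_meas: "B \<in> borel_measurable M"
    unfolding B_def
    by (rule measurable_outsideD[OF measurable_outside_sign_avg[OF measurable_outside_zero_on[OF coeff_measurable(2)[OF p(1)]]]]) simp
  note A_meas' = measurable_from_subalg[OF sub A_meas]
  note B'_meas' = measurable_from_subalg[OF sub B'_meas]
  have BB': "\<bar>B \<omega> - B' \<omega>\<bar> \<le> (\<Sum>q\<in>near n a p. C / real n * ?m q \<omega>)" for \<omega>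
  proof -
    have "B \<omega> - B' \<omega> = sign_avg ps (\<lambda>y. coeff2 z n p (zero_on {p} y) - coeff2 z n p (zero_on ?Q y)) (Y \<omega>)"
      by (simp add: B_def B'_def sign_avg_lin)
    also have "\<bar>\<dots>\<bar> \<le> (\<Sum>q\<in>near n a p. C / real n * ?m q \<omega>)"
    proof (rule sign_avg_abs_le)
      fix y assume y: "sign_completion ps (Y \<omega>) y"
      have yq: "zero_on {p} y q = Y \<omega> q" if "q \<in> near n a p" for q
      proof -
        have "q \<notin> set ps" using future[of q] that by (auto simp: near_def)
        then have "y q = Y \<omega> q" using y unfolding sign_completion_def by blast
        moreover have "q \<noteq> p" using that Q by auto
        ultimately show ?thesis by (simp add: zero_on_def)
      qed
      have "zero_on ?Q y = zero_on (near n a p) (zero_on {p} y)" by (auto simp: zero_on_def)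
      then show "\<bar>coeff2 z n p (zero_on {p} y) - coeff2 z n p (zero_on ?Q y)\<bar> \<le>
          (\<Sum>q\<in>near n a p. C / real n * ?m q \<omega>)"
        using coeff2_zero_on[OF p(1) finite_ball_tri(2) Q(2), of "zero_on {p} y"] yq by simp
    qed
    finally show ?thesis .
  qed
  have pt: "sign_avg ps ?f (Y \<omega>) - sign_avg (p # ps) ?f (Y \<omega>) \<le>
      1 / sqrt (real n) * (Y \<omega> p * A \<omega>) + 1 / real n * (((Y \<omega> p)^2 - 1) * B \<omega>) + rest (Y \<omega> p)" for \<omega>
  proof -
    have "sign_avg (p # ps) ?f (Y \<omega>) = sign_avg ps (sign_avg [p] ?f) (Y \<omega>)"
      unfolding sign_avg_commute by simp
    then have "sign_avg ps ?f (Y \<omega>) - sign_avg (p # ps) ?f (Y \<omega>) =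
        sign_avg ps (\<lambda>y. ?f y - sign_avg [p] ?f y) (Y \<omega>)"
      by (simp only: sign_avg_diff)
    also have "\<dots> \<le> sign_avg ps (\<lambda>y. Y \<omega> p / sqrt (real n) * coeff1 z n p (zero_on {p} y) +
        ((Y \<omega> p)^2 - 1) / real n * coeff2 z n p (zero_on {p} y) + rest (Y \<omega> p)) (Y \<omega>)"
    proof (rule sign_avg_mono)
      fix y assume "sign_completion ps (Y \<omega>) y"
      then have "y p = Y \<omega> p" using p(2) unfolding sign_completion_def by blast
      then show "?f y - sign_avg [p] ?f y \<le> Y \<omega> p / sqrt (real n) * coeff1 z n p (zero_on {p} y) +
          ((Y \<omega> p)^2 - 1) / real n * coeff2 z n p (zero_on {p} y) + rest (Y \<omega> p)"
        using lindeberg_pointwise[OF p(1) e, of y] by (simp add: zero_on_singleton rest_def)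
    qed
    also have "\<dots> = Y \<omega> p / sqrt (real n) * A \<omega> + ((Y \<omega> p)^2 - 1) / real n * B \<omega> + rest (Y \<omega> p)"
      by (simp only: sign_avg_add sign_avg_cmult sign_avg_const A_def B_def)
    finally show ?thesis by simp
  qed
  have iA: "integrable M (\<lambda>\<omega>. Y \<omega> p * A \<omega>)"
    by (rule integrable_mult_bounded[OF Y_integrable A_meas' bounds(1)])
  have iY: "integrable M (\<lambda>\<omega>. (Y \<omega> p)^2 + c)" "integrable M (\<lambda>\<omega>. (Y \<omega> p)^2 - c)" for c
    using Y_square_integrable by auto
  have iB: "integrable M (\<lambda>\<omega>. ((Y \<omega> p)^2 - c) * B \<omega>)" for c
    by (rule integrable_mult_bounded[OF iY(2) B_meas bounds(2)])
  have iB': "integrable M (\<lambda>\<omega>. ((Y \<omega> p)^2 - c) * B' \<omega>)" for c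
    by (rule integrable_mult_bounded[OF iY(2) B'_meas' bounds(3)])
  have iB1: "integrable M B"
    by (rule integrable_const_bound[where B = "C / real n"]) (use bounds B_meas in auto)
  have irest: "integrable M (\<lambda>\<omega>. rest (Y \<omega> p))"
    unfolding rest_def using Y_square_integrable tail_integrable by auto
  have rest: "(\<integral>\<omega>. rest (Y \<omega> p) \<partial>M) =
      C / (real n)^2 * (\<epsilon> * s p + tail \<epsilon> n p + s p / real n + 2 / sqrt (real n))"
    unfolding rest_def using Y_square_integrable tail_integrable by (simp add: tail_def prob_space Y_variance)
  have "(\<integral>\<omega>. ?d \<omega> * (B \<omega> - B' \<omega>) \<partial>M) \<le>
      (\<integral>\<omega>. (\<Sum>q\<in>near n a p. C / real n * (((Y \<omega> p)^2 + s p) * ?m q \<omega>)) \<partial>M)"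
  proof (rule integral_mono)
    show "integrable M (\<lambda>\<omega>. ?d \<omega> * (B \<omega> - B' \<omega>))"
      unfolding right_diff_distrib using iB iB' by auto
    show "integrable M (\<lambda>\<omega>. \<Sum>q\<in>near n a p. C / real n * (((Y \<omega> p)^2 + s p) * ?m q \<omega>))"
      by (intro Bochner_Integration.integrable_sum integrable_mult_right integrable_mult_bounded[where c = 1] iY) auto
    fix \<omega>
    have "?d \<omega> * (B \<omega> - B' \<omega>) \<le> \<bar>(Y \<omega> p)^2 - s p\<bar> * \<bar>B \<omega> - B' \<omega>\<bar>"
      by (metis abs_ge_self abs_mult)
    also have "\<dots> \<le> ((Y \<omega> p)^2 + s p) * (\<Sum>q\<in>near n a p. C / real n * ?m q \<omega>)"
      using s_nonneg[of p] by (intro mult_mono BB') (auto simp: abs_le_iff add_nonneg_nonneg)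
    finally show "?d \<omega> * (B \<omega> - B' \<omega>) \<le>
        (\<Sum>q\<in>near n a p. C / real n * (((Y \<omega> p)^2 + s p) * ?m q \<omega>))"
      by (simp only: sum_distrib_left mult.left_commute)
  qed
  also have "\<dots> = (\<Sum>q\<in>near n a p. C / real n * (\<integral>\<omega>. ((Y \<omega> p)^2 + s p) * ?m q \<omega> \<partial>M))"
  proof -
    have "integrable M (\<lambda>\<omega>. ((Y \<omega> p)^2 + s p) * ?m q \<omega>)" for q
      by (intro integrable_mult_bounded[where c = 1] iY) auto
    then show ?thesis by (subst Bochner_Integration.integral_sum) auto
  qed
  also have "\<dots> \<le> (\<Sum>q\<in>near n a p. C / real n * ?b q)"
    using C_ge(2) by (intro sum_mono mult_left_mono neighbour_bound e n) auto
  finally have near: "(\<integral>\<omega>. ?d \<omega> * (B \<omega> - B' \<omega>) \<partial>M) \<le>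
      C / real n * (\<Sum>q\<in>near n a p. ?b q)"
    by (simp add: sum_distrib_left)
  have far: "(\<integral>\<omega>. ?d \<omega> * B' \<omega> \<partial>M) \<le> C / real n * memory a p"
    by (rule memory_bound[OF B'_meas bounds(3)])
  have mean: "(s p - 1) * (\<integral>\<omega>. B \<omega> \<partial>M) \<le> C / real n * \<bar>s p - 1\<bar>"
  proof -
    have "\<bar>\<integral>\<omega>. B \<omega> \<partial>M\<bar> \<le> (\<integral>\<omega>. C / real n \<partial>M)"
      by (rule order_trans[OF integral_abs_bound integral_mono]) (use iB1 bounds in auto)
    then have "\<bar>s p - 1\<bar> * \<bar>\<integral>\<omega>. B \<omega> \<partial>M\<bar> \<le> \<bar>s p - 1\<bar> * (C / real n)"
      by (intro mult_left_mono) (auto simp: prob_space)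
    moreover have "(s p - 1) * (\<integral>\<omega>. B \<omega> \<partial>M) \<le> \<bar>s p - 1\<bar> * \<bar>\<integral>\<omega>. B \<omega> \<partial>M\<bar>"
      by (metis abs_ge_self abs_mult)
    ultimately show ?thesis by (simp add: mult.commute)
  qed
  have "(\<integral>\<omega>. ((Y \<omega> p)^2 - 1) * B \<omega> \<partial>M) =
      (\<integral>\<omega>. ?d \<omega> * B' \<omega> + ?d \<omega> * (B \<omega> - B' \<omega>) + (s p - 1) * B \<omega> \<partial>M)"
    by (intro Bochner_Integration.integral_cong) (auto simp: algebra_simps)
  also have "\<dots> = (\<integral>\<omega>. ?d \<omega> * B' \<omega> \<partial>M) + (\<integral>\<omega>. ?d \<omega> * (B \<omega> - B' \<omega>) \<partial>M) +
      (s p - 1) * (\<integral>\<omega>. B \<omega> \<partial>M)"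
  proof -
    have "integrable M (\<lambda>\<omega>. ?d \<omega> * (B \<omega> - B' \<omega>))"
      unfolding right_diff_distrib using iB iB' by auto
    then show ?thesis using iB' iB1 by simp
  qed
  also have "\<dots> \<le> C / real n * (memory a p + (\<Sum>q\<in>near n a p. ?b q) + \<bar>s p - 1\<bar>)"
    using near far mean by (simp add: distrib_left)
  finally have second: "1 / real n * (\<integral>\<omega>. ((Y \<omega> p)^2 - 1) * B \<omega> \<partial>M) \<le>
      1 / real n * (C / real n * (memory a p + (\<Sum>q\<in>near n a p. ?b q) + \<bar>s p - 1\<bar>))"
    by (intro mult_left_mono) auto
  have "(\<integral>\<omega>. sign_avg ps ?f (Y \<omega>) \<partial>M) - (\<integral>\<omega>. sign_avg (p # ps) ?f (Y \<omega>) \<partial>M) =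
      (\<integral>\<omega>. sign_avg ps ?f (Y \<omega>) - sign_avg (p # ps) ?f (Y \<omega>) \<partial>M)"
    by (rule Bochner_Integration.integral_diff[symmetric]) (rule sign_avg_sq_defect_integrable)+
  also have "\<dots> \<le> (\<integral>\<omega>. 1 / sqrt (real n) * (Y \<omega> p * A \<omega>) + 1 / real n * (((Y \<omega> p)^2 - 1) * B \<omega>) + rest (Y \<omega> p) \<partial>M)"
    by (intro integral_mono pt Bochner_Integration.integrable_diff Bochner_Integration.integrable_add
        integrable_mult_right sign_avg_sq_defect_integrable iA iB irest)
  also have "\<dots> = 1 / sqrt (real n) * (\<integral>\<omega>. Y \<omega> p * A \<omega> \<partial>M) + 1 / real n * (\<integral>\<omega>. ((Y \<omega> p)^2 - 1) * B \<omega> \<partial>M) +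
      (\<integral>\<omega>. rest (Y \<omega> p) \<partial>M)"
    using iA iB[of 1] irest by simp
  also have "(\<integral>\<omega>. Y \<omega> p * A \<omega> \<partial>M) = 0"
    by (rule martingale_orthogonal[OF pp A_meas bounds(1)])
  also have "1 / sqrt (real n) * 0 + 1 / real n * (\<integral>\<omega>. ((Y \<omega> p)^2 - 1) * B \<omega> \<partial>M) + (\<integral>\<omega>. rest (Y \<omega> p) \<partial>M) \<le>
      step_error \<epsilon> n a p"
    using second unfolding rest step_error_def by (simp add: power2_eq_square algebra_simps)
  finally show ?thesis by simp
qed

lemma lindeberg_telescope:
  assumes e: "0 < \<epsilon>" and st: "set (us @ vs) = tri n" "sorted_wrt lex_less (us @ vs)" "distinct (us @ vs)"
  shows "(\<integral>\<omega>. sign_avg vs (sq_defect z n) (Y \<omega>) \<partial>M) \<le>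
    (\<integral>\<omega>. sign_avg (us @ vs) (sq_defect z n) (Y \<omega>) \<partial>M) + sum (step_error \<epsilon> n a) (set us)"
  using st
proof (induction us arbitrary: vs rule: rev_induct)
  case (snoc p us)
  have "(\<integral>\<omega>. sign_avg vs (sq_defect z n) (Y \<omega>) \<partial>M) \<le>
      (\<integral>\<omega>. sign_avg (p # vs) (sq_defect z n) (Y \<omega>) \<partial>M) + step_error \<epsilon> n a p"
  proof (rule lindeberg_step[OF _ _ e])
    show "p \<in> tri n" using snoc.prems(1) by auto
    show "p \<notin> set vs" using snoc.prems(3) by auto
    show "lex_less q p" if "q \<in> tri n" "q \<notin> set vs" "q \<noteq> p" for q
    proof -
      have "q \<in> set us" using that snoc.prems(1) by auto
      then show ?thesis using snoc.prems(2) by (simp add: sorted_wrt_append)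
    qed
    show "\<not> lex_less q p" if "q \<in> set vs" for q
    proof -
      have "lex_less p q" using that snoc.prems(2) by (simp add: sorted_wrt_append)
      then show ?thesis by (auto simp: lex_less_def)
    qed
  qed
  also have "(\<integral>\<omega>. sign_avg (p # vs) (sq_defect z n) (Y \<omega>) \<partial>M) \<le>
      (\<integral>\<omega>. sign_avg (us @ p # vs) (sq_defect z n) (Y \<omega>) \<partial>M) + sum (step_error \<epsilon> n a) (set us)"
    using snoc.prems by (intro snoc.IH) auto
  finally show ?case using snoc.prems(3) by simp
qed simp

theorem sq_defect_expectation_le:
  assumes e: "0 < \<epsilon>" and n: "0 < n"
  shows "(\<integral>\<omega>. sq_defect z n (Y \<omega>) \<partial>M) \<le> 2 * C / sqrt (real n) + sum (step_error \<epsilon> n a) (tri n)"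
proof -
  have "(\<integral>\<omega>. sign_avg (tri_list n) (sq_defect z n) (Y \<omega>) \<partial>M) \<le> (\<integral>\<omega>. 2 * C / sqrt (real n) \<partial>M)"
    by (intro integral_mono sign_avg_sq_defect_integrable sign_avg_sq_defect set_tri_list n) simp
  then show ?thesis
    using lindeberg_telescope[OF e, of "tri_list n" "[]" n a] set_tri_list sorted_tri_list distinct_tri_list
    by (simp add: prob_space)
qed

definition avg :: "nat \<Rightarrow> (nat \<times> nat \<Rightarrow> real) \<Rightarrow> real" where
  "avg n h = (\<Sum>p\<in>tri n. h p) / (real n)^2"

lemma step_error_sum:
  assumes e: "0 < \<epsilon>" and n: "0 < n"
  shows "sum (step_error \<epsilon> n a) (tri n) \<le>
    C * (avg n (memory a) + real ((2 * a + 1)^2) * (2 * \<epsilon> * avg n s + 4 * avg n (tail \<epsilon> n)) +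
     avg n (\<lambda>p. \<bar>s p - 1\<bar>) + \<epsilon> * avg n s + avg n (tail \<epsilon> n) + avg n s / real n + 2 / sqrt (real n))"
proof -
  let ?N = "real ((2 * a + 1)^2)" and ?T = "tail \<epsilon> n"
  have "(\<Sum>p\<in>tri n. \<Sum>q\<in>near n a p. 2 * \<epsilon> * s p + 2 * (?T p + ?T q)) =
      (\<Sum>p\<in>tri n. \<Sum>q\<in>near n a p. (2 * \<epsilon> * s p + 2 * ?T p) + 2 * ?T q)"
    by (simp add: algebra_simps)
  also have "\<dots> \<le> ?N * ((\<Sum>p\<in>tri n. 2 * \<epsilon> * s p + 2 * ?T p) + (\<Sum>p\<in>tri n. 2 * ?T p))"
    using e s_nonneg tail_nonneg by (intro sum_near_le) (auto intro!: add_nonneg_nonneg mult_nonneg_nonneg)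
  also have "\<dots> = ?N * (2 * \<epsilon> * sum s (tri n) + 4 * sum ?T (tri n))"
    by (simp add: sum.distrib sum_distrib_left[symmetric])
  finally have near: "(\<Sum>p\<in>tri n. \<Sum>q\<in>near n a p. 2 * \<epsilon> * s p + 2 * (?T p + ?T q)) \<le> \<dots>" .
  have "(\<Sum>p\<in>tri n. 2 / sqrt (real n)) \<le> (real n)^2 * (2 / sqrt (real n))"
    using card_tri[of n] unfolding sum_constant
    by (intro mult_right_mono) (simp_all add: power2_eq_square flip: of_nat_mult)
  note last = this
  have "sum (step_error \<epsilon> n a) (tri n) = C / (real n)^2 * (sum (memory a) (tri n) +
      (\<Sum>p\<in>tri n. \<Sum>q\<in>near n a p. 2 * \<epsilon> * s p + 2 * (?T p + ?T q)) +
      (\<Sum>p\<in>tri n. \<bar>s p - 1\<bar>) + \<epsilon> * sum s (tri n) + sum ?T (tri n) + sum s (tri n) / real n + (\<Sum>p\<in>tri n. 2 / sqrt (real n)))"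
    unfolding step_error_def sum_distrib_left[symmetric] sum.distrib sum_divide_distrib[symmetric] ..
  also have "\<dots> \<le> C / (real n)^2 * (sum (memory a) (tri n) +
      ?N * (2 * \<epsilon> * sum s (tri n) + 4 * sum ?T (tri n)) +
      (\<Sum>p\<in>tri n. \<bar>s p - 1\<bar>) + \<epsilon> * sum s (tri n) + sum ?T (tri n) + sum s (tri n) / real n + (real n)^2 * (2 / sqrt (real n)))"
    using near last C_ge(2) by (intro mult_left_mono add_mono order_refl) auto
  also have "\<dots> = C * (avg n (memory a) + ?N * (2 * \<epsilon> * avg n s + 4 * avg n ?T) +
     avg n (\<lambda>p. \<bar>s p - 1\<bar>) + \<epsilon> * avg n s + avg n ?T + avg n s / real n + 2 / sqrt (real n))"
    using n unfolding avg_def by (simp add: add_divide_distrib distrib_left mult_ac)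
  finally show ?thesis .
qed

text \<open>The order of the choices is dictated by the error bound: the lag \<open>a\<close> first, then \<open>\<epsilon>\<close> small compared
  with the size of the neighbourhoods, and \<open>n\<close> last.\<close>

theorem sq_defect_expectation_tendsto:
  assumes s_bound: "\<And>n. 0 < n \<Longrightarrow> avg n s \<le> S"
    and mem: "\<And>\<delta>. 0 < \<delta> \<Longrightarrow> \<exists>a. \<forall>\<^sub>F n in sequentially. avg n (memory a) < \<delta>"
    and tail: "\<And>\<epsilon>. 0 < \<epsilon> \<Longrightarrow> (\<lambda>n. avg n (tail \<epsilon> n)) \<longlonglongrightarrow> 0"
    and var: "(\<lambda>n. avg n (\<lambda>p. \<bar>s p - 1\<bar>)) \<longlonglongrightarrow> 0"
  shows "(\<lambda>n. \<integral>\<omega>. sq_defect z n (Y \<omega>) \<partial>M) \<longlonglongrightarrow> 0"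
proof (rule order_tendstoI)
  let ?I = "\<lambda>n. \<integral>\<omega>. sq_defect z n (Y \<omega>) \<partial>M"
  fix y :: real assume "y < 0"
  then have "y < ?I n" for n
    by (rule less_le_trans) (auto simp: sq_defect_def intro!: Bochner_Integration.integral_nonneg)
  then show "\<forall>\<^sub>F n in sequentially. y < ?I n" by simp
next
  let ?I = "\<lambda>n. \<integral>\<omega>. sq_defect z n (Y \<omega>) \<partial>M"
  fix y :: real assume y: "0 < y"
  have C0: "0 < C" using K0 by (simp add: C_def)
  have "0 \<le> avg 1 s" by (simp add: avg_def sum_nonneg s_nonneg)
  then have S0: "0 \<le> S" using s_bound[of 1] by simp
  obtain a where a: "\<forall>\<^sub>F n in sequentially. avg n (memory a) < y / (4 * C)"
    using mem[of "y / (4 * C)"] y C0 by auto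
  \<comment> \<open>bounds the number of entries that are set to zero together\<close>
  define N where "N = real ((2 * a + 1)^2)"
  have N: "0 \<le> N" by (simp add: N_def)
  define \<epsilon> where "\<epsilon> = y / (4 * C * ((2 * N + 1) * S + 1))"
  have d: "0 < (2 * N + 1) * S + 1" using N S0 by (simp add: add_nonneg_pos)
  have e: "0 < \<epsilon>" using y C0 d by (simp add: \<epsilon>_def)
  have eps: "C * (\<epsilon> * ((2 * N + 1) * S)) \<le> y / 4"
  proof -
    have "C * (\<epsilon> * ((2 * N + 1) * S)) \<le> C * (\<epsilon> * ((2 * N + 1) * S + 1))"
      using C0 e by (intro mult_left_mono) auto
    also have "\<dots> = y / 4" using C0 d by (simp add: \<epsilon>_def)
    finally show ?thesis .
  qed
  define r where "r = (\<lambda>n. 2 * C / sqrt (real n) + C * ((4 * N + 1) * avg n (tail \<epsilon> n) + avg n (\<lambda>p. \<bar>s p - 1\<bar>) +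
      S * (1 / real n) + 2 / sqrt (real n)))"
  have "(\<lambda>n. 1 / sqrt (real n)) \<longlonglongrightarrow> 0"
    by real_asymp
  then have "(\<lambda>n. 2 * C * (1 / sqrt (real n)) + C * ((4 * N + 1) * avg n (tail \<epsilon> n) + avg n (\<lambda>p. \<bar>s p - 1\<bar>) +
      S * (1 / real n) + 2 * (1 / sqrt (real n)))) \<longlonglongrightarrow> 2 * C * 0 + C * ((4 * N + 1) * 0 + 0 + S * 0 + 2 * 0)"
    by (intro tendsto_intros tail[OF e] var lim_1_over_n)
  then have "r \<longlonglongrightarrow> 0" by (simp add: r_def)
  then have "\<forall>\<^sub>F n in sequentially. r n < y / 4" using y by (intro order_tendstoD(2)) auto
  moreover have "\<forall>\<^sub>F n in sequentially. 0 < n" by (rule eventually_gt_at_top)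
  ultimately show "\<forall>\<^sub>F n in sequentially. ?I n < y"
    using a
  proof eventually_elim
    case (elim n)
    note n = elim(2)
    let ?s = "avg n s" and ?t = "avg n (tail \<epsilon> n)" and ?v = "avg n (\<lambda>p. \<bar>s p - 1\<bar>)"
    have "?I n \<le> 2 * C / sqrt (real n) + C * (avg n (memory a) + N * (2 * \<epsilon> * ?s + 4 * ?t) +
         ?v + \<epsilon> * ?s + ?t + ?s / real n + 2 / sqrt (real n))"
      using sq_defect_expectation_le[OF e n, of a] step_error_sum[OF e n, of a] by (simp add: N_def)
    also have "\<dots> \<le> 2 * C / sqrt (real n) + C * (avg n (memory a) + N * (2 * \<epsilon> * S + 4 * ?t) +
         ?v + \<epsilon> * S + ?t + S / real n + 2 / sqrt (real n))"
      using s_bound[OF n] C0 N e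
      by (intro add_left_mono mult_left_mono add_mono divide_right_mono order_refl) auto
    also have "\<dots> = C * avg n (memory a) + C * (\<epsilon> * ((2 * N + 1) * S)) + r n"
      by (simp add: r_def algebra_simps)
    also have "\<dots> < y / 4 + y / 4 + y / 4"
    proof -
      have "C * avg n (memory a) < y / 4" using elim(3) C0 by (simp add: field_simps)
      from add_strict_mono[OF add_less_le_mono[OF this eps] elim(1)] show ?thesis by simp
    qed
    also have "\<dots> < y" using y by simp
    finally show ?case .
  qed
qed

end

section \<open>Eigenvalues and the trace of the resolvent\<close>

lemma poly_pderiv_linear_factors:
  fixes z :: "'a :: {field_char_0}"
  assumes "z \<notin> set as"
  shows "poly (pderiv (\<Prod>a\<leftarrow>as. [:- a, 1:])) z = poly (\<Prod>a\<leftarrow>as. [:- a, 1:]) z * (\<Sum>a\<leftarrow>as. 1 / (z - a))"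
  using assms
proof (induction as)
  case (Cons a as)
  then have "z - a \<noteq> 0" by auto
  then show ?case using Cons by (simp add: pderiv_mult pderiv_pCons field_simps del: mult_pCons_left)
qed simp

text \<open>By Jacobi's formula the trace of the adjugate of \<open>A - z\<close> is, up to sign, the derivative of the
  characteristic polynomial, so the trace of the resolvent is minus its logarithmic derivative.\<close>

lemma mtr_resolvent_eigenvalues:
  assumes A: "hermitian_mat n A" and z: "Im z \<noteq> 0" and cp: "char_poly A = (\<Prod>a\<leftarrow>as. [:- a, 1:])"
  shows "mtr (resolvent z A) = (\<Sum>a\<leftarrow>as. 1 / (a - z))"
proof -
  define B where "B = A - z \<cdot>\<^sub>m 1\<^sub>m n"
  have Ac: "A \<in> carrier_mat n n" by (rule hermitian_matD(1)[OF A])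
  then have Bc: "B \<in> carrier_mat n n" by (auto simp: B_def)
  have d: "det B \<noteq> 0" unfolding B_def by (rule det_shift_nonzero[OF A z])
  have neg: "poly (char_poly D) z = (-1) ^ m * det (D - z \<cdot>\<^sub>m 1\<^sub>m m)" if D: "D \<in> carrier_mat m m" for D m
  proof -
    have "- (char_matrix D z) = (-1) \<cdot>\<^sub>m (D - z \<cdot>\<^sub>m 1\<^sub>m m)"
      using D by (intro eq_matI) (auto simp: char_matrix_def)
    then show ?thesis unfolding char_poly_matrix[OF D] using D by (simp add: det_smult)
  qed
  have p0: "poly (char_poly A) z = (-1) ^ n * det B" unfolding B_def by (rule neg[OF Ac])
  have p1: "poly (pderiv (char_poly A)) z = - ((-1) ^ n * (\<Sum>i<n. det (mat_delete B i i)))"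
  proof -
    have "poly (char_poly (mat_delete A i i)) z = - ((-1) ^ n * det (mat_delete B i i))" if i: "i < n" for i
    proof -
      have "mat_delete B i i = mat_delete A i i - z \<cdot>\<^sub>m 1\<^sub>m (n - 1)"
        using Ac i by (intro eq_matI) (auto simp: B_def mat_delete_def)
      moreover have "mat_delete A i i \<in> carrier_mat (n - 1) (n - 1)" by (rule mat_delete_carrier[OF Ac])
      moreover have "(-1 :: complex) ^ n = - ((-1) ^ (n - 1))" using i by (cases n) auto
      ultimately show ?thesis by (simp add: neg)
    qed
    then show ?thesis by (simp add: pderiv_char_poly[OF Ac] poly_sum sum_negf sum_distrib_left)
  qed
  have zs: "z \<notin> set as"
  proof
    assume "z \<in> set as"
    then have "poly (char_poly A) z = 0" by (simp add: cp poly_prod_list_zero_iff)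
    then show False using p0 d by simp
  qed
  have "mtr (resolvent z A) = (\<Sum>i<n. det (mat_delete B i i)) / det B"
    using Ac Bc by (simp add: mtr_def resolvent_def Let_def B_def[symmetric] adj_mat_def cofactor_def sum_divide_distrib)
  also have "\<dots> = - (poly (pderiv (char_poly A)) z / poly (char_poly A) z)"
    unfolding p0 p1 by simp
  also have "\<dots> = - (\<Sum>a\<leftarrow>as. 1 / (z - a))"
    using poly_pderiv_linear_factors[OF zs] p0 d by (simp add: cp[symmetric])
  also have "\<dots> = (\<Sum>a\<leftarrow>as. 1 / (a - z))"
    by (induction as) (simp_all add: minus_divide_right)
  finally show ?thesis .
qed

text \<open>A root of the characteristic polynomial off the real axis would make the resolvent fail to exist
  there; hence the polynomial splits over the reals.\<close>

lemma real_symmetric_spectrum: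
  fixes A :: "real mat"
  assumes A: "A \<in> carrier_mat n n" and sym: "\<And>i j. i < n \<Longrightarrow> j < n \<Longrightarrow> A $$ (i,j) = A $$ (j,i)"
  obtains ls where "length ls = n" "eigenvalues A = mset ls"
    "\<And>z. Im z \<noteq> 0 \<Longrightarrow> mtr (resolvent z (map_mat complex_of_real A)) = (\<Sum>l\<leftarrow>ls. 1 / (of_real l - z))"
proof -
  let ?A = "map_mat complex_of_real A"
  have h: "hermitian_mat n ?A"
    unfolding hermitian_mat_def using A sym by auto
  note Ac = hermitian_matD(1)[OF h]
  obtain as where as: "char_poly ?A = (\<Prod>a\<leftarrow>as. [:- a, 1:])" "length as = n"
    using char_poly_factorized[OF Ac] by blast
  have re: "Im a = 0" if "a \<in> set as" for a
  proof (rule ccontr)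
    assume "Im a \<noteq> 0"
    have "poly (char_poly ?A) a = 0" using that by (simp add: as poly_prod_list_zero_iff)
    then have "det (char_matrix ?A a) = 0"
      using eigenvalue_root_char_poly[OF Ac] eigenvalue_det[OF Ac] by blast
    moreover have "char_matrix ?A a = ?A - a \<cdot>\<^sub>m 1\<^sub>m n"
      using Ac by (intro eq_matI) (auto simp: char_matrix_def)
    ultimately show False using det_shift_nonzero[OF h \<open>Im a \<noteq> 0\<close>] by simp
  qed
  define ls where "ls = map Re as"
  have as_ls: "as = map complex_of_real ls"
    unfolding ls_def using re by (simp add: map_idI complex_eq_iff)
  have "poly (char_poly A) = poly (\<Prod>l\<leftarrow>ls. [:- l, 1:])"
  proof
    fix x
    have "complex_of_real (poly (char_poly A) x) = poly (map_poly complex_of_real (char_poly A)) (of_real x)"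
      by simp
    also have "map_poly complex_of_real (char_poly A) = char_poly ?A"
      by (rule of_real_hom.char_poly_hom[OF A, symmetric])
    also have "poly (char_poly ?A) (of_real x) = of_real (poly (\<Prod>l\<leftarrow>ls. [:- l, 1:]) x)"
      unfolding as(1) as_ls by (induction ls) simp_all
    finally show "poly (char_poly A) x = poly (\<Prod>l\<leftarrow>ls. [:- l, 1:]) x"
      by (simp only: of_real_eq_iff)
  qed
  then have "char_poly A = (\<Prod>l\<leftarrow>ls. [:- l, 1:])" by (simp only: poly_eq_poly_eq_iff)
  moreover have "proots (\<Prod>l\<leftarrow>ls. [:- l, 1:]) = mset ls"
  proof (induction ls)
    case (Cons l ls)
    have "(\<Prod>l\<leftarrow>ls. [:- l, 1:]) \<noteq> 0" by (auto simp: prod_list_zero_iff)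
    then have "proots ([:- l, 1:] * (\<Prod>l\<leftarrow>ls. [:- l, 1:])) = {#l#} + mset ls"
      by (subst proots_mult) (simp_all add: Cons del: mult_pCons_left)
    then show ?case by (simp del: mult_pCons_left)
  qed simp
  ultimately have "eigenvalues A = mset ls" by (simp add: eigenvalues_def)
  moreover have "length ls = n" by (simp add: ls_def as)
  moreover have "mtr (resolvent z ?A) = (\<Sum>l\<leftarrow>ls. 1 / (of_real l - z))" if "Im z \<noteq> 0" for z
    using mtr_resolvent_eigenvalues[OF h that as(1)] by (simp add: as_ls o_def)
  ultimately show ?thesis using that by blast
qed

lemma normalized_field_mat_wigner:
  "map_mat complex_of_real (normalized_field_mat X n \<omega>) =
    wigner n (\<lambda>(k, l). X (int k + 1) (int l + 1) \<omega>)"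
  by (intro eq_matI) (auto simp: normalized_field_mat_def field_mat_def wigner_def Let_def max_def min_def)

lemma normalized_field_mat_spectrum:
  obtains ls where "length ls = n"
    "\<And>t. spectral_cdf (normalized_field_mat X n \<omega>) t = (\<Sum>l\<leftarrow>ls. of_bool (l \<le> t)) / real n"
    "\<And>z. Im z \<noteq> 0 \<Longrightarrow> stieltjes z n (\<lambda>(k, l). X (int k + 1) (int l + 1) \<omega>) =
      (\<Sum>l\<leftarrow>ls. 1 / (of_real l - z)) / of_nat n"
proof -
  let ?A = "normalized_field_mat X n \<omega>"
  have A: "?A \<in> carrier_mat n n" by (simp add: normalized_field_mat_def field_mat_def)
  have sym: "?A $$ (i,j) = ?A $$ (j,i)" if "i < n" "j < n" for i j
    using that by (auto simp: normalized_field_mat_def field_mat_def Let_def)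
  from real_symmetric_spectrum[OF A sym] obtain ls where ls: "length ls = n" "eigenvalues ?A = mset ls"
    "\<And>z. Im z \<noteq> 0 \<Longrightarrow> mtr (resolvent z (map_mat complex_of_real ?A)) = (\<Sum>l\<leftarrow>ls. 1 / (of_real l - z))"
    by blast
  have "spectral_cdf ?A t = (\<Sum>l\<leftarrow>ls. of_bool (l \<le> t)) / real n" for t
  proof -
    have "(\<Sum>l\<in>#mset ls. of_bool (l \<le> t)) = (\<Sum>l\<leftarrow>ls. of_bool (l \<le> t) :: real)"
      by (metis mset_map sum_mset_sum_list)
    then show ?thesis using carrier_matD(1)[OF A] by (simp add: spectral_cdf_def ls(2))
  qed
  moreover have "stieltjes z n (\<lambda>(k, l). X (int k + 1) (int l + 1) \<omega>) =
      (\<Sum>l\<leftarrow>ls. 1 / (of_real l - z)) / of_nat n" if "Im z \<noteq> 0" for z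
    using ls(3)[OF that] by (simp add: stieltjes_def normalized_field_mat_wigner)
  ultimately show ?thesis using that[OF ls(1)] by blast
qed

section \<open>The semicircle distribution\<close>

lemma semicircle_density_eq: "semicircle_density x = sqrt (max 0 (4 - x^2)) / (2 * pi)"
proof -
  have "\<bar>x\<bar> \<le> 2 \<longleftrightarrow> x^2 \<le> 4" using abs_le_square_iff[of x 2] by simp
  then show ?thesis by (auto simp: semicircle_density_def indicator_def max_def)
qed

lemma continuous_semicircle_density: "continuous_on A semicircle_density"
  unfolding semicircle_density_eq[abs_def] by (intro continuous_intros) auto

lemma semicircle_density_outside: "2 \<le> \<bar>x\<bar> \<Longrightarrow> semicircle_density x = 0"
  using abs_le_square_iff[of 2 x] by (simp add: semicircle_density_eq)

lemma semicircle_total: "integral {-3..3} semicircle_density = 1"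
proof -
  define F where "F = (\<lambda>x::real. (x * sqrt (4 - x^2) / 2 + 2 * arcsin (x / 2)) / (2 * pi))"
  have "(semicircle_density has_integral (F 2 - F (-2))) {-2..2}"
  proof (rule fundamental_theorem_of_calculus_interior)
    show "continuous_on {-2..2} F"
      unfolding F_def by (intro continuous_intros) auto
    fix x :: real assume x: "x \<in> {-2<..<2}"
    have "\<bar>x\<bar> < 2" using x by auto
    then have "\<bar>x\<bar>^2 < 2^2" by (intro power_strict_mono) auto
    then have x2: "x^2 < 4" by simp
    define r where "r = sqrt (4 - x^2)"
    have r: "0 < r" "r * r = 4 - x^2" "r \<noteq> 0" using x2 by (auto simp: r_def)
    have half: "sqrt (1 - (x / 2)^2) = r / 2"
      unfolding r_def by (rule real_sqrt_unique) (use x2 in \<open>auto simp: power_divide field_simps\<close>)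
    have d1: "((\<lambda>x. sqrt (4 - x^2)) has_real_derivative - x / r) (at x)"
      unfolding r_def using x2 by (auto intro!: derivative_eq_intros simp: field_simps)
    have d2: "((\<lambda>x. arcsin (x / 2)) has_real_derivative 1 / r) (at x)"
    proof -
      have "((\<lambda>x. arcsin (x / 2)) has_real_derivative inverse (sqrt (1 - (x / 2)^2)) * (1 / 2)) (at x)"
        using x by (intro DERIV_chain2[OF DERIV_arcsin]) (auto intro!: derivative_eq_intros)
      then show ?thesis unfolding half using r by (simp add: field_simps)
    qed
    have "(F has_real_derivative ((1 * sqrt (4 - x^2) + (- x / r) * x) / 2 + 2 * (1 / r)) / (2 * pi)) (at x)"
      unfolding F_def by (intro DERIV_cdivide DERIV_add DERIV_mult DERIV_cmult DERIV_ident d1 d2)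
    also have "((1 * sqrt (4 - x^2) + (- x / r) * x) / 2 + 2 * (1 / r)) / (2 * pi) = semicircle_density x"
    proof -
      have "(1 * r + (- x / r) * x) / 2 + 2 * (1 / r) = r"
        using r by (simp add: field_simps power2_eq_square)
      then show ?thesis using x2 by (simp add: semicircle_density_eq r_def[symmetric])
    qed
    finally show "(F has_vector_derivative semicircle_density x) (at x)"
      by (simp add: has_real_derivative_iff_has_vector_derivative)
  qed simp
  moreover have "F 2 - F (-2) = 1" by (simp add: F_def arcsin_minus field_simps)
  ultimately have "(semicircle_density has_integral 1) {-2..2}" by simp
  then have "(semicircle_density has_integral 1) {-3..3}"
    by (rule has_integral_on_superset) (auto simp: semicircle_density_outside)
  then show ?thesis by (rule integral_unique)
qed

lemma semicircle_cdf_eq_integral: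
  assumes "-3 \<le> a" "a \<le> 3" "{..x} \<inter> {-3..3} = {-3..a}"
  shows "semicircle_cdf x = integral {-3..a} semicircle_density"
proof -
  have "semicircle_cdf x = (\<integral>u\<in>{-3..a}. semicircle_density u \<partial>lborel)"
    unfolding semicircle_cdf_def set_lebesgue_integral_def
  proof (intro Bochner_Integration.integral_cong refl)
    fix u
    show "indicator {..x} u *\<^sub>R semicircle_density u = indicator {-3..a} u *\<^sub>R semicircle_density u"
      using assms(3) semicircle_density_outside[of u]
      by (cases "u \<in> {-3..3}") (auto simp: indicator_def)
  qed
  also have "\<dots> = integral {-3..a} semicircle_density"
    by (intro set_borel_integral_eq_integral(2) borel_integrable_atLeastAtMost' continuous_semicircle_density)
  finally show ?thesis .
qed

lemma semicircle_cdf_left: "x < -3 \<Longrightarrow> semicircle_cdf x = 0"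
proof -
  assume "x < -3"
  then have "(\<lambda>u. indicator {..x} u *\<^sub>R semicircle_density u) = (\<lambda>_. 0)"
    using semicircle_density_outside by (auto simp: indicator_def fun_eq_iff)
  then show "semicircle_cdf x = 0"
    unfolding semicircle_cdf_def set_lebesgue_integral_def by (simp only: Bochner_Integration.integral_zero)
qed

section \<open>Cauchy smoothing and the Levy distance\<close>

text \<open>Distribution function of the Cauchy law with scale \<open>\<eta>\<close>, whose density is the Poisson kernel.\<close>

definition cauchy_cdf :: "real \<Rightarrow> real \<Rightarrow> real" where
  "cauchy_cdf \<eta> u = 1 / 2 + arctan (u / \<eta>) / pi"

lemma cauchy_cdf_mono: "0 < \<eta> \<Longrightarrow> u \<le> v \<Longrightarrow> cauchy_cdf \<eta> u \<le> cauchy_cdf \<eta> v"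
  by (simp add: cauchy_cdf_def divide_right_mono arctan_monotone')

lemma cauchy_cdf_range: "0 \<le> cauchy_cdf \<eta> u" "cauchy_cdf \<eta> u \<le> 1"
  using arctan_lbound[of "u / \<eta>"] arctan_ubound[of "u / \<eta>"] pi_gt_zero
  by (auto simp: cauchy_cdf_def field_simps)

lemma cauchy_cdf_minus: "cauchy_cdf \<eta> (- u) = 1 - cauchy_cdf \<eta> u"
  by (simp add: cauchy_cdf_def arctan_minus field_simps)

definition ecdf :: "real list \<Rightarrow> real \<Rightarrow> real" where
  "ecdf ls t = (\<Sum>l\<leftarrow>ls. of_bool (l \<le> t)) / real (length ls)"

definition smooth_ecdf :: "real \<Rightarrow> real list \<Rightarrow> real \<Rightarrow> real" where
  "smooth_ecdf \<eta> ls t = (\<Sum>l\<leftarrow>ls. cauchy_cdf \<eta> (t - l)) / real (length ls)"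

definition list_stieltjes :: "real list \<Rightarrow> complex \<Rightarrow> complex" where
  "list_stieltjes ls z = (\<Sum>l\<leftarrow>ls. 1 / (of_real l - z)) / of_nat (length ls)"

lemma smooth_ecdf_mono: "0 < \<eta> \<Longrightarrow> u \<le> v \<Longrightarrow> smooth_ecdf \<eta> ls u \<le> smooth_ecdf \<eta> ls v"
  unfolding smooth_ecdf_def by (intro divide_right_mono sum_list_mono cauchy_cdf_mono) auto

lemma smooth_ecdf_range:
  assumes "ls \<noteq> []" shows "0 \<le> smooth_ecdf \<eta> ls u" "smooth_ecdf \<eta> ls u \<le> 1"
proof -
  have "(\<Sum>l\<leftarrow>ls. cauchy_cdf \<eta> (u - l)) \<le> (\<Sum>l\<leftarrow>ls. 1)" "(\<Sum>l\<leftarrow>ls. 0) \<le> (\<Sum>l\<leftarrow>ls. cauchy_cdf \<eta> (u - l))"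
    by (intro sum_list_mono cauchy_cdf_range)+
  then show "0 \<le> smooth_ecdf \<eta> ls u" "smooth_ecdf \<eta> ls u \<le> 1"
    using assms by (auto simp: smooth_ecdf_def sum_list_triv divide_le_eq)
qed

text \<open>A shift by \<open>\<delta>\<close> absorbs the smoothing except for the mass \<open>\<kappa>\<close> that the Cauchy law puts beyond \<open>\<delta>\<close>.\<close>

lemma ecdf_smooth_ecdf:
  assumes eta: "0 < \<eta>" and d: "0 < \<delta>" and ls: "ls \<noteq> []"
  defines "\<kappa> \<equiv> 1 - cauchy_cdf \<eta> \<delta>"
  shows "ecdf ls (x - \<delta>) - \<kappa> \<le> smooth_ecdf \<eta> ls x" "smooth_ecdf \<eta> ls x \<le> ecdf ls (x + \<delta>) + \<kappa>"
proof -
  have n: "0 < real (length ls)" using ls by simp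
  have k: "0 \<le> \<kappa>" using cauchy_cdf_range by (simp add: \<kappa>_def)
  have "(\<Sum>l\<leftarrow>ls. of_bool (l \<le> x - \<delta>) - \<kappa>) \<le> (\<Sum>l\<leftarrow>ls. cauchy_cdf \<eta> (x - l))"
  proof (rule sum_list_mono)
    fix l show "of_bool (l \<le> x - \<delta>) - \<kappa> \<le> cauchy_cdf \<eta> (x - l)"
      using cauchy_cdf_mono[OF eta, of \<delta> "x - l"] cauchy_cdf_range[of \<eta> "x - l"] k by (auto simp: \<kappa>_def)
  qed
  then have "(\<Sum>l\<leftarrow>ls. of_bool (l \<le> x - \<delta>)) - real (length ls) * \<kappa> \<le> (\<Sum>l\<leftarrow>ls. cauchy_cdf \<eta> (x - l))"
    by (simp add: sum_list_subtractf sum_list_triv)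
  from divide_right_mono[OF this less_imp_le[OF n]]
  show "ecdf ls (x - \<delta>) - \<kappa> \<le> smooth_ecdf \<eta> ls x"
    using n by (simp add: ecdf_def smooth_ecdf_def diff_divide_distrib)
  have "(\<Sum>l\<leftarrow>ls. cauchy_cdf \<eta> (x - l)) \<le> (\<Sum>l\<leftarrow>ls. of_bool (l \<le> x + \<delta>) + \<kappa>)"
  proof (rule sum_list_mono)
    fix l show "cauchy_cdf \<eta> (x - l) \<le> of_bool (l \<le> x + \<delta>) + \<kappa>"
      using cauchy_cdf_mono[OF eta, of "x - l" "- \<delta>"] cauchy_cdf_range[of \<eta> "x - l"] k
      by (auto simp: \<kappa>_def cauchy_cdf_minus)
  qed
  then have "(\<Sum>l\<leftarrow>ls. cauchy_cdf \<eta> (x - l)) \<le> (\<Sum>l\<leftarrow>ls. of_bool (l \<le> x + \<delta>)) + real (length ls) * \<kappa>"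
    by (simp add: sum_list_addf sum_list_triv)
  from divide_right_mono[OF this less_imp_le[OF n]]
  show "smooth_ecdf \<eta> ls x \<le> ecdf ls (x + \<delta>) + \<kappa>"
    using n by (simp add: ecdf_def smooth_ecdf_def add_divide_distrib)
qed

text \<open>The imaginary part of \<open>1 / (l - E - i \<eta>)\<close> is \<open>\<pi>\<close> times the Cauchy density centred at \<open>l\<close>.\<close>

lemma smooth_ecdf_derivative:
  assumes eta: "0 < \<eta>"
  shows "(smooth_ecdf \<eta> ls has_real_derivative Im (list_stieltjes ls (Complex E \<eta>)) / pi) (at E within S)"
proof -
  let ?h = "\<lambda>l. Im (1 / (of_real l - Complex E \<eta>))"
  have one: "((\<lambda>E. cauchy_cdf \<eta> (E - l)) has_real_derivative ?h l / pi) (at E within S)" for l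
  proof -
    have "?h l = \<eta> / ((l - E)^2 + \<eta>^2)"
      by (simp add: Im_divide)
    also have "\<dots> = inverse (1 + ((E - l) / \<eta>)^2) * (1 / \<eta>)"
      using eta by (simp add: field_simps power2_eq_square)
    finally have e: "?h l = inverse (1 + ((E - l) / \<eta>)^2) * (1 / \<eta>)" .
    have "((\<lambda>E. arctan ((E - l) / \<eta>)) has_real_derivative inverse (1 + ((E - l) / \<eta>)^2) * (1 / \<eta>)) (at E within S)"
      using eta by (intro DERIV_chain2[OF DERIV_arctan]) (auto intro!: derivative_eq_intros)
    from DERIV_add[OF DERIV_const[of "1 / 2"] DERIV_cdivide[OF this, of pi]]
    show ?thesis unfolding e cauchy_cdf_def by simp
  qed
  have "((\<lambda>E. \<Sum>l\<leftarrow>ls. cauchy_cdf \<eta> (E - l)) has_real_derivative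
      (\<Sum>l\<leftarrow>ls. ?h l / pi)) (at E within S)"
    by (induction ls) (auto intro!: DERIV_add one simp del: complex_of_real_def)
  then have "(smooth_ecdf \<eta> ls has_real_derivative
      (\<Sum>l\<leftarrow>ls. ?h l / pi) / real (length ls)) (at E within S)"
    unfolding smooth_ecdf_def by (rule DERIV_cdivide)
  moreover have "Im (list_stieltjes ls w) / pi = (\<Sum>l\<leftarrow>ls. Im (1 / (of_real l - w)) / pi) / real (length ls)" for w
  proof -
    have im: "Im (\<Sum>l\<leftarrow>ls. 1 / (of_real l - w)) / pi = (\<Sum>l\<leftarrow>ls. Im (1 / (of_real l - w)) / pi)"
      by (induction ls) (auto simp: add_divide_distrib)
    moreover have "Im (u / of_nat m) = Im u / real m" for u m
      by (metis Im_divide_of_real of_real_of_nat_eq)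
    ultimately have "Im (list_stieltjes ls w) = Im (\<Sum>l\<leftarrow>ls. 1 / (of_real l - w)) / real (length ls)"
      by (simp only: list_stieltjes_def)
    then have "Im (list_stieltjes ls w) / pi = Im (\<Sum>l\<leftarrow>ls. 1 / (of_real l - w)) / pi / real (length ls)"
      by simp
    then show ?thesis by (simp only: im)
  qed
  ultimately show ?thesis by simp
qed

lemma list_stieltjes_bound:
  assumes "ls \<noteq> []" "0 < Im z" "Im z = Im w"
  shows "cmod (list_stieltjes ls z - list_stieltjes ls w) \<le> cmod (z - w) / (Im z)^2"
proof -
  have one: "cmod (1 / (of_real l - z) - 1 / (of_real l - w)) \<le> cmod (z - w) / (Im z)^2" for l
  proof -
    have nz: "Im z \<le> cmod (complex_of_real l - z)" "Im z \<le> cmod (complex_of_real l - w)"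
      using abs_Im_le_cmod[of "complex_of_real l - z"] abs_Im_le_cmod[of "complex_of_real l - w"] assms by auto
    then have "complex_of_real l - z \<noteq> 0" "complex_of_real l - w \<noteq> 0" using assms(2) by auto
    then have "1 / (of_real l - z) - 1 / (of_real l - w) = (z - w) / ((complex_of_real l - z) * (complex_of_real l - w))"
      by (simp add: field_simps)
    then have "cmod (1 / (of_real l - z) - 1 / (of_real l - w)) =
        cmod (z - w) / (cmod (complex_of_real l - z) * cmod (complex_of_real l - w))"
      by (simp add: norm_divide norm_mult)
    also have "\<dots> \<le> cmod (z - w) / (Im z * Im z)"
      using nz assms(2) by (intro divide_left_mono mult_mono mult_pos_pos) auto
    finally show ?thesis by (simp add: power2_eq_square)
  qed
  let ?u = "\<lambda>z l. 1 / (of_real l - z)"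
  have "cmod ((\<Sum>l\<leftarrow>ls. ?u z l) - (\<Sum>l\<leftarrow>ls. ?u w l)) \<le> real (length ls) * (cmod (z - w) / (Im z)^2)"
  proof (induction ls)
    case (Cons l ls)
    have "(?u z l + (\<Sum>l\<leftarrow>ls. ?u z l)) - (?u w l + (\<Sum>l\<leftarrow>ls. ?u w l)) =
       (?u z l - ?u w l) + ((\<Sum>l\<leftarrow>ls. ?u z l) - (\<Sum>l\<leftarrow>ls. ?u w l))"
      by simp
    also have "cmod \<dots> \<le> cmod (z - w) / (Im z)^2 + real (length ls) * (cmod (z - w) / (Im z)^2)"
      by (intro order_trans[OF norm_triangle_ineq] add_mono one Cons.IH)
    finally show ?case by (simp add: distrib_right add_divide_distrib)
  qed simp
  then show ?thesis using assms(1)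
    by (simp add: list_stieltjes_def diff_divide_distrib[symmetric] norm_divide divide_le_eq mult.commute)
qed

lemma list_stieltjes_Im_nonneg:
  assumes "0 < Im z" shows "0 \<le> Im (list_stieltjes ls z)"
proof -
  have "0 \<le> Im (\<Sum>l\<leftarrow>ls. 1 / (of_real l - z))"
    using assms by (induction ls) (auto simp: Im_divide intro!: add_nonneg_nonneg divide_nonneg_nonneg)
  moreover have "Im (u / of_nat m) = Im u / real m" for u m
    by (metis Im_divide_of_real of_real_of_nat_eq)
  ultimately show ?thesis by (simp add: list_stieltjes_def)
qed

text \<open>Integrating the bound on the densities over an interval of length 6 gives an error of at most \<open>6 \<theta>\<close>
  for increments on \<open>[-3, 3]\<close>. As the semicircle law has mass 1 there, the smoothed spectral
  distribution has mass at most \<open>6 \<theta>\<close> to the left of \<open>-3\<close>, and the distribution functions differ by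
  at most \<open>12 \<theta>\<close> everywhere.\<close>

lemma levy_dist_le:
  assumes ls: "ls \<noteq> []" and eta: "0 < \<eta>" and eps: "0 < \<epsilon>" and th: "0 \<le> \<theta>"
    and close: "\<And>E. -3 \<le> E \<Longrightarrow> E \<le> 3 \<Longrightarrow> \<bar>Im (list_stieltjes ls (Complex E \<eta>)) / pi - semicircle_density E\<bar> \<le> \<theta>"
    and small: "(1 - cauchy_cdf \<eta> \<epsilon>) + 12 * \<theta> \<le> \<epsilon>"
  shows "levy_dist (ecdf ls) semicircle_cdf \<le> \<epsilon>"
proof -
  let ?H = "smooth_ecdf \<eta> ls" and ?G = semicircle_cdf and ?g = semicircle_density
  define p where "p = (\<lambda>E. Im (list_stieltjes ls (Complex E \<eta>)) / pi)"
  have incr: "\<bar>(?H x - ?H (-3)) - integral {-3..x} ?g\<bar> \<le> 6 * \<theta>" if x: "-3 \<le> x" "x \<le> 3" for x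
  proof -
    have hp: "(p has_integral (?H x - ?H (-3))) {-3..x}"
      unfolding p_def using x(1) smooth_ecdf_derivative[OF eta]
      by (intro fundamental_theorem_of_calculus) (auto simp: has_real_derivative_iff_has_vector_derivative)
    have hg: "(?g has_integral integral {-3..x} ?g) {-3..x}"
      by (intro integrable_integral integrable_continuous_real continuous_semicircle_density)
    have "((\<lambda>E. p E - ?g E) has_integral (?H x - ?H (-3)) - integral {-3..x} ?g) (cbox (-3) x)"
      using has_integral_diff[OF hp hg] by simp
    then have "norm ((?H x - ?H (-3)) - integral {-3..x} ?g) \<le> \<theta> * measure lborel (cbox (-3) x)"
      by (rule has_integral_bound[OF th]) (use close x in \<open>auto simp: p_def\<close>)
    also have "\<dots> \<le> \<theta> * 6" using th x by (intro mult_left_mono) auto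
    finally show ?thesis by simp
  qed
  have H: "0 \<le> ?H x" "?H x \<le> 1" for x using smooth_ecdf_range[OF ls] by auto
  have left: "?H (-3) \<le> 6 * \<theta>" using incr[of 3] H[of 3] semicircle_total by simp
  have unif: "\<bar>?H x - ?G x\<bar> \<le> 12 * \<theta>" for x
  proof -
    consider "x < -3" | "-3 \<le> x" "x \<le> 3" | "3 < x" by linarith
    then show ?thesis
    proof cases
      case 1
      then show ?thesis using smooth_ecdf_mono[OF eta, of x "-3" ls] left H[of x] th
        by (simp add: semicircle_cdf_left)
    next
      case 2
      then have "?G x = integral {-3..x} ?g" by (intro semicircle_cdf_eq_integral) auto
      then show ?thesis using incr[OF 2] left H[of "-3"] by simp
    next
      case 3
      then have "?G x = integral {-3..3} ?g" by (intro semicircle_cdf_eq_integral) auto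
      then show ?thesis using smooth_ecdf_mono[OF eta, of 3 x ls] incr[of 3] H[of x] H[of "-3"] semicircle_total 3 th
        by simp
    qed
  qed
  have "\<epsilon> \<in> {\<epsilon>. \<epsilon> > 0 \<and> (\<forall>x. ecdf ls (x - \<epsilon>) - \<epsilon> \<le> ?G x \<and> ?G x \<le> ecdf ls (x + \<epsilon>) + \<epsilon>)}"
  proof (intro CollectI conjI allI eps)
    fix x
    show "ecdf ls (x - \<epsilon>) - \<epsilon> \<le> ?G x" "?G x \<le> ecdf ls (x + \<epsilon>) + \<epsilon>"
      using ecdf_smooth_ecdf[OF eta eps ls, of x] unif[of x] small by linarith+
  qed
  then show ?thesis unfolding levy_dist_def by (intro cInf_lower bdd_belowI[of _ 0]) auto
qed

section \<open>Roots of the semicircle equation\<close>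

text \<open>The product of the two roots is 1, so their imaginary parts have opposite signs, and their sum \<open>-z\<close>
  is not real, so one of them lies above the real axis. A point \<open>w\<close> of the closed upper half plane
  stays away from the other root, and there the defect controls its distance to the first.\<close>

lemma defect_root:
  assumes z: "0 < Im z"
  obtains s where "0 < Im s" "\<And>w. 0 \<le> Im w \<Longrightarrow> Im s * cmod (w - s) \<le> (cmod s)^2 * cmod (defect z w)" "defect z s = 0"
proof -
  note root = that
  define r where "r = csqrt (z^2 - 4)"
  have r2: "r^2 = z^2 - 4" by (simp add: r_def)
  define s1 s2 where "s1 = (- z + r) / 2" "s2 = (- z - r) / 2"
  have sum: "s1 + s2 = - z" by (simp add: s1_s2_def field_simps)
  have prod: "s1 * s2 = 1"
  proof -
    have "s1 * s2 = (z^2 - r^2) / 4" by (simp add: s1_s2_def power2_eq_square field_simps)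
    then show ?thesis by (simp add: r2)
  qed
  have fac: "defect z w = (w - s1) * (w - s2)" for w
  proof -
    have "(w - s1) * (w - s2) = w^2 - (s1 + s2) * w + s1 * s2" by (simp add: power2_eq_square algebra_simps)
    then show ?thesis by (simp add: sum prod defect_def algebra_simps)
  qed
  have main: thesis if st: "s * t = 1" "s + t = - z" "0 < Im s" "\<And>w. defect z w = (w - s) * (w - t)" for s t
  proof (rule root[of s])
    show "0 < Im s" by fact
    show "defect z s = 0" using st(4) by simp
    fix w assume w: "0 \<le> Im w"
    have s0: "s \<noteq> 0" using st(1) by auto
    then have "t = cnj s / of_real ((cmod s)^2)"
      using st(1) by (simp add: complex_norm_square field_simps del: of_real_power)
    then have "Im t = - Im s / (cmod s)^2" by (simp del: of_real_power)
    then have "Im s / (cmod s)^2 \<le> Im (w - t)" using w by simp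
    also have "\<dots> \<le> cmod (w - t)" using abs_Im_le_cmod[of "w - t"] by simp
    finally have "Im s \<le> (cmod s)^2 * cmod (w - t)" using s0 by (simp add: divide_le_eq mult.commute)
    then have "Im s * cmod (w - s) \<le> (cmod s)^2 * cmod (w - t) * cmod (w - s)" by (rule mult_right_mono) simp
    then show "Im s * cmod (w - s) \<le> (cmod s)^2 * cmod (defect z w)"
      unfolding st(4) norm_mult by (simp add: mult_ac)
  qed
  have "Im s1 + Im s2 < 0" using arg_cong[OF sum, of Im] z by simp
  have im: "0 < Im s1 \<or> 0 < Im s2"
  proof (rule ccontr)
    assume "\<not> ?thesis"
    then have le: "Im s1 \<le> 0" "Im s2 \<le> 0" by auto
    have s0: "s1 \<noteq> 0" using prod by auto
    then have "s2 = cnj s1 / of_real ((cmod s1)^2)"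
      using prod by (simp add: complex_norm_square field_simps del: of_real_power)
    then have "Im s2 = - Im s1 / (cmod s1)^2" by (simp del: of_real_power)
    then have "Im s1 = 0 \<and> Im s2 = 0" using le s0
      by (cases "Im s1 = 0") (auto simp: divide_le_0_iff zero_le_divide_iff)
    then show False using \<open>Im s1 + Im s2 < 0\<close> by simp
  qed
  show thesis
    using im
  proof
    assume "0 < Im s1" then show thesis using main[of s1 s2] prod sum fac by blast
  next
    assume "0 < Im s2"
    then show thesis using main[of s2 s1] prod sum fac by (simp add: mult.commute add.commute)
  qed
qed

text \<open>Completing the square, \<open>w = 2 s + z\<close> satisfies \<open>w\<^sup>2 = z\<^sup>2 - 4\<close>, which differs little from the real
  number \<open>E\<^sup>2 - 4\<close>. Hence \<open>w\<close> is close to one of the square roots of the latter.\<close>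

lemma root_near_density:
  assumes s: "0 < Im s" "defect (Complex E \<eta>) s = 0" and eta: "0 < \<eta>"
  shows "\<bar>2 * Im s + \<eta> - sqrt (max 0 (4 - E^2))\<bar> \<le> sqrt (\<eta> * (2 * \<bar>E\<bar> + \<eta>))"
proof -
  define z where "z = Complex E \<eta>"
  define w where "w = 2 * s + z"
  have "w^2 - (z^2 - 4) = 4 * defect z s"
    by (simp add: w_def defect_def power2_eq_square algebra_simps)
  then have w2: "w^2 = z^2 - 4" using s(2) by (simp add: z_def)
  have Imw: "Im w = 2 * Im s + \<eta>" by (simp add: w_def z_def)
  then have Imw0: "0 < Im w" using s eta by simp
  define e where "e = cmod (z^2 - of_real (E^2))"
  have "z^2 - of_real (E^2) = Complex (- (\<eta>^2)) (2 * E * \<eta>)"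
    by (simp add: z_def complex_eq_iff power2_eq_square)
  then have "e \<le> \<bar>- (\<eta>^2)\<bar> + \<bar>2 * E * \<eta>\<bar>"
    using cmod_le[of "z^2 - of_real (E^2)"] by (simp only: e_def complex.sel)
  also have "\<dots> = \<eta> * (2 * \<bar>E\<bar> + \<eta>)" using eta by (simp add: abs_mult power2_eq_square algebra_simps)
  finally have e: "e \<le> \<eta> * (2 * \<bar>E\<bar> + \<eta>)" .
  show ?thesis
  proof (cases "E^2 \<le> 4")
    case True
    define D where "D = sqrt (4 - E^2)"
    have D: "0 \<le> D" "D^2 = 4 - E^2" using True by (auto simp: D_def)
    have "(w - Complex 0 D) * (w + Complex 0 D) = w^2 + of_real (D^2)"
      by (simp add: complex_eq_iff power2_eq_square algebra_simps)
    also have "\<dots> = z^2 - of_real (E^2)" by (simp add: w2 D(2))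
    finally have "cmod (w - Complex 0 D) * cmod (w + Complex 0 D) = e"
      by (simp add: e_def norm_mult[symmetric])
    moreover have "\<bar>Im w - D\<bar> \<le> cmod (w - Complex 0 D)" using abs_Im_le_cmod[of "w - Complex 0 D"] by simp
    moreover have "\<bar>Im w - D\<bar> \<le> cmod (w + Complex 0 D)"
      using abs_Im_le_cmod[of "w + Complex 0 D"] Imw0 D(1) by simp
    ultimately have "\<bar>Im w - D\<bar> * \<bar>Im w - D\<bar> \<le> e" by (metis abs_ge_zero mult_mono norm_ge_zero)
    then have "\<bar>Im w - D\<bar> \<le> sqrt (\<eta> * (2 * \<bar>E\<bar> + \<eta>))" using e by (intro real_le_rsqrt) (simp add: power2_eq_square)
    then show ?thesis using True by (simp add: Imw D_def)
  next
    case False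
    define D where "D = sqrt (E^2 - 4)"
    have D: "D^2 = E^2 - 4" using False by (auto simp: D_def)
    have "(w - of_real D) * (w + of_real D) = w^2 - of_real (D^2)"
      by (simp add: power2_eq_square algebra_simps)
    also have "\<dots> = z^2 - of_real (E^2)" by (simp add: w2 D)
    finally have "cmod (w - of_real D) * cmod (w + of_real D) = e"
      by (simp add: e_def norm_mult[symmetric])
    moreover have "\<bar>Im w\<bar> \<le> cmod (w - of_real D)" "\<bar>Im w\<bar> \<le> cmod (w + of_real D)"
      using abs_Im_le_cmod[of "w - of_real D"] abs_Im_le_cmod[of "w + of_real D"] by simp_all
    ultimately have "\<bar>Im w\<bar> * \<bar>Im w\<bar> \<le> e" by (metis abs_ge_zero mult_mono norm_ge_zero)
    then have "\<bar>Im w\<bar> \<le> sqrt (\<eta> * (2 * \<bar>E\<bar> + \<eta>))" using e by (intro real_le_rsqrt) (simp add: power2_eq_square)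
    then show ?thesis using False by (simp add: Imw)
  qed
qed

section \<open>Convergence in probability of the spectral distribution\<close>

lemma tri_avg_eq:
  "tri_avg n f = (\<Sum>p\<in>tri n. f (int (fst p) + 1) (int (snd p) + 1)) / (real n)^2"
proof -
  have "(\<Sum>i = 1..int n. \<Sum>j = 1..i. f i j) = (\<Sum>p\<in>(SIGMA i:{1..int n}. {1..i}). f (fst p) (snd p))"
    by (subst sum.Sigma) (auto simp: case_prod_beta)
  also have "\<dots> = (\<Sum>p\<in>tri n. f (int (fst p) + 1) (int (snd p) + 1))"
    by (rule sum.reindex_bij_witness[where i = "\<lambda>p. (int (fst p) + 1, int (snd p) + 1)"
          and j = "\<lambda>p. (nat (fst p - 1), nat (snd p - 1))"]) (auto simp: tri_def)
  finally show ?thesis by (simp add: tri_avg_def)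
qed

lemma subalgebra_past_sigma:
  assumes "\<And>i j. X i j \<in> borel_measurable M"
  shows "subalgebra M (past_sigma M X a i j)"
proof -
  let ?S = "{X u v -` A \<inter> space M | u v A. (u, v) \<in> past_set a i j \<and> v \<le> u \<and> A \<in> sets borel}"
  have "?S \<subseteq> sets M" using assms by (auto intro: measurable_sets)
  then have "sigma_sets (space M) ?S \<subseteq> sets M" by (rule sets.sigma_sets_subset)
  moreover have "?S \<subseteq> Pow (space M)" by auto
  ultimately show ?thesis by (simp add: subalgebra_def past_sigma_def)
qed

lemma past_sigma_measurable:
  assumes "(u, v) \<in> past_set a i j" "v \<le> u"
  shows "X u v \<in> borel_measurable (past_sigma M X a i j)"
proof (rule measurableI)
  let ?S = "{X u v -` A \<inter> space M | u v A. (u, v) \<in> past_set a i j \<and> v \<le> u \<and> A \<in> sets borel}"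
  have S: "?S \<subseteq> Pow (space M)" by auto
  fix A :: "real set" assume "A \<in> sets borel"
  then have "X u v -` A \<inter> space M \<in> ?S" using assms by blast
  then show "X u v -` A \<inter> space (past_sigma M X a i j) \<in> sets (past_sigma M X a i j)"
    using S by (simp add: past_sigma_def)
qed simp

text \<open>The distance \<open>\<epsilon>\<close> is shared out: a quarter to the tail of the Cauchy law, and to each of the four
  sources of error in the density (\<open>finite_test_points\<close>) the part \<open>\<epsilon> / 96\<close>, because
  \<open>levy_dist_le\<close> multiplies their sum by 12.\<close>

lemma small_scale_exists:
  assumes "0 < \<epsilon>"
  obtains \<eta> where "0 < \<eta>" "\<eta> \<le> 1" "1 - cauchy_cdf \<eta> \<epsilon> \<le> \<epsilon> / 4" "sqrt (7 * \<eta>) + \<eta> \<le> \<epsilon> / 96"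
proof -
  have "((\<lambda>\<eta>. 1 - cauchy_cdf \<eta> \<epsilon>) \<longlongrightarrow> 0) (at_right 0)"
    unfolding cauchy_cdf_def using assms by real_asymp
  then have 1: "\<forall>\<^sub>F \<eta> in at_right 0. 1 - cauchy_cdf \<eta> \<epsilon> < \<epsilon> / 4"
    using assms by (intro order_tendstoD(2)) auto
  have "((\<lambda>\<eta>. sqrt (7 * \<eta>) + \<eta>) \<longlongrightarrow> 0) (at_right (0::real))" by real_asymp
  then have 2: "\<forall>\<^sub>F \<eta> in at_right 0. sqrt (7 * \<eta>) + \<eta> < \<epsilon> / 96"
    using assms by (intro order_tendstoD(2)) auto
  have 3: "\<forall>\<^sub>F \<eta> in at_right (0::real). \<eta> \<in> {0<..<1}" by (rule eventually_at_right_real) simp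
  have "\<forall>\<^sub>F \<eta> in at_right 0. 0 < \<eta> \<and> \<eta> \<le> 1 \<and> 1 - cauchy_cdf \<eta> \<epsilon> \<le> \<epsilon> / 4 \<and> sqrt (7 * \<eta>) + \<eta> \<le> \<epsilon> / 96"
    using 1 2 3 by eventually_elim auto
  then obtain \<eta> where "0 < \<eta> \<and> \<eta> \<le> 1 \<and> 1 - cauchy_cdf \<eta> \<epsilon> \<le> \<epsilon> / 4 \<and> sqrt (7 * \<eta>) + \<eta> \<le> \<epsilon> / 96"
    using eventually_happens[of _ "at_right (0::real)"] by auto
  then show ?thesis using that by blast
qed

text \<open>At distance \<open>\<eta>\<close> from the real axis every Stieltjes transform is Lipschitz with constant \<open>1 / \<eta>\<^sup>2\<close>,
  whatever the distribution. So a finite net of points, chosen before the matrix, suffices to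
  control the density on the whole interval.\<close>

lemma finite_test_points:
  assumes e: "0 < \<epsilon>" and eta: "0 < \<eta>" "\<eta> \<le> 1" and small: "sqrt (7 * \<eta>) + \<eta> \<le> \<epsilon> / 96"
  obtains T where "finite T"
    "\<And>ls s E. ls \<noteq> [] \<Longrightarrow> (\<And>E. E \<in> T \<Longrightarrow> 0 < Im (s E) \<and> defect (Complex E \<eta>) (s E) = 0 \<and>
        cmod (list_stieltjes ls (Complex E \<eta>) - s E) < \<epsilon> / 96) \<Longrightarrow> -3 \<le> E \<Longrightarrow> E \<le> 3 \<Longrightarrow>
      \<bar>Im (list_stieltjes ls (Complex E \<eta>)) / pi - semicircle_density E\<bar> \<le> \<epsilon> / 24"
proof -
  have "uniformly_continuous_on {-3..3::real} semicircle_density"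
    by (intro compact_uniformly_continuous continuous_semicircle_density) simp
  then obtain d where d: "0 < d" "\<And>x y. x \<in> {-3..3} \<Longrightarrow> y \<in> {-3..3} \<Longrightarrow> dist y x < d \<Longrightarrow>
      dist (semicircle_density y) (semicircle_density x) < \<epsilon> / 96"
    using e unfolding uniformly_continuous_on_def by (metis divide_pos_pos zero_less_numeral)
  define h where "h = min d (\<eta>^2 * (\<epsilon> / 96))"
  have h: "0 < h" using d(1) e eta by (simp add: h_def)
  obtain T where T: "finite T" "T \<subseteq> {-3..3::real}" "{-3..3} \<subseteq> (\<Union>x\<in>T. ball x h)"
    using seq_compact_imp_totally_bounded[of "{-3..3::real}"] h compact_Icc compact_imp_seq_compact by metis
  show ?thesis
  proof (rule that[OF T(1)])
    fix ls :: "real list" and s :: "real \<Rightarrow> complex" and E :: real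
    assume ls: "ls \<noteq> []" and s: "\<And>E. E \<in> T \<Longrightarrow> 0 < Im (s E) \<and> defect (Complex E \<eta>) (s E) = 0 \<and>
        cmod (list_stieltjes ls (Complex E \<eta>) - s E) < \<epsilon> / 96" and E: "-3 \<le> E" "E \<le> 3"
    let ?S = "\<lambda>E. list_stieltjes ls (Complex E \<eta>)" and ?g = semicircle_density
    obtain t where t: "t \<in> T" "dist t E < h" using T(3) E by (auto simp: subset_iff)
    have tE: "\<bar>E - t\<bar> < h" using t(2) by (simp add: dist_real_def)
    have t3: "-3 \<le> t" "t \<le> 3" using T(2) t(1) by auto
    have pi1: "\<bar>x / pi\<bar> \<le> \<bar>x\<bar>" for x
      using pi_ge_two by (simp add: divide_le_eq mult_le_cancel_left1)
    have "cmod (?S E - ?S t) \<le> cmod (Complex E \<eta> - Complex t \<eta>) / \<eta>^2"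
      using list_stieltjes_bound[OF ls, of "Complex E \<eta>" "Complex t \<eta>"] eta by simp
    also have "cmod (Complex E \<eta> - Complex t \<eta>) = \<bar>E - t\<bar>" by (simp add: cmod_def)
    also have "\<bar>E - t\<bar> / \<eta>^2 \<le> \<epsilon> / 96" using tE eta by (simp add: h_def divide_le_eq mult.commute)
    finally have "\<bar>Im (?S E - ?S t)\<bar> \<le> \<epsilon> / 96" using abs_Im_le_cmod order_trans by blast
    then have 1: "\<bar>(Im (?S E) - Im (?S t)) / pi\<bar> \<le> \<epsilon> / 96" using pi1 order_trans by (metis minus_complex.simps(2))
    have "\<bar>Im (?S t - s t)\<bar> \<le> \<epsilon> / 96" using abs_Im_le_cmod[of "?S t - s t"] s[OF t(1)] by linarith
    then have 2: "\<bar>(Im (?S t) - Im (s t)) / pi\<bar> \<le> \<epsilon> / 96" using pi1 order_trans by (metis minus_complex.simps(2))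
    have "\<bar>2 * Im (s t) + \<eta> - sqrt (max 0 (4 - t^2))\<bar> \<le> sqrt (\<eta> * (2 * \<bar>t\<bar> + \<eta>))"
      using root_near_density s[OF t(1)] eta(1) by blast
    also have "\<dots> \<le> sqrt (\<eta> * 7)" using t3 eta by (intro real_sqrt_le_mono mult_left_mono) auto
    also have "\<dots> = sqrt (7 * \<eta>)" by (simp add: mult.commute)
    finally have "\<bar>Im (s t) - sqrt (max 0 (4 - t^2)) / 2\<bar> \<le> \<epsilon> / 96"
      using small eta e by linarith
    then have "\<bar>(Im (s t) - sqrt (max 0 (4 - t^2)) / 2) / pi\<bar> \<le> \<epsilon> / 96" using pi1 order_trans by blast
    then have 3: "\<bar>Im (s t) / pi - ?g t\<bar> \<le> \<epsilon> / 96"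
      by (simp add: semicircle_density_eq diff_divide_distrib)
    have 4: "\<bar>?g t - ?g E\<bar> \<le> \<epsilon> / 96"
      using d(2)[of E t] E t3 t(2) by (simp add: h_def dist_real_def)
    have "Im (?S E) / pi - ?g E = (Im (?S E) - Im (?S t)) / pi + (Im (?S t) - Im (s t)) / pi + (Im (s t) / pi - ?g t) + (?g t - ?g E)"
      by (simp add: diff_divide_distrib)
    then show "\<bar>Im (?S E) / pi - ?g E\<bar> \<le> \<epsilon> / 24" using 1 2 3 4 by linarith
  qed
qed

text \<open>Markov's inequality for the squared defect, combined with the stability of the root.\<close>

lemma stieltjes_tendsto_in_prob:
  fixes Y :: "'a \<Rightarrow> nat \<times> nat \<Rightarrow> real"
  assumes "prob_space M" and Y: "\<And>p. (\<lambda>\<omega>. Y \<omega> p) \<in> borel_measurable M"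
    and z: "0 < Im z" and s: "0 < Im s" "\<And>w. 0 \<le> Im w \<Longrightarrow> Im s * cmod (w - s) \<le> (cmod s)^2 * cmod (defect z w)"
    and nonneg: "\<And>n \<omega>. 0 \<le> Im (stieltjes z n (Y \<omega>))"
    and int: "\<And>n. integrable M (\<lambda>\<omega>. sq_defect z n (Y \<omega>))"
    and lim: "(\<lambda>n. \<integral>\<omega>. sq_defect z n (Y \<omega>) \<partial>M) \<longlonglongrightarrow> 0" and r: "0 < \<rho>"
  shows "(\<lambda>n. measure M {\<omega> \<in> space M. \<rho> \<le> cmod (stieltjes z n (Y \<omega>) - s)}) \<longlonglongrightarrow> 0"
proof -
  let ?A = "\<lambda>n. {\<omega> \<in> space M. \<rho> \<le> cmod (stieltjes z n (Y \<omega>) - s)}" and ?I = "\<lambda>n. \<integral>\<omega>. sq_defect z n (Y \<omega>) \<partial>M"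
  interpret prob_space M by fact
  have s0: "0 < cmod s" using s(1) by auto
  define c where "c = (Im s * \<rho> / (cmod s)^2)^2"
  have c: "0 < c" using s s0 r by (simp add: c_def)
  have markov: "measure M (?A n) \<le> ?I n / c" for n
  proof -
    have "(?A n) \<subseteq> {\<omega> \<in> space M. c \<le> sq_defect z n (Y \<omega>)}"
    proof safe
      fix \<omega> assume "\<rho> \<le> cmod (stieltjes z n (Y \<omega>) - s)"
      then have "Im s * \<rho> \<le> Im s * cmod (stieltjes z n (Y \<omega>) - s)" using s by (intro mult_left_mono) auto
      also have "\<dots> \<le> (cmod s)^2 * cmod (defect z (stieltjes z n (Y \<omega>)))" by (rule s(2)[OF nonneg])
      finally have "Im s * \<rho> / (cmod s)^2 \<le> cmod (defect z (stieltjes z n (Y \<omega>)))"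
        using s0 by (simp add: divide_le_eq mult.commute)
      then show "c \<le> sq_defect z n (Y \<omega>)"
        unfolding c_def sq_defect_def using s r by (intro power_mono) auto
    qed
    then have "measure M (?A n) \<le> measure M {\<omega> \<in> space M. c \<le> sq_defect z n (Y \<omega>)}"
      using int[of n] by (intro finite_measure_mono) auto
    also have "\<dots> \<le> ?I n / c"
      using integral_Markov_inequality_measure[OF int[of n], of "{}" c] c by (simp add: sq_defect_def)
    finally show ?thesis .
  qed
  have "(\<lambda>n. ?I n / c) \<longlonglongrightarrow> 0 / c"
    using c by (intro tendsto_divide[OF lim tendsto_const]) simp
  then show ?thesis
    unfolding div_0
    by (rule Lim_null_comparison[rotated])
      (simp only: real_norm_def abs_of_nonneg[OF measure_nonneg] markov eventually_True)
qed

theorem corollary9: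
  fixes M :: "'a measure" and X :: "int \<Rightarrow> int \<Rightarrow> 'a \<Rightarrow> real" and \<sigma> :: "int \<Rightarrow> int \<Rightarrow> real"
  assumes "prob_space M"
    and "\<And>i j. X i j \<in> borel_measurable M"
    and "\<And>i j. integrable M (\<lambda>\<omega>. (X i j \<omega>)\<^sup>2)"
    and "\<And>i j. (\<integral>\<omega>. X i j \<omega> \<partial>M) = 0"
    and "\<And>i j. (\<integral>\<omega>. (X i j \<omega>)\<^sup>2 \<partial>M) = (\<sigma> i j)\<^sup>2"
    and "\<And>i j. 1 \<le> j \<Longrightarrow> j \<le> i \<Longrightarrow>
           AE \<omega> in M. real_cond_exp M (past_sigma M X 1 i j) (X i j) \<omega> = 0"
    and "bdd_above ((\<lambda>n. tri_avg n (\<lambda>i j. (\<sigma> i j)\<^sup>2)) ` {1..})"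
    and "(\<lambda>a. limsup (\<lambda>n. ereal (tri_avg n (\<lambda>i j. Lp_norm M 1
           (real_cond_exp M (past_sigma M X a i j) (\<lambda>\<omega>. (X i j \<omega>)\<^sup>2 - (\<sigma> i j)\<^sup>2))))))
         \<longlonglongrightarrow> 0"
    and "\<And>\<epsilon>. \<epsilon> > 0 \<Longrightarrow> (\<lambda>n. tri_avg n (\<lambda>i j.
           \<integral>\<omega>. (X i j \<omega>)\<^sup>2 * of_bool (\<bar>X i j \<omega>\<bar> > \<epsilon> * sqrt (real n)) \<partial>M)) \<longlonglongrightarrow> 0"
    and "(\<lambda>n. tri_avg n (\<lambda>i j. \<bar>(\<sigma> i j)\<^sup>2 - 1\<bar>)) \<longlonglongrightarrow> 0"
  shows "cdf_tendsto_in_prob M (\<lambda>n \<omega>. spectral_cdf (normalized_field_mat X n \<omega>)) semicircle_cdf"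
proof -
  interpret prob_space M by fact
  \<comment> \<open>Matrix positions count from 0, the random field from 1.\<close>
  define Y where "Y = (\<lambda>\<omega> (k, l). X (int k + 1) (int l + 1) \<omega>)"
  define G where "G = (\<lambda>a p. past_sigma M X a (int (fst p) + 1) (int (snd p) + 1))"
  define s where "s = (\<lambda>p. (\<sigma> (int (fst p) + 1) (int (snd p) + 1))^2)"
  have Y_eq: "(\<lambda>\<omega>. Y \<omega> p) = X (int (fst p) + 1) (int (snd p) + 1)" for p
    by (simp add: Y_def case_prod_beta)
  interpret F: martingale_difference_field M Y G s
  proof
    show "(\<lambda>\<omega>. Y \<omega> p) \<in> borel_measurable M" for p unfolding Y_eq by fact
    show "subalgebra M (G a p)" for a p unfolding G_def by (intro subalgebra_past_sigma assms)
    show "(\<lambda>\<omega>. Y \<omega> q) \<in> borel_measurable (G a p)"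
      if "snd q \<le> fst q" "snd p \<le> fst p" "lex_less q p" "int a \<le> sup_dist p q" for a p q
      unfolding Y_eq G_def
      using that by (intro past_sigma_measurable) (auto simp: past_set_def lex_le_def lex_less_def sup_dist_def abs_minus_commute)
    show "integrable M (\<lambda>\<omega>. (Y \<omega> p)^2)" "(\<integral>\<omega>. (Y \<omega> p)^2 \<partial>M) = s p" for p
      using assms(3,5) by (simp_all add: Y_def s_def case_prod_beta)
    show "AE \<omega> in M. real_cond_exp M (G 1 p) (\<lambda>\<omega>. Y \<omega> p) \<omega> = 0" if "snd p \<le> fst p" for p
      unfolding Y_eq G_def using that by (intro assms(6)) auto
  qed
  have lim: "(\<lambda>n. \<integral>\<omega>. sq_defect z n (Y \<omega>) \<partial>M) \<longlonglongrightarrow> 0"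
    and int: "integrable M (\<lambda>\<omega>. sq_defect z n (Y \<omega>))" if z: "0 < Im z" for z n
  proof -
    interpret L: lindeberg_replacement M Y G s z "max 1 (max (1 / \<bar>Im z\<bar>) (cmod z))"
      by unfold_locales (use z in auto)
    show "integrable M (\<lambda>\<omega>. sq_defect z n (Y \<omega>))"
      using L.sign_avg_sq_defect_integrable[of "[]"] by simp
    have avg: "tri_avg n f = L.avg n (\<lambda>p. f (int (fst p) + 1) (int (snd p) + 1))" for n f
      by (simp add: tri_avg_eq L.avg_def)
    obtain S where S: "\<And>n. n \<in> {1..} \<Longrightarrow> tri_avg n (\<lambda>i j. (\<sigma> i j)^2) \<le> S"
      using assms(7) by (auto simp: bdd_above_def)
    show "(\<lambda>n. \<integral>\<omega>. sq_defect z n (Y \<omega>) \<partial>M) \<longlonglongrightarrow> 0"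
    proof (rule L.sq_defect_expectation_tendsto)
      show "L.avg n s \<le> S" if "0 < n" for n using S[of n] that by (simp add: avg s_def)
      show "\<exists>a. \<forall>\<^sub>F n in sequentially. L.avg n (F.memory a) < \<delta>" if "0 < \<delta>" for \<delta>
      proof -
        have m: "L.avg n (F.memory a) = tri_avg n (\<lambda>i j. Lp_norm M 1
           (real_cond_exp M (past_sigma M X a i j) (\<lambda>\<omega>. (X i j \<omega>)^2 - (\<sigma> i j)^2)))" for n a
          unfolding avg F.memory_def[abs_def] Lp_norm_def
          by (simp add: Y_def G_def s_def case_prod_beta)
        have "\<forall>\<^sub>F a in sequentially. limsup (\<lambda>n. ereal (L.avg n (F.memory a))) < ereal \<delta>"
          using order_tendstoD(2)[OF assms(8), of "ereal \<delta>"] that by (simp add: m)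
        then obtain a where "limsup (\<lambda>n. ereal (L.avg n (F.memory a))) < ereal \<delta>"
          using eventually_happens trivial_limit_sequentially by blast
        then have "\<forall>\<^sub>F n in sequentially. ereal (L.avg n (F.memory a)) < ereal \<delta>" by (rule Limsup_lessD)
        then show ?thesis by auto
      qed
      show "(\<lambda>n. L.avg n (F.tail \<epsilon> n)) \<longlonglongrightarrow> 0" if "0 < \<epsilon>" for \<epsilon>
        using assms(9)[OF that] unfolding avg F.tail_def[abs_def] by (simp add: Y_def case_prod_beta)
      show "(\<lambda>n. L.avg n (\<lambda>p. \<bar>s p - 1\<bar>)) \<longlonglongrightarrow> 0"
        using assms(10) unfolding avg by (simp add: s_def)
    qed
  qed
  have spec: "\<exists>ls. length ls = n \<and> spectral_cdf (normalized_field_mat X n \<omega>) = ecdf ls \<and>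
      (\<forall>z. Im z \<noteq> 0 \<longrightarrow> stieltjes z n (Y \<omega>) = list_stieltjes ls z)" for n \<omega>
    by (rule normalized_field_mat_spectrum[of n X \<omega>])
      (auto simp: ecdf_def list_stieltjes_def Y_def fun_eq_iff)
  have nonneg: "0 \<le> Im (stieltjes z n (Y \<omega>))" if "0 < Im z" for z n \<omega>
    using spec[of n \<omega>] list_stieltjes_Im_nonneg[OF that] that by auto
  show ?thesis
    unfolding cdf_tendsto_in_prob_def
  proof (intro allI impI)
    fix \<epsilon> :: real assume e: "0 < \<epsilon>"
    obtain \<eta> where eta: "0 < \<eta>" "\<eta> \<le> 1" "1 - cauchy_cdf \<eta> \<epsilon> \<le> \<epsilon> / 4" "sqrt (7 * \<eta>) + \<eta> \<le> \<epsilon> / 96"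
      using small_scale_exists[OF e] by blast
    obtain T where T: "finite T" and test:
      "\<And>ls s E. ls \<noteq> [] \<Longrightarrow> (\<And>E. E \<in> T \<Longrightarrow> 0 < Im (s E) \<and> defect (Complex E \<eta>) (s E) = 0 \<and>
        cmod (list_stieltjes ls (Complex E \<eta>) - s E) < \<epsilon> / 96) \<Longrightarrow> -3 \<le> E \<Longrightarrow> E \<le> 3 \<Longrightarrow>
      \<bar>Im (list_stieltjes ls (Complex E \<eta>)) / pi - semicircle_density E\<bar> \<le> \<epsilon> / 24"
      using finite_test_points[OF e eta(1,2,4)] by blast
    have "\<exists>s. 0 < Im s \<and> (\<forall>w. 0 \<le> Im w \<longrightarrow> Im s * cmod (w - s) \<le> (cmod s)^2 * cmod (defect (Complex E \<eta>) w)) \<and>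
        defect (Complex E \<eta>) s = 0" for E
      by (rule defect_root[of "Complex E \<eta>"]) (use eta(1) in auto)
    then obtain r where r: "\<And>E. 0 < Im (r E)" "\<And>E. defect (Complex E \<eta>) (r E) = 0"
      "\<And>E w. 0 \<le> Im w \<Longrightarrow> Im (r E) * cmod (w - r E) \<le> (cmod (r E))^2 * cmod (defect (Complex E \<eta>) w)"
      by metis
    define bad where "bad = (\<lambda>n E. {\<omega> \<in> space M. \<epsilon> / 96 \<le> cmod (stieltjes (Complex E \<eta>) n (Y \<omega>) - r E)})"
    have bad_sets: "bad n E \<in> sets M" for n E
    proof -
      have [measurable]: "(\<lambda>\<omega>. stieltjes (Complex E \<eta>) n (Y \<omega>)) \<in> borel_measurable M"
        by (rule measurable_outsideD[OF stieltjes_measurable]) simp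
      show ?thesis unfolding bad_def by measurable
    qed
    have "(\<lambda>n. measure M (bad n E)) \<longlonglongrightarrow> 0" for E
      unfolding bad_def using eta(1) e
      by (intro stieltjes_tendsto_in_prob[OF assms(1) F.Y_measurable _ r(1) r(3) nonneg int lim]) auto
    then have sum0: "(\<lambda>n. \<Sum>E\<in>T. measure M (bad n E)) \<longlonglongrightarrow> 0"
      by (rule tendsto_null_sum)
    let ?ev = "\<lambda>n. {\<omega> \<in> space M. \<epsilon> < levy_dist (spectral_cdf (normalized_field_mat X n \<omega>)) semicircle_cdf}"
    have bound: "measure M (?ev n) \<le> (\<Sum>E\<in>T. measure M (bad n E))" if n: "0 < n" for n
    proof -
      have "?ev n \<subseteq> (\<Union>E\<in>T. bad n E)"
      proof (intro subsetI, rule ccontr)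
        fix \<omega> assume ev: "\<omega> \<in> ?ev n" and good: "\<omega> \<notin> (\<Union>E\<in>T. bad n E)"
        obtain ls where ls: "length ls = n" "spectral_cdf (normalized_field_mat X n \<omega>) = ecdf ls"
          "\<And>z. Im z \<noteq> 0 \<Longrightarrow> stieltjes z n (Y \<omega>) = list_stieltjes ls z" using spec by blast
        have "ls \<noteq> []" using ls(1) n by auto
        moreover have "cmod (list_stieltjes ls (Complex E \<eta>) - r E) < \<epsilon> / 96" if "E \<in> T" for E
          using good ev that ls(3)[of "Complex E \<eta>"] eta(1) by (auto simp: bad_def not_le)
        ultimately have "levy_dist (ecdf ls) semicircle_cdf \<le> \<epsilon>"
          using r(1,2) eta e by (intro levy_dist_le[where \<theta> = "\<epsilon> / 24" and \<eta> = \<eta>] test) auto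
        then show False using ev ls(2) by simp
      qed
      \<comment> \<open>A set outside the \<open>\<sigma>\<close>-algebra has measure 0 by convention, so the bound holds for it too.\<close>
      then have "measure M (?ev n) \<le> measure M (\<Union>E\<in>T. bad n E)"
        using bad_sets T
        by (cases "?ev n \<in> sets M") (auto intro!: finite_measure_mono simp: measure_notin_sets)
      also have "\<dots> \<le> (\<Sum>E\<in>T. measure M (bad n E))"
        using bad_sets T by (intro finite_measure_subadditive_finite) auto
      finally show ?thesis .
    qed
    have "\<forall>\<^sub>F n in sequentially. measure M (?ev n) \<le> (\<Sum>E\<in>T. measure M (bad n E))"
      using eventually_gt_at_top[of "0::nat"] by (rule eventually_mono) (rule bound)
    then show "(\<lambda>n. measure M (?ev n)) \<longlonglongrightarrow> 0"
      by (intro Lim_null_comparison[OF _ sum0]) (simp only: real_norm_def abs_of_nonneg[OF measure_nonneg])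
  qed
qed

end
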